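(* The Maximum Induced Matching problem for hypertrees is $\mathbb{NP}$-complete.
   Context: A hypergraph $H=(V,\mathcal{E})$ has a finite vertex set $V$ and a (multi)set $\mathcal{E}$ of subsets of $V$. Its line graph $L(H)$ has vertex set $\mathcal{E}$, two hyperedges adjacent iff they intersect; for a graph $G$, $G^2$ has the same vertices with two vertices adjacent iff their distance in $G$ is 1 or 2. A set $M\subseteq\mathcal{E}$ is an induced matching of $H$ if it is an independent set in $L(H)^2$; the (decision) Maximum Induced Matching problem asks, given $H$ and an integer $k$, whether $H$ has an induced matching of size at least $k$. $H$ is a hypertree if there is a tree $T$ with vertex set $V$ such that for every $e\in\mathcal{E}$ the induced subgraph $T[e]$ is connected. *)

theory Defs
  imports Main "HOL-Library.Extended_Nat" "HOL-Computational_Algebra.Polynomial"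
begin

section \<open>Graphs\<close>

record 'a graph =
  verts :: "'a set"
  adj :: "('a \<times> 'a) set"

definition simple_graph :: "'a graph \<Rightarrow> bool" where
  "simple_graph G \<longleftrightarrow>
     finite (verts G) \<and> adj G \<subseteq> verts G \<times> verts G \<and> sym (adj G) \<and> irrefl (adj G)"

definition induced_subgraph :: "'a graph \<Rightarrow> 'a set \<Rightarrow> 'a graph" where
  "induced_subgraph G S = \<lparr>verts = verts G \<inter> S, adj = adj G \<inter> (S \<times> S)\<rparr>"

text \<open>The length of a shortest walk, and \<open>\<infinity>\<close> if there is none.\<close>

definition distance :: "'a graph \<Rightarrow> 'a \<Rightarrow> 'a \<Rightarrow> enat" where
  "distance G u v = (INF n \<in> {n. (u, v) \<in> adj G ^^ n}. enat n)"

definition graph_square :: "'a graph \<Rightarrow> 'a graph" where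
  "graph_square G =
     \<lparr>verts = verts G,
      adj = {(u, v). u \<in> verts G \<and> v \<in> verts G \<and> (distance G u v = 1 \<or> distance G u v = 2)}\<rparr>"

definition independent_set :: "'a graph \<Rightarrow> 'a set \<Rightarrow> bool" where
  "independent_set G S \<longleftrightarrow> S \<subseteq> verts G \<and> (\<forall>u\<in>S. \<forall>v\<in>S. (u, v) \<notin> adj G)"

text \<open>The graph without vertices is not connected.\<close>

definition connected_graph :: "'a graph \<Rightarrow> bool" where
  "connected_graph G \<longleftrightarrow>
     verts G \<noteq> {} \<and> (\<forall>u\<in>verts G. \<forall>v\<in>verts G. (u, v) \<in> (adj G)\<^sup>*)"

definition graph_cycle :: "'a graph \<Rightarrow> 'a list \<Rightarrow> bool" where
  "graph_cycle G vs \<longleftrightarrow>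
     3 \<le> length vs \<and> distinct vs \<and> set vs \<subseteq> verts G \<and>
     (\<forall>i<length vs. (vs ! i, vs ! (Suc i mod length vs)) \<in> adj G)"

definition tree :: "'a graph \<Rightarrow> bool" where
  "tree T \<longleftrightarrow> simple_graph T \<and> connected_graph T \<and> (\<nexists>vs. graph_cycle T vs)"


section \<open>Hypergraphs and induced matchings\<close>

text \<open>The multiset of hyperedges is given as a list, whose order is irrelevant. A hyperedge is
  identified by its position, so that equal hyperedges remain distinct vertices of the line graph.\<close>

record 'a hypergraph =
  hverts :: "'a set"
  hedges :: "'a set list"

definition is_hypergraph :: "'a hypergraph \<Rightarrow> bool" where
  "is_hypergraph H \<longleftrightarrow> finite (hverts H) \<and> (\<forall>e\<in>set (hedges H). e \<subseteq> hverts H)"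

definition line_graph :: "'a hypergraph \<Rightarrow> nat graph" where
  "line_graph H =
     \<lparr>verts = {..<length (hedges H)},
      adj = {(i, j). i < length (hedges H) \<and> j < length (hedges H) \<and> i \<noteq> j \<and>
                     hedges H ! i \<inter> hedges H ! j \<noteq> {}}\<rparr>"

definition induced_matching :: "'a hypergraph \<Rightarrow> nat set \<Rightarrow> bool" where
  "induced_matching H M \<longleftrightarrow> independent_set (graph_square (line_graph H)) M"

definition hypertree :: "'a hypergraph \<Rightarrow> bool" where
  "hypertree H \<longleftrightarrow>
     is_hypergraph H \<and>
     (\<exists>T. tree T \<and> verts T = hverts H \<and>
          (\<forall>e\<in>set (hedges H). connected_graph (induced_subgraph T e)))"

definition maximum_induced_matching :: "'a hypergraph \<Rightarrow> nat \<Rightarrow> bool" where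
  "maximum_induced_matching H k \<longleftrightarrow> (\<exists>M. induced_matching H M \<and> k \<le> card M)"


section \<open>Multi-tape Turing machines\<close>

text \<open>Every tape is infinite in both directions. Symbols are natural numbers: 0 is the blank,
  1 and 2 are the two bits. The control states are \<open>0, \<dots>, Q\<close> with \<open>Q = tm_halt M\<close>, where 0 is
  the initial and \<open>Q\<close> the only halting state. The transition function is relevant only for the
  finitely many arguments constrained by \<open>turing_machine\<close>.\<close>

datatype move = Move_Left | Stay | Move_Right

record tm =
  tm_tapes :: nat
  tm_symbols :: nat
  tm_halt :: nat
  tm_delta :: "nat \<Rightarrow> nat list \<Rightarrow> nat \<times> (nat \<times> move) list"

definition turing_machine :: "tm \<Rightarrow> bool" where
  "turing_machine M \<longleftrightarrow>
     0 < tm_tapes M \<and> 3 \<le> tm_symbols M \<and>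
     (\<forall>q ss. q < tm_halt M \<and> length ss = tm_tapes M \<and> set ss \<subseteq> {..<tm_symbols M} \<longrightarrow>
        (case tm_delta M q ss of (q', as) \<Rightarrow>
           q' \<le> tm_halt M \<and> length as = tm_tapes M \<and> fst ` set as \<subseteq> {..<tm_symbols M}))"

text \<open>A tape consists of its contents and its head position.\<close>

type_synonym tape = "(int \<Rightarrow> nat) \<times> int"
type_synonym config = "nat \<times> tape list"

fun read_tape :: "tape \<Rightarrow> nat" where
  "read_tape (f, p) = f p"

fun move_head :: "move \<Rightarrow> int \<Rightarrow> int" where
  "move_head Move_Left p = p - 1"
| "move_head Stay p = p"
| "move_head Move_Right p = p + 1"

fun act_tape :: "nat \<times> move \<Rightarrow> tape \<Rightarrow> tape" where
  "act_tape (a, d) (f, p) = (f(p := a), move_head d p)"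

fun tm_step :: "tm \<Rightarrow> config \<Rightarrow> config" where
  "tm_step M (q, ts) =
     (if q < tm_halt M
      then (case tm_delta M q (map read_tape ts) of (q', as) \<Rightarrow> (q', map2 act_tape as ts))
      else (q, ts))"

definition bit_symbol :: "bool \<Rightarrow> nat" where
  "bit_symbol b = (if b then 2 else 1)"

definition input_tape :: "bool list \<Rightarrow> tape" where
  "input_tape x =
     (\<lambda>i. if 0 \<le> i \<and> i < int (length x) then bit_symbol (x ! nat i) else 0, 0)"

text \<open>The inputs are written on the first tapes, one word per tape; all other tapes are blank.\<close>

definition tm_init :: "tm \<Rightarrow> bool list list \<Rightarrow> config" where
  "tm_init M xs = (0, map input_tape (xs @ replicate (tm_tapes M - length xs) []))"

text \<open>The output is the word on the last tape that starts in cell 0 and ends before the first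
  blank. A halted configuration no longer changes, so halting at time \<open>t\<close> means halting after at
  most \<open>t\<close> steps.\<close>

definition tape_holds :: "tape \<Rightarrow> bool list \<Rightarrow> bool" where
  "tape_holds tp y \<longleftrightarrow>
     (\<forall>i<length y. fst tp (int i) = bit_symbol (y ! i)) \<and> fst tp (int (length y)) = 0"

definition tm_computes :: "tm \<Rightarrow> bool list list \<Rightarrow> bool list \<Rightarrow> nat \<Rightarrow> bool" where
  "tm_computes M xs y t \<longleftrightarrow>
     length xs \<le> tm_tapes M \<and>
     (case (tm_step M ^^ t) (tm_init M xs) of (q, ts) \<Rightarrow>
        q = tm_halt M \<and> tape_holds (last ts) y)"


section \<open>NP-completeness\<close>

definition polytime_function :: "(bool list \<Rightarrow> bool list) \<Rightarrow> bool" where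
  "polytime_function f \<longleftrightarrow>
     (\<exists>M (p :: nat poly). turing_machine M \<and>
        (\<forall>x. tm_computes M [x] (f x) (poly p (length x))))"

definition polytime_relation :: "(bool list \<Rightarrow> bool list \<Rightarrow> bool) \<Rightarrow> bool" where
  "polytime_relation R \<longleftrightarrow>
     (\<exists>M (p :: nat poly). turing_machine M \<and>
        (\<forall>x w. tm_computes M [x, w] [R x w] (poly p (length x + length w))))"

definition in_NP :: "bool list set \<Rightarrow> bool" where
  "in_NP L \<longleftrightarrow>
     (\<exists>R (p :: nat poly). polytime_relation R \<and>
        (\<forall>x. x \<in> L \<longleftrightarrow> (\<exists>w. length w \<le> poly p (length x) \<and> R x w)))"

definition polytime_reducible :: "bool list set \<Rightarrow> bool list set \<Rightarrow> bool" where
  "polytime_reducible L L' \<longleftrightarrow> (\<exists>f. polytime_function f \<and> (\<forall>x. x \<in> L \<longleftrightarrow> f x \<in> L'))"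

definition NP_hard :: "bool list set \<Rightarrow> bool" where
  "NP_hard L \<longleftrightarrow> (\<forall>L'. in_NP L' \<longrightarrow> polytime_reducible L' L)"

definition NP_complete :: "bool list set \<Rightarrow> bool" where
  "NP_complete L \<longleftrightarrow> in_NP L \<and> NP_hard L"


section \<open>Problem instances as bit strings\<close>

text \<open>Binary representation, least significant bit first and without leading zeros.\<close>

fun binary :: "nat \<Rightarrow> bool list" where
  "binary n = (if n = 0 then [] else odd n # binary (n div 2))"

declare binary.simps [simp del]

text \<open>The vertices are \<open>0, \<dots>, n - 1\<close> and the hyperedges are given by the rows of the incidence
  matrix. The word is \<open>n\<close> in unary, a 0, for every hyperedge a 1 followed by its row, a 0, and
  \<open>k\<close> in binary.\<close>

definition encode_instance :: "nat \<Rightarrow> nat set list \<Rightarrow> nat \<Rightarrow> bool list" where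
  "encode_instance n es k =
     replicate n True @ [False] @
     concat (map (\<lambda>e. True # map (\<lambda>v. v \<in> e) [0..<n]) es) @ [False] @
     binary k"

lemma binary_inject: "binary m = binary n \<Longrightarrow> m = n"
proof (induction m arbitrary: n rule: less_induct)
  case (less m)
  show ?case
  proof (cases "m = 0 \<or> n = 0")
    case True
    then show ?thesis
      using less.prems by (auto simp: binary.simps[of m] binary.simps[of n] split: if_splits)
  next
    case False
    then have "odd m = odd n" and "binary (m div 2) = binary (n div 2)"
      using less.prems by (simp_all add: binary.simps[of m] binary.simps[of n])
    moreover from this(2) have "m div 2 = n div 2"
      using False by (intro less.IH) auto
    ultimately show ?thesis
      by (metis odd_iff_mod_2_eq_one even_iff_mod_2_eq_zero mult_div_mod_eq)
  qed
qed

lemma replicate_True_inject: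
  "replicate m True @ False # xs = replicate n True @ False # ys \<Longrightarrow> m = n \<and> xs = ys"
proof (induction m arbitrary: n)
  case 0
  then show ?case by (cases n) auto
next
  case (Suc m)
  then show ?case by (cases n) auto
qed

lemma encode_instance_inject:
  assumes "encode_instance n es k = encode_instance n' es' k'"
    and "\<forall>e\<in>set es. e \<subseteq> {..<n}" and "\<forall>e\<in>set es'. e \<subseteq> {..<n'}"
  shows "n = n' \<and> es = es' \<and> k = k'"
proof -
  let ?row = "\<lambda>e. map (\<lambda>v. v \<in> e) [0..<n]"
  let ?rows = "\<lambda>es. concat (map (\<lambda>e. True # ?row e) es)"
  have row: "e = e'" if "?row e = ?row e'" "e \<subseteq> {..<n}" "e' \<subseteq> {..<n}" for e e'
  proof -
    have "\<forall>v<n. v \<in> e \<longleftrightarrow> v \<in> e'"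
      using that(1) by (simp add: list_eq_iff_nth_eq)
    then show ?thesis using that(2,3) by auto
  qed
  have rows: "es = es' \<and> zs = zs'"
    if "?rows es @ False # zs = ?rows es' @ False # zs'"
      "\<forall>e\<in>set es. e \<subseteq> {..<n}" "\<forall>e\<in>set es'. e \<subseteq> {..<n}" for es es' zs zs'
    using that
  proof (induction es arbitrary: es')
    case Nil
    then show ?case by (cases es') auto
  next
    case (Cons e es)
    then obtain e' es'' where [simp]: "es' = e' # es''" by (cases es') auto
    have "?row e = ?row e'" and eq: "?rows es @ False # zs = ?rows es'' @ False # zs'"
      using Cons.prems(1) by auto
    then show ?case
      using Cons.IH[OF eq] Cons.prems(2,3) row[of e e'] by auto
  qed
  have n: "n = n'"
    using assms(1) replicate_True_inject unfolding encode_instance_def append_Cons append_Nil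
    by blast
  then have "?rows es @ False # binary k = ?rows es' @ False # binary k'"
    using assms(1) by (simp add: encode_instance_def)
  then show ?thesis
    using rows[of es "binary k" es' "binary k'"] assms(2,3) n binary_inject by auto
qed

definition mim_hypertree :: "bool list set" where
  "mim_hypertree =
     {encode_instance n es k | n es k.
        hypertree \<lparr>hverts = {..<n}, hedges = es\<rparr> \<and>
        maximum_induced_matching \<lparr>hverts = {..<n}, hedges = es\<rparr> k}"

end

theory Submission
  imports Defs
begin

text \<open>Membership in NP: a tree is certified by the parent and the depth of every vertex, and a set of
  vertices is connected iff exactly one of its vertices has no parent in the set.

  Hardness: from a verifying Turing machine and an input we construct a graph whose vertices are the
  possible local views of the computation (time, tape, state and symbols read, head position, time of
  the last visit of the cell) and whose edges are the pairs of incompatible views. Since the symbol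
  read is determined by the last visit, all conditions on a computation concern pairs of views, and
  the accepting computations correspond to the independent sets of the largest conceivable size.
  Independent sets of a graph on \<open>{0, \<dots>, N - 1}\<close> are induced matchings of a hypergraph on a star with
  centre \<open>N\<close>: its hyperedges are the singletons \<open>{u}\<close>, the sets \<open>{N, u}\<close> and, for every edge, the set
  \<open>{N, u, v}\<close>.

  Polynomial time: the verifier and the reduction are definable by bounded sums, hence computed by
  nested loops over unary counters, and the head positions of a Turing machine are such counters.\<close>

section \<open>Counter programs\<close>

text \<open>An encoded instance contains no tree, so membership has to guess one. Ranks that
  strictly decrease along parents turn both acyclicity and connectivity into local checks, whereas
  reachability would call for a search. On the hardness side the obstacle is that a local rule of a
  computation relates all tapes at once, while a graph sees only pairs. A view therefore carries the
  symbols read on all tapes: next state, written symbols and head movements are then functions of a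
  single view. Views for the same time and tape conflict, so with \<open>T + 2\<close> times and
  \<open>K\<close> tapes an independent set of size \<open>(T + 2) * K\<close> has exactly one view
  for each pair. The witness word is not part of the graph; its bits are the symbols met at the
  first visits of cells of the second tape. The machine is fixed in the reduction, so its transition
  table is a constant, and a view is a number with six digits in a base that is polynomial in the
  input length. All numbers that occur are thus polynomially bounded, which is why unary counters
  are enough even though \<open>k\<close> is written in binary.\<close>

text \<open>The head positions of the tapes serve as counters: an input tape is only read, and every other
  tape except the output tape carries a single mark in cell 0, which allows to test for zero. The
  instruction \<open>CMove j A d r\<close> moves head \<open>d\<close> one step to the right (\<open>r\<close>) or to the left if head \<open>j\<close>
  reads a symbol in \<open>A\<close>, and \<open>Emit j A\<close> appends to the output whether this is the case. The last
  argument of \<open>exec\<close> is an upper bound on the running time.\<close>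

datatype cmd =
    CMove nat "nat set" nat bool
  | Emit nat "nat set"
  | Seq cmd cmd  (infixr \<open>;;\<close> 60)
  | While nat "nat set" cmd

fun width :: "cmd \<Rightarrow> nat" where
  "width (CMove j A d r) = max (Suc j) (Suc d)"
| "width (Emit j A) = Suc j"
| "width (c1 ;; c2) = max (width c1) (width c2)"
| "width (While j A c) = max (Suc j) (width c)"

text \<open>A counter tape shows 1 in cell 0 and 0 elsewhere, so reading 0 means that the counter is
  positive. An input tape shows 0 past the end of its word.\<close>

definition rd :: "bool list list \<Rightarrow> nat \<Rightarrow> nat \<Rightarrow> nat" where
  "rd I j p = (if j < length I then (if p < length (I ! j) then bit_symbol (I ! j ! p) else 0)
               else of_bool (p = 0))"

text \<open>A move to the left that takes effect requires a positive position; this keeps the heads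
  out of the negative cells and the positions in \<open>nat\<close>.\<close>

inductive exec :: "bool list list \<Rightarrow> cmd \<Rightarrow> (nat \<Rightarrow> nat) \<Rightarrow> bool list \<Rightarrow>
    (nat \<Rightarrow> nat) \<Rightarrow> bool list \<Rightarrow> nat \<Rightarrow> bool" for I where
  exec_CMove: "1 \<le> t \<Longrightarrow> (rd I j (s j) \<in> A \<Longrightarrow> \<not> r \<Longrightarrow> 0 < s d) \<Longrightarrow>
     s' = (if rd I j (s j) \<in> A then s(d := if r then Suc (s d) else s d - 1) else s) \<Longrightarrow>
     exec I (CMove j A d r) s y s' y t"
| exec_Emit: "1 \<le> t \<Longrightarrow> y' = y @ [rd I j (s j) \<in> A] \<Longrightarrow> exec I (Emit j A) s y s y' t"
| exec_Seq: "exec I c1 s y s1 y1 t1 \<Longrightarrow> exec I c2 s1 y1 s2 y2 t2 \<Longrightarrow> t1 + t2 \<le> t \<Longrightarrow>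
     exec I (c1 ;; c2) s y s2 y2 t"
| exec_While_False: "rd I j (s j) \<notin> A \<Longrightarrow> 1 \<le> t \<Longrightarrow> exec I (While j A c) s y s y t"
| exec_While_True: "rd I j (s j) \<in> A \<Longrightarrow> exec I c s y s1 y1 t1 \<Longrightarrow>
     exec I (While j A c) s1 y1 s2 y2 t2 \<Longrightarrow> Suc (t1 + t2) \<le> t \<Longrightarrow>
     exec I (While j A c) s y s2 y2 t"

lemma exec_mono: "exec I c s y s' y' t \<Longrightarrow> t \<le> t' \<Longrightarrow> exec I c s y s' y' t'"
  by (cases rule: exec.cases) (auto intro: exec.intros)

definition prim_tm :: "nat \<Rightarrow> (nat list \<Rightarrow> (nat \<times> move) list) \<Rightarrow> tm" where
  "prim_tm K g = \<lparr>tm_tapes = Suc K, tm_symbols = 3, tm_halt = 1, tm_delta = \<lambda>q ss. (1, g ss)\<rparr>"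

text \<open>The halting state of the first machine is the initial state of the second one.\<close>

definition seq_tm :: "tm \<Rightarrow> tm \<Rightarrow> tm" where
  "seq_tm M M' = \<lparr>tm_tapes = tm_tapes M, tm_symbols = 3, tm_halt = tm_halt M + tm_halt M',
     tm_delta = \<lambda>q ss. if q < tm_halt M then tm_delta M q ss
       else (case tm_delta M' (q - tm_halt M) ss of (q', as) \<Rightarrow> (q' + tm_halt M, as))\<rparr>"

text \<open>In the loop, state 0 is the test and \<open>Suc q\<close> plays state \<open>q\<close>
  of the body, except that the halting state of the body is identified with the test. The number
  \<open>Suc (tm_halt M)\<close> is thereby free for the exit.\<close>

definition loop_state :: "tm \<Rightarrow> nat \<Rightarrow> nat" where
  "loop_state M q = (if q = tm_halt M then 0 else Suc q)"

definition while_tm :: "nat \<Rightarrow> nat set \<Rightarrow> tm \<Rightarrow> tm" where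
  "while_tm j A M = \<lparr>tm_tapes = tm_tapes M, tm_symbols = 3, tm_halt = Suc (tm_halt M),
     tm_delta = \<lambda>q ss. case q of
         0 \<Rightarrow> (if ss ! j \<in> A then loop_state M 0 else Suc (tm_halt M), map (\<lambda>a. (a, Stay)) ss)
       | Suc q \<Rightarrow> (case tm_delta M q ss of (q', as) \<Rightarrow> (loop_state M q', as))\<rparr>"

fun compile :: "nat \<Rightarrow> cmd \<Rightarrow> tm" where
  "compile K (CMove j A d r) = prim_tm K (\<lambda>ss. map (\<lambda>i. (ss ! i,
      if i = d \<and> ss ! j \<in> A then (if r then Move_Right else Move_Left) else Stay)) [0..<Suc K])"
| "compile K (Emit j A) = prim_tm K (\<lambda>ss. map (\<lambda>i.
      if i = K then (bit_symbol (ss ! j \<in> A), Move_Right) else (ss ! i, Stay)) [0..<Suc K])"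
| "compile K (c1 ;; c2) = seq_tm (compile K c1) (compile K c2)"
| "compile K (While j A c) = while_tm j A (compile K c)"

lemma turing_machine_seq_tm:
  assumes "turing_machine M" "turing_machine M'" "tm_tapes M = tm_tapes M'"
    and "tm_symbols M = 3" "tm_symbols M' = 3"
  shows "turing_machine (seq_tm M M')"
  unfolding turing_machine_def
proof (intro conjI allI impI)
  fix q ss
  assume *: "q < tm_halt (seq_tm M M') \<and> length ss = tm_tapes (seq_tm M M') \<and>
    set ss \<subseteq> {..<tm_symbols (seq_tm M M')}"
  show "case tm_delta (seq_tm M M') q ss of (q', as) \<Rightarrow> q' \<le> tm_halt (seq_tm M M') \<and>
    length as = tm_tapes (seq_tm M M') \<and> fst ` set as \<subseteq> {..<tm_symbols (seq_tm M M')}"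
  proof (cases "q < tm_halt M")
    case True
    then have "case tm_delta M q ss of (q', as) \<Rightarrow>
      q' \<le> tm_halt M \<and> length as = tm_tapes M \<and> fst ` set as \<subseteq> {..<tm_symbols M}"
      using assms * by (simp add: turing_machine_def seq_tm_def)
    then show ?thesis using True assms by (auto simp: seq_tm_def split: prod.splits)
  next
    case False
    then have "q - tm_halt M < tm_halt M'" using * by (simp add: seq_tm_def) linarith
    then have "case tm_delta M' (q - tm_halt M) ss of (q', as) \<Rightarrow>
      q' \<le> tm_halt M' \<and> length as = tm_tapes M' \<and> fst ` set as \<subseteq> {..<tm_symbols M'}"
      using assms * by (simp add: turing_machine_def seq_tm_def)
    then show ?thesis using False assms by (auto simp: seq_tm_def split: prod.splits)
  qed
qed (use assms in \<open>auto simp: turing_machine_def seq_tm_def\<close>)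

lemma turing_machine_while_tm:
  assumes "turing_machine M" "tm_symbols M = 3"
  shows "turing_machine (while_tm j A M)"
  unfolding turing_machine_def
proof (intro conjI allI impI)
  fix q ss
  assume *: "q < tm_halt (while_tm j A M) \<and> length ss = tm_tapes (while_tm j A M) \<and>
    set ss \<subseteq> {..<tm_symbols (while_tm j A M)}"
  show "case tm_delta (while_tm j A M) q ss of (q', as) \<Rightarrow> q' \<le> tm_halt (while_tm j A M) \<and>
    length as = tm_tapes (while_tm j A M) \<and> fst ` set as \<subseteq> {..<tm_symbols (while_tm j A M)}"
  proof (cases q)
    case 0
    then show ?thesis using * by (auto simp: while_tm_def loop_state_def)
  next
    case (Suc q0)
    then have "case tm_delta M q0 ss of (q', as) \<Rightarrow>
      q' \<le> tm_halt M \<and> length as = tm_tapes M \<and> fst ` set as \<subseteq> {..<tm_symbols M}"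
      using assms * by (simp add: turing_machine_def while_tm_def)
    then show ?thesis using Suc assms
      by (auto simp: while_tm_def loop_state_def split: prod.splits)
  qed
qed (use assms in \<open>auto simp: turing_machine_def while_tm_def\<close>)

lemma turing_machine_prim_tm:
  assumes "\<And>ss. length ss = Suc K \<Longrightarrow> set ss \<subseteq> {..<3} \<Longrightarrow>
    length (g ss) = Suc K \<and> fst ` set (g ss) \<subseteq> {..<3}"
  shows "turing_machine (prim_tm K g)"
  using assms by (auto simp: turing_machine_def prim_tm_def)

lemma tm_tapes_compile [simp]: "tm_tapes (compile K c) = Suc K"
  by (induction c) (auto simp: prim_tm_def seq_tm_def while_tm_def)

lemma tm_symbols_compile [simp]: "tm_symbols (compile K c) = 3"
  by (induction c) (auto simp: prim_tm_def seq_tm_def while_tm_def)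

lemma turing_machine_compile: "turing_machine (compile K c)"
proof (induction c)
  case (CMove j A d r)
  show ?case
    unfolding compile.simps
    by (rule turing_machine_prim_tm) (auto simp: subset_iff simp del: upt_Suc)
next
  case (Emit j A)
  show ?case
    unfolding compile.simps
    by (rule turing_machine_prim_tm) (auto simp: subset_iff bit_symbol_def simp del: upt_Suc)
qed (auto intro: turing_machine_seq_tm turing_machine_while_tm)

section \<open>Correctness of the compilation\<close>

lemma tm_steps_halted: "\<not> q < tm_halt M \<Longrightarrow> (tm_step M ^^ t) (q, ts) = (q, ts)"
  by (induction t) auto

text \<open>In its halting state \<open>M\<close> stands still, but \<open>seq_tm M M'\<close> goes
  on with \<open>M'\<close>. The simulation must therefore stop at the first halting time, which may
  be earlier than \<open>t\<close>.\<close>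

lemma seq_tm_first:
  "(tm_step M ^^ t) (q, ts) = (tm_halt M, ts') \<Longrightarrow>
   \<exists>t'\<le>t. (tm_step (seq_tm M M') ^^ t') (q, ts) = (tm_halt M, ts')"
proof (induction t arbitrary: q ts)
  case (Suc t)
  show ?case
  proof (cases "q < tm_halt M")
    case True
    obtain q1 ts1 where 1: "tm_step M (q, ts) = (q1, ts1)" by (cases "tm_step M (q, ts)")
    then have "(tm_step M ^^ t) (q1, ts1) = (tm_halt M, ts')"
      using Suc.prems by (simp add: funpow_Suc_right del: funpow.simps)
    from Suc.IH[OF this] obtain t' where
      "t' \<le> t" "(tm_step (seq_tm M M') ^^ t') (q1, ts1) = (tm_halt M, ts')" by auto
    moreover have "tm_step (seq_tm M M') (q, ts) = (q1, ts1)"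
      using 1 True by (auto simp: seq_tm_def)
    ultimately show ?thesis
      by (intro exI[of _ "Suc t'"]) (auto simp: funpow_Suc_right simp del: funpow.simps)
  next
    case False
    then show ?thesis using Suc.prems tm_steps_halted[OF False] by (intro exI[of _ 0]) auto
  qed
qed auto

text \<open>Adding \<open>tm_halt M\<close> to the state commutes with every step, including the
  idle steps of a halted \<open>M'\<close>, so here the number of steps is exact.\<close>

lemma seq_tm_second:
  "(tm_step M' ^^ t) (q, ts) = (q', ts') \<Longrightarrow>
   (tm_step (seq_tm M M') ^^ t) (tm_halt M + q, ts) = (tm_halt M + q', ts')"
proof (induction t arbitrary: q' ts')
  case (Suc t)
  obtain q1 ts1 where 1: "(tm_step M' ^^ t) (q, ts) = (q1, ts1)"
    by (cases "(tm_step M' ^^ t) (q, ts)")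
  then show ?case using Suc.IH[OF 1] Suc.prems
    by (auto simp: seq_tm_def split: if_splits prod.splits)
qed auto

text \<open>Again only the first halting time of the body counts, because the loop machine would go
  on with its test.\<close>

lemma while_tm_body:
  "(tm_step M ^^ t) (q, ts) = (tm_halt M, ts') \<Longrightarrow>
   \<exists>t'\<le>t. (tm_step (while_tm j A M) ^^ t') (loop_state M q, ts) = (0, ts')"
proof (induction t arbitrary: q ts)
  case (Suc t)
  show ?case
  proof (cases "q < tm_halt M")
    case True
    obtain q1 ts1 where 1: "tm_step M (q, ts) = (q1, ts1)" by (cases "tm_step M (q, ts)")
    then have "(tm_step M ^^ t) (q1, ts1) = (tm_halt M, ts')"
      using Suc.prems by (simp add: funpow_Suc_right del: funpow.simps)
    from Suc.IH[OF this] obtain t' where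
      "t' \<le> t" "(tm_step (while_tm j A M) ^^ t') (loop_state M q1, ts1) = (0, ts')" by auto
    moreover have "tm_step (while_tm j A M) (loop_state M q, ts) = (loop_state M q1, ts1)"
      using 1 True by (auto simp: while_tm_def loop_state_def split: prod.splits)
    ultimately show ?thesis
      by (intro exI[of _ "Suc t'"]) (auto simp: funpow_Suc_right simp del: funpow.simps)
  next
    case False
    then show ?thesis using Suc.prems tm_steps_halted[OF False]
      by (intro exI[of _ 0]) (auto simp: loop_state_def)
  qed
qed (auto simp: loop_state_def)

definition content :: "bool list list \<Rightarrow> nat \<Rightarrow> int \<Rightarrow> nat" where
  "content I j = (if j < length I then fst (input_tape (I ! j)) else (\<lambda>i. of_bool (i = 0)))"

text \<open>The last tape is the output, with its head on the first blank after the word written so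
  far. A program of width at most \<open>K\<close> affects it only through
  \<open>Emit\<close>.\<close>

definition tapes :: "nat \<Rightarrow> bool list list \<Rightarrow> (nat \<Rightarrow> nat) \<Rightarrow> bool list \<Rightarrow> tape list" where
  "tapes K I s y =
     map (\<lambda>j. (content I j, int (s j))) [0..<K] @ [(fst (input_tape y), int (length y))]"

lemma length_tapes [simp]: "length (tapes K I s y) = Suc K"
  by (simp add: tapes_def)

lemma nth_tapes:
  "i < Suc K \<Longrightarrow> tapes K I s y ! i =
     (if i = K then (fst (input_tape y), int (length y)) else (content I i, int (s i)))"
  by (auto simp: tapes_def nth_append)

lemma content_rd: "content I j (int p) = rd I j p"
  by (auto simp: content_def rd_def input_tape_def)

lemma nth_read_tapes:
  "i < Suc K \<Longrightarrow> read_tape (tapes K I s y ! i) = (if i = K then 0 else rd I i (s i))"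
  by (auto simp: nth_tapes content_rd input_tape_def)

lemma act_tape_Stay: "act_tape (read_tape tp, Stay) tp = tp"
  by (cases tp) auto

lemma map2_Stay: "map2 act_tape (map ((\<lambda>a. (a, Stay)) \<circ> read_tape) ts) ts = ts"
  by (induction ts) (auto simp: act_tape_Stay)

lemma input_tape_snoc:
  "(fst (input_tape y))(int (length y) := bit_symbol b) = fst (input_tape (y @ [b]))"
  by (rule ext) (auto simp: input_tape_def nth_append)

lemma prim_tm_step:
  assumes "map2 act_tape (g (map read_tape ts)) ts = ts'" "1 \<le> t"
  shows "\<exists>t'\<le>t. (tm_step (prim_tm K g) ^^ t') (0, ts) = (tm_halt (prim_tm K g), ts')"
  using assms by (intro exI[of _ 1]) (simp add: prim_tm_def)

lemma compile_exec:
  assumes "exec I c s y s' y' t" "width c \<le> K"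
  shows "\<exists>t'\<le>t. (tm_step (compile K c) ^^ t') (0, tapes K I s y) =
    (tm_halt (compile K c), tapes K I s' y')"
  using assms
proof (induction rule: exec.induct)
  case (exec_CMove t j s A r d s' y)
  have "map2 act_tape (map (\<lambda>i. (map read_tape (tapes K I s y) ! i,
      if i = d \<and> map read_tape (tapes K I s y) ! j \<in> A then
        (if r then Move_Right else Move_Left) else Stay)) [0..<Suc K]) (tapes K I s y)
    = tapes K I s' y" (is "?l = _")
  proof (rule nth_equalityI)
    fix i assume "i < length ?l"
    then have i: "i < Suc K" by simp
    have j: "j < K" using exec_CMove.prems by simp
    then have l: "?l ! i = act_tape (read_tape (tapes K I s y ! i),
       if i = d \<and> rd I j (s j) \<in> A then (if r then Move_Right else Move_Left) else Stay)
        (tapes K I s y ! i)"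
      using i j by (simp add: nth_read_tapes del: upt_Suc)
    show "?l ! i = tapes K I s' y ! i"
      unfolding l using i exec_CMove
      by (auto simp: nth_tapes act_tape_Stay of_nat_diff)
  qed simp
  then show ?case
    unfolding compile.simps using exec_CMove.hyps(1) by (rule prim_tm_step)
next
  case (exec_Emit t y' y j s A)
  have "map2 act_tape (map (\<lambda>i. if i = K then
      (bit_symbol (map read_tape (tapes K I s y) ! j \<in> A), Move_Right)
      else (map read_tape (tapes K I s y) ! i, Stay)) [0..<Suc K]) (tapes K I s y)
    = tapes K I s y'" (is "?l = _")
  proof (rule nth_equalityI)
    fix i assume "i < length ?l"
    then have i: "i < Suc K" by simp
    have j: "j < K" using exec_Emit.prems by simp
    then have l: "?l ! i = act_tape (if i = K then (bit_symbol (rd I j (s j) \<in> A), Move_Right)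
       else (read_tape (tapes K I s y ! i), Stay)) (tapes K I s y ! i)"
      using i j by (simp add: nth_read_tapes del: upt_Suc)
    show "?l ! i = tapes K I s y' ! i"
      unfolding l using i exec_Emit
      by (auto simp: nth_tapes act_tape_Stay input_tape_snoc)
  qed simp
  then show ?case
    unfolding compile.simps using exec_Emit.hyps(1) by (rule prim_tm_step)
next
  case (exec_Seq c1 s y s1 y1 t1 c2 s2 y2 t2 t)
  let ?M = "compile K c1" and ?M' = "compile K c2"
  obtain u1 where u1: "u1 \<le> t1" "(tm_step ?M ^^ u1) (0, tapes K I s y) = (tm_halt ?M, tapes K I s1 y1)"
    using exec_Seq by auto
  obtain u2 where u2: "u2 \<le> t2" "(tm_step ?M' ^^ u2) (0, tapes K I s1 y1) = (tm_halt ?M', tapes K I s2 y2)"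
    using exec_Seq by auto
  obtain u1' where u1': "u1' \<le> u1"
    "(tm_step (seq_tm ?M ?M') ^^ u1') (0, tapes K I s y) = (tm_halt ?M, tapes K I s1 y1)"
    using seq_tm_first[OF u1(2)] by auto
  have "(tm_step (seq_tm ?M ?M') ^^ (u2 + u1')) (0, tapes K I s y) =
      (tm_halt (seq_tm ?M ?M'), tapes K I s2 y2)"
    using seq_tm_second[OF u2(2), of ?M] u1'(2) unfolding funpow_add by (simp add: seq_tm_def)
  then show ?case using u1(1) u1'(1) u2(1) exec_Seq.hyps(3)
    by (intro exI[of _ "u2 + u1'"]) auto
next
  case (exec_While_False j s A t c y)
  let ?M = "compile K c"
  have "tm_step (while_tm j A ?M) (0, tapes K I s y) = (tm_halt (while_tm j A ?M), tapes K I s y)"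
    using exec_While_False
    by (simp add: while_tm_def nth_read_tapes map2_Stay)
  then show ?case using exec_While_False.hyps(2) by (intro exI[of _ 1]) auto
next
  case (exec_While_True j s A c y s1 y1 t1 s2 y2 t2 t)
  let ?M = "compile K c" and ?W = "compile K (While j A c)"
  obtain u1 where u1: "u1 \<le> t1" "(tm_step ?M ^^ u1) (0, tapes K I s y) = (tm_halt ?M, tapes K I s1 y1)"
    using exec_While_True by auto
  obtain u1' where u1': "u1' \<le> u1"
    "(tm_step ?W ^^ u1') (loop_state ?M 0, tapes K I s y) = (0, tapes K I s1 y1)"
    using while_tm_body[OF u1(2)] by auto
  obtain u2 where u2: "u2 \<le> t2" "(tm_step ?W ^^ u2) (0, tapes K I s1 y1) = (tm_halt ?W, tapes K I s2 y2)"
    using exec_While_True by auto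
  have "tm_step ?W (0, tapes K I s y) = (loop_state ?M 0, tapes K I s y)"
    using exec_While_True
    by (simp add: while_tm_def nth_read_tapes map2_Stay)
  then have "(tm_step ?W ^^ (u2 + (u1' + 1))) (0, tapes K I s y) = (tm_halt ?W, tapes K I s2 y2)"
    using u1'(2) u2(2) unfolding funpow_add by simp
  then show ?case using u1(1) u1'(1) u2(1) exec_While_True.hyps(4)
    by (intro exI[of _ "u2 + (u1' + 1)"]) auto
qed

text \<open>\<open>tm_init\<close> leaves all tapes after the inputs blank. One step writes the mark
  1 into cell 0 of every counter tape, while the output tape \<open>K\<close> stays blank.\<close>

definition mark_tm :: "nat \<Rightarrow> nat \<Rightarrow> tm" where
  "mark_tm m K = prim_tm K (\<lambda>ss. map (\<lambda>i. (if m \<le> i \<and> i < K then 1 else ss ! i, Stay)) [0..<Suc K])"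

lemma turing_machine_mark_tm: "turing_machine (mark_tm m K)"
  unfolding mark_tm_def
  by (rule turing_machine_prim_tm) (auto simp: subset_iff simp del: upt_Suc)

lemma mark_tm_step:
  assumes "length I \<le> K" "tm_tapes M = Suc K"
  shows "\<exists>t\<le>1. (tm_step (mark_tm (length I) K) ^^ t) (tm_init M I) =
    (tm_halt (mark_tm (length I) K), tapes K I (\<lambda>_. 0) [])"
proof -
  define ts where "ts = map input_tape (I @ replicate (Suc K - length I) [])"
  have len: "length ts = Suc K" using assms by (simp add: ts_def)
  let ?g = "\<lambda>ss. map (\<lambda>i. (if length I \<le> i \<and> i < K then 1 else ss ! i, Stay)) [0..<Suc K]"
  have "map2 act_tape (?g (map read_tape ts)) ts = tapes K I (\<lambda>_. 0) []" (is "?l = _")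
  proof (rule nth_equalityI)
    fix i assume "i < length ?l"
    then have i: "i < Suc K" using len by simp
    then have l: "?l ! i = act_tape (if length I \<le> i \<and> i < K then 1 else read_tape (ts ! i), Stay) (ts ! i)"
      using len by (simp del: upt_Suc)
    have "ts ! i = (if i < length I then input_tape (I ! i) else input_tape [])"
      using i assms by (auto simp: nth_append ts_def)
    then show "?l ! i = tapes K I (\<lambda>_. 0) [] ! i"
      unfolding l using i assms by (auto simp: nth_tapes act_tape_Stay content_def input_tape_def fun_eq_iff)
  qed (use len in simp)
  then show ?thesis
    using prim_tm_step[of ?g ts _ 1 K] assms by (simp add: mark_tm_def tm_init_def ts_def del: funpow.simps)
qed

lemma compiled_tm_computes:
  assumes "length I \<le> K" "width c \<le> K" "exec I c (\<lambda>_. 0) [] s y t"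
  shows "tm_computes (seq_tm (mark_tm (length I) K) (compile K c)) I y (Suc t)"
proof -
  let ?A = "mark_tm (length I) K" and ?C = "compile K c"
  let ?M = "seq_tm ?A ?C"
  have tapes: "tm_tapes ?M = Suc K" by (simp add: seq_tm_def mark_tm_def prim_tm_def)
  obtain q0 ts0 where init: "tm_init ?M I = (q0, ts0)" and q0: "q0 = 0"
    by (simp add: tm_init_def)
  obtain t0 where t0: "t0 \<le> 1" "(tm_step ?A ^^ t0) (0, ts0) = (tm_halt ?A, tapes K I (\<lambda>_. 0) [])"
    using mark_tm_step[OF assms(1) tapes] init q0 by auto
  from seq_tm_first[OF this(2)] t0(1) obtain t1 where
    t1: "t1 \<le> 1" "(tm_step ?M ^^ t1) (tm_init ?M I) = (tm_halt ?A, tapes K I (\<lambda>_. 0) [])"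
    using init q0 by (metis le_trans)
  obtain t2 where
    t2: "t2 \<le> t" "(tm_step ?C ^^ t2) (0, tapes K I (\<lambda>_. 0) []) = (tm_halt ?C, tapes K I s y)"
    using compile_exec[OF assms(3,2)] by auto
  have "(tm_step ?M ^^ (t2 + t1)) (tm_init ?M I) = (tm_halt ?M, tapes K I s y)"
    using seq_tm_second[OF t2(2), of ?A] t1(2) unfolding funpow_add by (simp add: seq_tm_def)
  \<comment> \<open>The halted machine idles, so the run is padded to exactly \<open>Suc t\<close>
    steps, the time at which \<open>tm_computes\<close> inspects it.\<close>
  then have "(tm_step ?M ^^ (Suc t - (t2 + t1) + (t2 + t1))) (tm_init ?M I) = (tm_halt ?M, tapes K I s y)"
    unfolding funpow_add by (simp add: tm_steps_halted)
  moreover have "Suc t - (t2 + t1) + (t2 + t1) = Suc t" using t1(1) t2(1) by simp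
  moreover have "tape_holds (last (tapes K I s y)) y"
    by (auto simp: tapes_def tape_holds_def input_tape_def)
  ultimately show ?thesis using assms(1) tapes by (simp add: tm_computes_def)
qed

section \<open>Functions and words computed by nested loops\<close>

text \<open>Functions of the input words \<open>I\<close> and of numerical variables \<open>s\<close>, in de Bruijn style: \<open>s 0\<close> is the
  variable of the innermost summation. Values are kept in unary, so that polynomially bounded loops
  are all that is needed.\<close>

inductive loop_fun :: "nat \<Rightarrow> (bool list list \<Rightarrow> (nat \<Rightarrow> nat) \<Rightarrow> nat) \<Rightarrow> bool" for m where
  loop_fun_var: "loop_fun m (\<lambda>I s. s n)"
| loop_fun_one: "loop_fun m (\<lambda>I s. 1)"
| loop_fun_add: "loop_fun m F \<Longrightarrow> loop_fun m G \<Longrightarrow> loop_fun m (\<lambda>I s. F I s + G I s)"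
| loop_fun_sub: "loop_fun m F \<Longrightarrow> loop_fun m G \<Longrightarrow> loop_fun m (\<lambda>I s. F I s - G I s)"
| loop_fun_sum_nat: "loop_fun m F \<Longrightarrow> loop_fun m G \<Longrightarrow> loop_fun m (\<lambda>I s. \<Sum>i<F I s. G I (case_nat i s))"
| loop_fun_bit: "j < m \<Longrightarrow> loop_fun m F \<Longrightarrow>
     loop_fun m (\<lambda>I s. of_bool (F I s < length (I ! j) \<and> I ! j ! F I s))"
| loop_fun_length: "j < m \<Longrightarrow> loop_fun m (\<lambda>I s. length (I ! j))"

inductive loop_word :: "nat \<Rightarrow> (bool list list \<Rightarrow> (nat \<Rightarrow> nat) \<Rightarrow> bool list) \<Rightarrow> bool" for m where
  loop_word_bit: "loop_fun m F \<Longrightarrow> loop_word m (\<lambda>I s. [F I s \<noteq> 0])"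
| loop_word_append: "loop_word m V \<Longrightarrow> loop_word m W \<Longrightarrow> loop_word m (\<lambda>I s. V I s @ W I s)"
| loop_word_loop_nat: "loop_fun m F \<Longrightarrow> loop_word m W \<Longrightarrow>
     loop_word m (\<lambda>I s. concat (map (\<lambda>i. W I (case_nat i s)) [0..<F I s]))"

lemma poly_nat_mono: "a \<le> b \<Longrightarrow> poly (p :: nat poly) a \<le> poly p b"
  by (induction p) (auto intro: add_mono mult_mono)

definition inputs_bounded :: "nat \<Rightarrow> bool list list \<Rightarrow> nat \<Rightarrow> bool" where
  "inputs_bounded m I X \<longleftrightarrow> length I = m \<and> (\<forall>j<m. length (I ! j) \<le> X)"

lemma inputs_bounded_mono: "inputs_bounded m I X \<Longrightarrow> X \<le> Y \<Longrightarrow> inputs_bounded m I Y"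
  unfolding inputs_bounded_def by (meson le_trans)

text \<open>The value of a function is the number of rounds of the loops that it controls, so this
  bound is what makes the running times polynomial.\<close>

lemma loop_fun_bound:
  "loop_fun m F \<Longrightarrow> \<exists>p :: nat poly. \<forall>I s X. inputs_bounded m I X \<longrightarrow> (\<forall>n. s n \<le> X) \<longrightarrow> F I s \<le> poly p X"
proof (induction rule: loop_fun.induct)
  case (loop_fun_var n)
  show ?case by (rule exI[of _ "[:0, 1:]"]) auto
next
  case loop_fun_one
  show ?case by (rule exI[of _ 1]) auto
next
  case (loop_fun_add F G)
  then obtain p q where pq:
    "\<And>I s X. inputs_bounded m I X \<Longrightarrow> (\<forall>n. s n \<le> X) \<Longrightarrow> F I s \<le> poly p X"
    "\<And>I s X. inputs_bounded m I X \<Longrightarrow> (\<forall>n. s n \<le> X) \<Longrightarrow> G I s \<le> poly q X" by metis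
  show ?case
    by (rule exI[of _ "p + q"]) (auto intro: add_mono pq)
next
  case (loop_fun_sub F G)
  then obtain p where p:
    "\<And>I s X. inputs_bounded m I X \<Longrightarrow> (\<forall>n. s n \<le> X) \<Longrightarrow> F I s \<le> poly p X" by metis
  show ?case
    by (rule exI[of _ p]) (meson diff_le_self le_trans p)
next
  case (loop_fun_sum_nat F G)
  then obtain p q where pq:
    "\<And>I s X. inputs_bounded m I X \<Longrightarrow> (\<forall>n. s n \<le> X) \<Longrightarrow> F I s \<le> poly p X"
    "\<And>I s X. inputs_bounded m I X \<Longrightarrow> (\<forall>n. s n \<le> X) \<Longrightarrow> G I s \<le> poly q X" by metis
  show ?case
  \<comment> \<open>The summation variable stays below \<open>poly p X\<close>, so the extended
    environment is bounded by \<open>X + poly p X\<close>, where \<open>q\<close> is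
    evaluated.\<close>
  proof (intro exI[of _ "p * pcompose q ([:0, 1:] + p)"] allI impI)
    fix I and s :: "nat \<Rightarrow> nat" and X assume *: "inputs_bounded m I X" "\<forall>n. s n \<le> X"
    have "G I (case_nat i s) \<le> poly q (X + poly p X)" if "i < F I s" for i
    proof (rule pq(2))
      show "inputs_bounded m I (X + poly p X)" using *(1) by (rule inputs_bounded_mono) simp
      show "\<forall>n. case_nat i s n \<le> X + poly p X"
        using that pq(1)[OF *] *(2) by (auto split: nat.splits intro: trans_le_add1)
    qed
    then have "(\<Sum>i<F I s. G I (case_nat i s)) \<le> F I s * poly q (X + poly p X)"
      using sum_bounded_above[of "{..<F I s}" "\<lambda>i. G I (case_nat i s)"] by simp
    also have "\<dots> \<le> poly p X * poly q (X + poly p X)" using pq(1)[OF *] by simp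
    finally show "(\<Sum>i<F I s. G I (case_nat i s)) \<le> poly (p * pcompose q ([:0, 1:] + p)) X"
      by (simp add: poly_pcompose)
  qed
next
  case (loop_fun_bit j F)
  show ?case by (rule exI[of _ 1]) auto
next
  case (loop_fun_length j)
  then show ?case by (intro exI[of _ "[:0, 1:]"]) (auto simp: inputs_bounded_def)
qed

section \<open>Counter programs for loop functions and loop words\<close>

abbreviation Inc :: "nat \<Rightarrow> cmd" where "Inc d \<equiv> CMove d UNIV d True"
abbreviation Dec :: "nat \<Rightarrow> cmd" where "Dec d \<equiv> CMove d {0} d False"
abbreviation Back :: "nat \<Rightarrow> cmd" where "Back j \<equiv> CMove j UNIV j False"
abbreviation Countdown :: "nat \<Rightarrow> cmd \<Rightarrow> cmd" where "Countdown k c \<equiv> While k {0} (Dec k ;; c)"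

lemma exec_Inc: "s' = s(d := Suc (s d)) \<Longrightarrow> exec I (Inc d) s y s' y 1"
  by (rule exec_CMove) auto

lemma exec_Dec: "length I \<le> d \<Longrightarrow> s' = s(d := s d - 1) \<Longrightarrow> exec I (Dec d) s y s' y 1"
  by (rule exec_CMove) (auto simp: rd_def)

lemma exec_Back: "0 < s j \<Longrightarrow> s' = s(j := s j - 1) \<Longrightarrow> exec I (Back j) s y s' y 1"
  by (rule exec_CMove) auto

text \<open>\<open>\<sigma> i\<close> and \<open>ys i\<close> are the counters and the output when
  \<open>i\<close> rounds remain. A round costs one test, one decrement and at most \<open>T\<close>
  for the body, hence \<open>T + 2\<close>.\<close>

lemma exec_Countdown:
  assumes "length I \<le> k" "\<And>i. i \<le> n \<Longrightarrow> \<sigma> i k = i"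
    and "\<And>i. i < n \<Longrightarrow> exec I c ((\<sigma> (Suc i))(k := i)) (ys (Suc i)) (\<sigma> i) (ys i) T"
  shows "exec I (Countdown k c) (\<sigma> n) (ys n) (\<sigma> 0) (ys 0) (n * (T + 2) + 1)"
  using assms(2,3)
proof (induction n)
  case 0
  then show ?case using assms(1) by (intro exec_While_False) (auto simp: rd_def)
next
  case (Suc n)
  have 1: "exec I (Dec k ;; c) (\<sigma> (Suc n)) (ys (Suc n)) (\<sigma> n) (ys n) (T + 1)"
    by (rule exec_Seq[OF exec_Dec Suc.prems(2)])
      (use assms(1) Suc.prems(1)[of "Suc n"] in auto)
  have 2: "exec I (Countdown k c) (\<sigma> n) (ys n) (\<sigma> 0) (ys 0) (n * (T + 2) + 1)"
    by (rule Suc.IH) (use Suc.prems in auto)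
  have 3: "rd I k (\<sigma> (Suc n) k) \<in> {0}"
    using assms(1) Suc.prems(1)[of "Suc n"] by (simp add: rd_def)
  show ?case by (rule exec_While_True[OF 3 1 2]) simp
qed

lemma exec_clear:
  assumes "length I \<le> k"
  shows "exec I (While k {0} (Dec k)) (s(k := n)) y (s(k := 0)) y (2 * n + 1)"
proof (induction n)
  case 0
  then show ?case using assms by (intro exec_While_False) (auto simp: rd_def)
next
  case (Suc n)
  have 1: "exec I (Dec k) (s(k := Suc n)) y (s(k := n)) y 1"
    by (rule exec_Dec) (use assms in auto)
  show ?case by (rule exec_While_True[OF _ 1 Suc]) (use assms in \<open>auto simp: rd_def\<close>)
qed

text \<open>The counters from \<open>L\<close> on are scratch space, which is clear before and after the execution.
  The environment of a function is kept in the counters \<open>\<rho> n\<close>.\<close>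

definition scratch :: "nat \<Rightarrow> nat \<Rightarrow> (nat \<Rightarrow> nat) \<Rightarrow> bool" where
  "scratch m L s \<longleftrightarrow> (\<forall>j. j < m \<or> L \<le> j \<longrightarrow> s j = 0)"

text \<open>The value is added to counter \<open>d\<close> instead of replacing its content, so that
  a sum is computed by running the programs of the summands one after the other with the same
  target.\<close>

definition realizes ::
  "nat \<Rightarrow> (bool list list \<Rightarrow> (nat \<Rightarrow> nat) \<Rightarrow> nat) \<Rightarrow> nat \<Rightarrow> (nat \<Rightarrow> nat) \<Rightarrow> nat \<Rightarrow> cmd \<Rightarrow> nat poly \<Rightarrow> bool"
where
  "realizes m F L \<rho> d c p \<longleftrightarrow>
     (\<forall>I s y X. inputs_bounded m I X \<and> scratch m L s \<and> (\<forall>n. s (\<rho> n) \<le> X) \<longrightarrow>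
        exec I c s y (s(d := s d + F I (\<lambda>n. s (\<rho> n)))) y (poly p X))"

lemma realizesD:
  "realizes m F L \<rho> d c p \<Longrightarrow> inputs_bounded m I X \<Longrightarrow> scratch m L s \<Longrightarrow> (\<And>n. s (\<rho> n) \<le> X) \<Longrightarrow>
   s' = s(d := s d + F I (\<lambda>n. s (\<rho> n))) \<Longrightarrow> poly p X \<le> t \<Longrightarrow> exec I c s y s' y t"
  unfolding realizes_def by (metis exec_mono)

definition frame :: "nat \<Rightarrow> nat \<Rightarrow> (nat \<Rightarrow> nat) \<Rightarrow> bool" where
  "frame m L \<rho> \<longleftrightarrow> (\<forall>n. m \<le> \<rho> n \<and> \<rho> n < L)"

lemma frame_fresh: "frame m L \<rho> \<Longrightarrow> L \<le> k \<Longrightarrow> k \<notin> range \<rho>"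
  by (auto simp: frame_def not_less[symmetric])

lemma frame_mono: "frame m L \<rho> \<Longrightarrow> L \<le> L' \<Longrightarrow> frame m L' \<rho>"
  by (auto simp: frame_def intro: less_le_trans)

lemma loop_fun_realizes:
  "loop_fun m F \<Longrightarrow> frame m L \<rho> \<Longrightarrow> m \<le> d \<Longrightarrow> d < L \<Longrightarrow> d \<notin> range \<rho> \<Longrightarrow> \<exists>c p. realizes m F L \<rho> d c p"
proof (induction arbitrary: L \<rho> d rule: loop_fun.induct)
  case (loop_fun_var n)
  let ?v = "\<rho> n"
  have v: "m \<le> ?v" "?v < L" "d \<noteq> ?v" using loop_fun_var by (auto simp: frame_def)
  \<comment> \<open>Reading a counter empties it: its content goes to \<open>d\<close> and to the
    scratch counter \<open>L\<close>, from which it is then restored.\<close>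
  let ?c = "Countdown ?v (Inc d ;; Inc L) ;; Countdown L (Inc ?v)"
  have "realizes m (\<lambda>I s. s n) L \<rho> d ?c ([:0, 1:] * [:8:] + [:8:])"
    unfolding realizes_def
  proof (intro allI impI, elim conjE)
    fix I s y X assume *: "inputs_bounded m I X" "scratch m L s" "\<forall>n. s (\<rho> n) \<le> X"
    have I: "length I = m" using * by (simp add: inputs_bounded_def)
    have sL: "s L = 0" using * by (simp add: scratch_def)
    let ?n = "s ?v"
    define \<sigma> where "\<sigma> i = s(?v := i, d := s d + (?n - i), L := ?n - i)" for i
    define \<tau> where "\<tau> i = s(?v := ?n - i, d := s d + ?n, L := i)" for i
    have "exec I (Countdown ?v (Inc d ;; Inc L)) (\<sigma> ?n) y (\<sigma> 0) y (?n * (2 + 2) + 1)"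
    proof (rule exec_Countdown[where ys = "\<lambda>_. y"])
      fix i assume i: "i < ?n"
      show "exec I (Inc d ;; Inc L) ((\<sigma> (Suc i))(?v := i)) y (\<sigma> i) y 2"
        by (rule exec_Seq[OF exec_Inc[OF refl] exec_Inc]) (use v i loop_fun_var.prems in \<open>auto simp: \<sigma>_def fun_eq_iff\<close>)
    qed (use v I in \<open>auto simp: \<sigma>_def\<close>)
    moreover have "exec I (Countdown L (Inc ?v)) (\<tau> ?n) y (\<tau> 0) y (?n * (1 + 2) + 1)"
    proof (rule exec_Countdown[where ys = "\<lambda>_. y"])
      fix i assume i: "i < ?n"
      show "exec I (Inc ?v) ((\<tau> (Suc i))(L := i)) y (\<tau> i) y 1"
        by (rule exec_Inc) (use v i in \<open>auto simp: \<tau>_def fun_eq_iff\<close>)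
    qed (use v I in \<open>auto simp: \<tau>_def\<close>)
    moreover have "\<sigma> ?n = s" using sL by (auto simp: \<sigma>_def fun_eq_iff)
    moreover have "\<tau> 0 = s(d := s d + ?n)" using sL v loop_fun_var.prems by (auto simp: \<tau>_def fun_eq_iff)
    moreover have "\<sigma> 0 = \<tau> ?n" using v loop_fun_var.prems by (auto simp: \<sigma>_def \<tau>_def fun_eq_iff)
    ultimately show "exec I ?c s y (s(d := s d + s (\<rho> n))) y (poly ([:0, 1:] * [:8:] + [:8:]) X)"
      using spec[OF *(3), of n] by (auto intro!: exec_Seq)
  qed
  then show ?case by blast
next
  case loop_fun_one
  have "realizes m (\<lambda>I s. 1) L \<rho> d (Inc d) 1"
    unfolding realizes_def by (auto intro!: exec_CMove)
  then show ?case by blast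
next
  case (loop_fun_add F G)
  obtain c p where cp: "realizes m F L \<rho> d c p" using loop_fun_add.IH(1)[OF loop_fun_add.prems] by blast
  obtain c' p' where cp': "realizes m G L \<rho> d c' p'" using loop_fun_add.IH(2)[OF loop_fun_add.prems] by blast
  have "realizes m (\<lambda>I s. F I s + G I s) L \<rho> d (c ;; c') (p + p')"
    unfolding realizes_def
  proof (intro allI impI, elim conjE)
    fix I s y X assume *: "inputs_bounded m I X" "scratch m L s" "\<forall>n. s (\<rho> n) \<le> X"
    let ?s = "s(d := s d + F I (\<lambda>n. s (\<rho> n)))"
    have eq: "?s (\<rho> n) = s (\<rho> n)" for n using loop_fun_add.prems by auto
    show "exec I (c ;; c') s y (s(d := s d + (F I (\<lambda>n. s (\<rho> n)) + G I (\<lambda>n. s (\<rho> n))))) y (poly (p + p') X)"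
    proof (rule exec_Seq[OF realizesD[OF cp *(1,2) _ refl order_refl] realizesD[OF cp' *(1) _ _ _ order_refl]])
      show "scratch m L ?s" using *(2) loop_fun_add.prems by (auto simp: scratch_def)
    qed (use * eq loop_fun_add.prems in \<open>auto simp: eq\<close>)
  qed
  then show ?case by blast
next
  case (loop_fun_sub F G)
  let ?L = "L + 2"
  have fr: "frame m ?L \<rho>" and nr: "L \<notin> range \<rho>" "Suc L \<notin> range \<rho>"
    using frame_fresh[OF loop_fun_sub.prems(1)] frame_mono[OF loop_fun_sub.prems(1)] by auto
  obtain c p where cp: "realizes m F ?L \<rho> L c p"
    using loop_fun_sub.IH(1)[OF fr, of L] loop_fun_sub.prems nr by auto
  obtain c' p' where cp': "realizes m G ?L \<rho> (Suc L) c' p'"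
    using loop_fun_sub.IH(2)[OF fr, of "Suc L"] loop_fun_sub.prems nr by auto
  obtain b where b: "\<And>I s X. inputs_bounded m I X \<Longrightarrow> (\<forall>n. s n \<le> X) \<Longrightarrow> F I s \<le> poly b X"
    using loop_fun_bound[OF loop_fun_sub.hyps(1)] by blast
  obtain b' where b': "\<And>I s X. inputs_bounded m I X \<Longrightarrow> (\<forall>n. s n \<le> X) \<Longrightarrow> G I s \<le> poly b' X"
    using loop_fun_bound[OF loop_fun_sub.hyps(2)] by blast
  \<comment> \<open>\<open>Dec\<close> has no effect at zero, so decrementing \<open>L\<close> once
    for every unit of \<open>Suc L\<close> leaves the truncated difference, which is then moved to
    \<open>d\<close>.\<close>
  let ?c = "c ;; c' ;; Countdown (Suc L) (Dec L) ;; Countdown L (Inc d)"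
  let ?p = "p + p' + [:3:] * b' + [:3:] * b + [:2:]"
  have "realizes m (\<lambda>I s. F I s - G I s) L \<rho> d ?c ?p"
    unfolding realizes_def
  proof (intro allI impI, elim conjE)
    fix I s y X assume *: "inputs_bounded m I X" "scratch m L s" "\<forall>n. s (\<rho> n) \<le> X"
    have I: "length I = m" using * by (simp add: inputs_bounded_def)
    have sL: "s L = 0" "s (Suc L) = 0" using * by (simp_all add: scratch_def)
    define f where "f = F I (\<lambda>n. s (\<rho> n))"
    define g where "g = G I (\<lambda>n. s (\<rho> n))"
    have env: "(\<lambda>n. (s(L := f)) (\<rho> n)) = (\<lambda>n. s (\<rho> n))" using nr by (auto simp: fun_eq_iff)
    define \<sigma> where "\<sigma> i = s(L := f - (g - i), Suc L := i)" for i
    define \<tau> where "\<tau> i = s(L := i, d := s d + (f - g - i))" for i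
    have d: "d < L" "m \<le> d" by fact+
    have 1: "exec I c s y (s(L := f)) y (poly p X)"
      by (rule realizesD[OF cp *(1)]) (use * sL in \<open>auto simp: f_def scratch_def\<close>)
    have 2: "exec I c' (s(L := f)) y (\<sigma> g) y (poly p' X)"
    proof (rule realizesD[OF cp' *(1)])
      show "\<sigma> g = (s(L := f)) (Suc L := (s(L := f)) (Suc L) + G I (\<lambda>n. (s(L := f)) (\<rho> n)))"
        unfolding env g_def[symmetric] using sL by (simp add: \<sigma>_def)
      show "scratch m ?L (s(L := f))" using * d by (auto simp: scratch_def)
      show "\<And>n. (s(L := f)) (\<rho> n) \<le> X" using fun_cong[OF env] * by simp
    qed simp
    have 3: "exec I (Countdown (Suc L) (Dec L)) (\<sigma> g) y (\<sigma> 0) y (g * (1 + 2) + 1)"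
    proof (rule exec_Countdown[where ys = "\<lambda>_. y"])
      fix i assume i: "i < g"
      show "exec I (Dec L) ((\<sigma> (Suc i))(Suc L := i)) y (\<sigma> i) y 1"
        by (rule exec_Dec) (use I d i in \<open>auto simp: \<sigma>_def fun_eq_iff\<close>)
    qed (use I d in \<open>auto simp: \<sigma>_def\<close>)
    have 4: "exec I (Countdown L (Inc d)) (\<tau> (f - g)) y (\<tau> 0) y ((f - g) * (1 + 2) + 1)"
    proof (rule exec_Countdown[where ys = "\<lambda>_. y"])
      fix i assume i: "i < f - g"
      show "exec I (Inc d) ((\<tau> (Suc i))(L := i)) y (\<tau> i) y 1"
        by (rule exec_Inc) (use I d i in \<open>auto simp: \<tau>_def fun_eq_iff\<close>)
    qed (use I d in \<open>auto simp: \<tau>_def\<close>)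
    have 5: "\<sigma> 0 = \<tau> (f - g)" using d sL by (auto simp: \<sigma>_def \<tau>_def fun_eq_iff)
    have 6: "\<tau> 0 = s(d := s d + (f - g))" using d sL by (auto simp: \<tau>_def fun_eq_iff)
    have "f \<le> poly b X" "g \<le> poly b' X" using b[OF *(1,3)] b'[OF *(1,3)] by (auto simp: f_def g_def)
    then have t: "poly p X + (poly p' X + ((g * (1 + 2) + 1) + ((f - g) * (1 + 2) + 1))) \<le> poly ?p X"
      by simp
    have "exec I ?c s y (\<tau> 0) y (poly ?p X)"
      using exec_Seq[OF 1 exec_Seq[OF 2 exec_Seq[OF 3 4[folded 5] order_refl] order_refl] t] .
    then show "exec I ?c s y (s(d := s d + (F I (\<lambda>n. s (\<rho> n)) - G I (\<lambda>n. s (\<rho> n))))) y (poly ?p X)"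
      unfolding 6 f_def g_def .
  qed
  then show ?case by blast
next
  case (loop_fun_sum_nat F G)
  \<comment> \<open>Counter \<open>L\<close> is at once the loop counter and variable 0 of
    \<open>G\<close>. It runs downwards, which is harmless for a sum.\<close>
  let ?L = "Suc L" and ?\<rho> = "case_nat L \<rho>"
  have fr: "frame m ?L \<rho>" and nr: "L \<notin> range \<rho>"
    using frame_fresh[OF loop_fun_sum_nat.prems(1)] frame_mono[OF loop_fun_sum_nat.prems(1)] by auto
  have fr': "frame m ?L ?\<rho>" and nr': "d \<notin> range ?\<rho>"
    using fr loop_fun_sum_nat.prems by (auto simp: frame_def split: nat.splits)
  obtain c p where cp: "realizes m F ?L \<rho> L c p"
    using loop_fun_sum_nat.IH(1)[OF fr, of L] loop_fun_sum_nat.prems nr by auto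
  obtain c' p' where cp': "realizes m G ?L ?\<rho> d c' p'"
    using loop_fun_sum_nat.IH(2)[OF fr', of d] loop_fun_sum_nat.prems nr' by auto
  obtain b where b: "\<And>I s X. inputs_bounded m I X \<Longrightarrow> (\<forall>n. s n \<le> X) \<Longrightarrow> F I s \<le> poly b X"
    using loop_fun_bound[OF loop_fun_sum_nat.hyps(1)] by blast
  let ?c = "c ;; Countdown L c'"
  let ?p = "p + b * (pcompose p' ([:0, 1:] + b) + [:2:]) + [:1:]"
  have "realizes m (\<lambda>I s. \<Sum>i<F I s. G I (case_nat i s)) L \<rho> d ?c ?p"
    unfolding realizes_def
  proof (intro allI impI, elim conjE)
    fix I s y X assume *: "inputs_bounded m I X" "scratch m L s" "\<forall>n. s (\<rho> n) \<le> X"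
    have I: "length I = m" using * by (simp add: inputs_bounded_def)
    have sL: "s L = 0" using * by (simp add: scratch_def)
    have d: "d < L" "m \<le> d" by fact+
    define f where "f = F I (\<lambda>n. s (\<rho> n))"
    define g where "g i = G I (case_nat i (\<lambda>n. s (\<rho> n)))" for i
    have fb: "f \<le> poly b X" using b[OF *(1,3)] by (simp add: f_def)
    define \<sigma> where "\<sigma> i = s(L := i, d := s d + (\<Sum>j\<in>{i..<f}. g j))" for i
    let ?T = "poly p' (X + poly b X)"
    have 1: "exec I c s y (\<sigma> f) y (poly p X)"
      by (rule realizesD[OF cp *(1)]) (use * sL d in \<open>auto simp: f_def scratch_def \<sigma>_def fun_eq_iff\<close>)
    have 2: "exec I (Countdown L c') (\<sigma> f) y (\<sigma> 0) y (f * (?T + 2) + 1)"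
    proof (rule exec_Countdown[where ys = "\<lambda>_. y"])
      fix i assume i: "i < f"
      let ?s = "(\<sigma> (Suc i))(L := i)"
      have env: "(\<lambda>n. ?s (?\<rho> n)) = case_nat i (\<lambda>n. s (\<rho> n))"
        using nr loop_fun_sum_nat.prems(4) by (auto simp: \<sigma>_def fun_eq_iff split: nat.splits)
      have bound: "?s (?\<rho> n) \<le> X + poly b X" for n
        using fun_cong[OF env, of n] * i fb by (auto split: nat.splits intro: trans_le_add1)
      show "exec I c' ?s y (\<sigma> i) y ?T"
      proof (rule realizesD[OF cp'])
        show "?s (?\<rho> n) \<le> X + poly b X" for n by (rule bound)
        show "inputs_bounded m I (X + poly b X)" using *(1) by (rule inputs_bounded_mono) simp
        show "scratch m ?L ?s" using * d by (auto simp: scratch_def \<sigma>_def)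
        show "\<sigma> i = ?s(d := ?s d + G I (\<lambda>n. ?s (?\<rho> n)))"
          unfolding env g_def[symmetric] using i d
          by (auto simp: \<sigma>_def fun_eq_iff sum.atLeast_Suc_lessThan)
      qed simp
    qed (use I d in \<open>auto simp: \<sigma>_def\<close>)
    have 3: "\<sigma> 0 = s(d := s d + (\<Sum>i<f. g i))"
      using d sL by (auto simp: \<sigma>_def fun_eq_iff atLeast0LessThan)
    have t: "poly p X + (f * (?T + 2) + 1) \<le> poly ?p X"
      using mult_le_mono1[OF fb, of "?T + 2"] by (simp add: poly_pcompose)
    show "exec I ?c s y (s(d := s d + (\<Sum>i<F I (\<lambda>n. s (\<rho> n)). G I (case_nat i (\<lambda>n. s (\<rho> n)))))) y (poly ?p X)"
      using exec_Seq[OF 1 2 t] unfolding 3 f_def g_def .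
  qed
  then show ?case by blast
next
  case (loop_fun_bit j F)
  let ?L = "L + 2"
  have fr: "frame m ?L \<rho>" and nr: "L \<notin> range \<rho>"
    using frame_fresh[OF loop_fun_bit.prems(1)] frame_mono[OF loop_fun_bit.prems(1)] by auto
  obtain c p where cp: "realizes m F ?L \<rho> L c p"
    using loop_fun_bit.IH[OF fr, of L] loop_fun_bit.prems nr by auto
  obtain b where b: "\<And>I s X. inputs_bounded m I X \<Longrightarrow> (\<forall>n. s n \<le> X) \<Longrightarrow> F I s \<le> poly b X"
    using loop_fun_bound[OF loop_fun_bit.hyps(2)] by blast
  \<comment> \<open>The input head walks to the position \<open>F\<close> while \<open>Suc L\<close>
    records the distance for the way back. Past the end of the word it reads 0, which agrees with
    the value 0 there.\<close>
  let ?c = "c ;; Countdown L (Inc (Suc L) ;; Inc j) ;; CMove j {2} d True ;; Countdown (Suc L) (Back j)"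
  let ?p = "p + [:7:] * b + [:3:]"
  have "realizes m (\<lambda>I s. of_bool (F I s < length (I ! j) \<and> I ! j ! F I s)) L \<rho> d ?c ?p"
    unfolding realizes_def
  proof (intro allI impI, elim conjE)
    fix I s y X assume *: "inputs_bounded m I X" "scratch m L s" "\<forall>n. s (\<rho> n) \<le> X"
    have I: "length I = m" using * by (simp add: inputs_bounded_def)
    have d: "d < L" "m \<le> d" "j < m" by fact+
    have sL: "s L = 0" "s (Suc L) = 0" "s j = 0" using * d by (simp_all add: scratch_def)
    define f where "f = F I (\<lambda>n. s (\<rho> n))"
    define r where "r = (of_bool (f < length (I ! j) \<and> I ! j ! f) :: nat)"
    have fb: "f \<le> poly b X" using b[OF *(1,3)] by (simp add: f_def)
    define \<sigma> where "\<sigma> i = s(L := i, Suc L := f - i, j := f - i)" for i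
    define \<tau> where "\<tau> i = s(Suc L := i, j := i, d := s d + r)" for i
    have 1: "exec I c s y (\<sigma> f) y (poly p X)"
      by (rule realizesD[OF cp *(1)]) (use * sL d in \<open>auto simp: f_def scratch_def \<sigma>_def fun_eq_iff\<close>)
    have 2: "exec I (Countdown L (Inc (Suc L) ;; Inc j)) (\<sigma> f) y (\<sigma> 0) y (f * (2 + 2) + 1)"
    proof (rule exec_Countdown[where ys = "\<lambda>_. y"])
      fix i assume i: "i < f"
      show "exec I (Inc (Suc L) ;; Inc j) ((\<sigma> (Suc i))(L := i)) y (\<sigma> i) y 2"
        by (rule exec_Seq[OF exec_Inc[OF refl] exec_Inc]) (use d i in \<open>auto simp: \<sigma>_def fun_eq_iff\<close>)
    qed (use I d in \<open>auto simp: \<sigma>_def\<close>)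
    have 3: "exec I (CMove j {2} d True) (\<sigma> 0) y (\<tau> f) y 1"
      by (rule exec_CMove)
        (use I d sL in \<open>auto simp: \<sigma>_def \<tau>_def r_def rd_def bit_symbol_def fun_eq_iff\<close>)
    have 4: "exec I (Countdown (Suc L) (Back j)) (\<tau> f) y (\<tau> 0) y (f * (1 + 2) + 1)"
    proof (rule exec_Countdown[where ys = "\<lambda>_. y"])
      fix i assume i: "i < f"
      show "exec I (Back j) ((\<tau> (Suc i))(Suc L := i)) y (\<tau> i) y 1"
        by (rule exec_Back) (use d i in \<open>auto simp: \<tau>_def fun_eq_iff\<close>)
    qed (use I d in \<open>auto simp: \<tau>_def\<close>)
    have 5: "\<tau> 0 = s(d := s d + r)" using d sL by (auto simp: \<tau>_def fun_eq_iff)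
    have t: "poly p X + ((f * (2 + 2) + 1) + (1 + (f * (1 + 2) + 1))) \<le> poly ?p X"
      using fb by simp
    show "exec I ?c s y (s(d := s d + of_bool (F I (\<lambda>n. s (\<rho> n)) < length (I ! j) \<and>
        I ! j ! F I (\<lambda>n. s (\<rho> n))))) y (poly ?p X)"
      using exec_Seq[OF 1 exec_Seq[OF 2 exec_Seq[OF 3 4 order_refl] order_refl] t]
      unfolding 5 r_def f_def .
  qed
  then show ?case by blast
next
  case (loop_fun_length j)
  let ?c = "While j {1, 2} (Inc L ;; Inc j) ;; Countdown L (Back j ;; Inc d)"
  let ?p = "[:0, 7:] + [:2:]"
  have "realizes m (\<lambda>I s. length (I ! j)) L \<rho> d ?c ?p"
    unfolding realizes_def
  proof (intro allI impI, elim conjE)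
    fix I s y X assume *: "inputs_bounded m I X" "scratch m L s" "\<forall>n. s (\<rho> n) \<le> X"
    have I: "length I = m" using * by (simp add: inputs_bounded_def)
    have d: "d < L" "m \<le> d" "j < m" by fact+
    have sL: "s L = 0" "s j = 0" using * d by (simp_all add: scratch_def)
    let ?l = "length (I ! j)"
    have lb: "?l \<le> X" using * d by (simp add: inputs_bounded_def)
    define \<sigma> where "\<sigma> i = s(L := i, j := i)" for i
    define \<tau> where "\<tau> i = s(L := i, j := i, d := s d + (?l - i))" for i
    have "exec I (While j {1, 2} (Inc L ;; Inc j)) (\<sigma> (?l - n)) y (\<sigma> ?l) y (3 * n + 1)"
      if "n \<le> ?l" for n
      using that
    proof (induction n)
      case 0
      have "exec I (While j {1, 2} (Inc L ;; Inc j)) (\<sigma> ?l) y (\<sigma> ?l) y (3 * 0 + 1)"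
        by (rule exec_While_False) (use I d in \<open>auto simp: \<sigma>_def rd_def\<close>)
      then show ?case by simp
    next
      case (Suc n)
      have "exec I (Inc L ;; Inc j) (\<sigma> (?l - Suc n)) y (\<sigma> (?l - n)) y 2"
        by (rule exec_Seq[OF exec_Inc[OF refl] exec_Inc]) (use d Suc.prems in \<open>auto simp: \<sigma>_def fun_eq_iff\<close>)
      then show ?case
      proof (rule exec_While_True[rotated])
        show "exec I (While j {1, 2} (Inc L ;; Inc j)) (\<sigma> (?l - n)) y (\<sigma> ?l) y (3 * n + 1)"
          using Suc by simp
        show "rd I j (\<sigma> (?l - Suc n) j) \<in> {1, 2}"
          using I d Suc.prems by (auto simp: \<sigma>_def rd_def bit_symbol_def)
      qed simp
    qed
    from this[of ?l] have 1: "exec I (While j {1, 2} (Inc L ;; Inc j)) (\<sigma> 0) y (\<sigma> ?l) y (3 * ?l + 1)"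
      by simp
    have 2: "exec I (Countdown L (Back j ;; Inc d)) (\<tau> ?l) y (\<tau> 0) y (?l * (2 + 2) + 1)"
    proof (rule exec_Countdown[where ys = "\<lambda>_. y"])
      fix i assume i: "i < ?l"
      show "exec I (Back j ;; Inc d) ((\<tau> (Suc i))(L := i)) y (\<tau> i) y 2"
        by (rule exec_Seq[OF exec_Back[OF _ refl] exec_Inc]) (use d i in \<open>auto simp: \<tau>_def fun_eq_iff\<close>)
    qed (use I d in \<open>auto simp: \<tau>_def\<close>)
    have 3: "\<sigma> 0 = s" "\<sigma> ?l = \<tau> ?l" "\<tau> 0 = s(d := s d + ?l)"
      using d sL by (auto simp: \<sigma>_def \<tau>_def fun_eq_iff)
    have t: "3 * ?l + 1 + (?l * (2 + 2) + 1) \<le> poly ?p X" using lb by simp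
    show "exec I ?c s y (s(d := s d + ?l)) y (poly ?p X)"
      using exec_Seq[OF 1[unfolded 3(1,2)] 2[unfolded 3(3)] t] .
  qed
  then show ?case by blast
qed

definition writes ::
  "nat \<Rightarrow> (bool list list \<Rightarrow> (nat \<Rightarrow> nat) \<Rightarrow> bool list) \<Rightarrow> nat \<Rightarrow> (nat \<Rightarrow> nat) \<Rightarrow> cmd \<Rightarrow> nat poly \<Rightarrow> bool"
where
  "writes m W L \<rho> c p \<longleftrightarrow>
     (\<forall>I s y X. inputs_bounded m I X \<and> scratch m L s \<and> (\<forall>n. s (\<rho> n) \<le> X) \<longrightarrow>
        exec I c s y s (y @ W I (\<lambda>n. s (\<rho> n))) (poly p X))"

lemma writesD:
  "writes m W L \<rho> c p \<Longrightarrow> inputs_bounded m I X \<Longrightarrow> scratch m L s \<Longrightarrow> (\<And>n. s (\<rho> n) \<le> X) \<Longrightarrow>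
   y' = y @ W I (\<lambda>n. s (\<rho> n)) \<Longrightarrow> poly p X \<le> t \<Longrightarrow> exec I c s y s y' t"
  unfolding writes_def by (metis exec_mono)

lemma loop_word_writes:
  "loop_word m W \<Longrightarrow> frame m L \<rho> \<Longrightarrow> m \<le> L \<Longrightarrow> \<exists>c p. writes m W L \<rho> c p"
proof (induction arbitrary: L \<rho> rule: loop_word.induct)
  case (loop_word_bit F)
  let ?L = "Suc L"
  have fr: "frame m ?L \<rho>" and nr: "L \<notin> range \<rho>"
    using frame_fresh[OF loop_word_bit.prems(1)] frame_mono[OF loop_word_bit.prems(1)] by auto
  obtain c p where cp: "realizes m F ?L \<rho> L c p"
    using loop_fun_realizes[OF loop_word_bit.hyps fr, of L] loop_word_bit.prems nr by auto
  obtain b where b: "\<And>I s X. inputs_bounded m I X \<Longrightarrow> (\<forall>n. s n \<le> X) \<Longrightarrow> F I s \<le> poly b X"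
    using loop_fun_bound[OF loop_word_bit.hyps] by blast
  \<comment> \<open>Head \<open>L\<close> reads 0 iff it is off its mark, that is, iff the value is
    nonzero; afterwards the counter is cleared.\<close>
  let ?c = "c ;; Emit L {0} ;; While L {0} (Dec L)"
  let ?p = "p + [:2:] * b + [:2:]"
  have "writes m (\<lambda>I s. [F I s \<noteq> 0]) L \<rho> ?c ?p"
    unfolding writes_def
  proof (intro allI impI, elim conjE)
    fix I s y X assume *: "inputs_bounded m I X" "scratch m L s" "\<forall>n. s (\<rho> n) \<le> X"
    have I: "length I = m" using * by (simp add: inputs_bounded_def)
    have sL: "s L = 0" using * by (simp add: scratch_def)
    define f where "f = F I (\<lambda>n. s (\<rho> n))"
    have fb: "f \<le> poly b X" using b[OF *(1,3)] by (simp add: f_def)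
    let ?y = "y @ [f \<noteq> 0]"
    have 1: "exec I c s y (s(L := f)) y (poly p X)"
      by (rule realizesD[OF cp *(1)]) (use * sL in \<open>auto simp: f_def scratch_def\<close>)
    have 2: "exec I (Emit L {0}) (s(L := f)) y (s(L := f)) ?y 1"
      by (rule exec_Emit) (use I loop_word_bit.prems in \<open>auto simp: rd_def\<close>)
    have 3: "exec I (While L {0} (Dec L)) (s(L := f)) ?y (s(L := 0)) ?y (2 * f + 1)"
      by (rule exec_clear) (use I loop_word_bit.prems in auto)
    have 4: "s(L := 0) = s" using sL by auto
    have t: "poly p X + (1 + (2 * f + 1)) \<le> poly ?p X" using fb by simp
    show "exec I ?c s y s (y @ [F I (\<lambda>n. s (\<rho> n)) \<noteq> 0]) (poly ?p X)"
      using exec_Seq[OF 1 exec_Seq[OF 2 3[unfolded 4] order_refl] t] unfolding f_def .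
  qed
  then show ?case by blast
next
  case (loop_word_append V W)
  obtain c p where cp: "writes m V L \<rho> c p" using loop_word_append.IH(1)[OF loop_word_append.prems] by blast
  obtain c' p' where cp': "writes m W L \<rho> c' p'" using loop_word_append.IH(2)[OF loop_word_append.prems] by blast
  have "writes m (\<lambda>I s. V I s @ W I s) L \<rho> (c ;; c') (p + p')"
    using cp cp' unfolding writes_def
    by (auto intro!: exec_Seq simp flip: append_assoc)
  then show ?case by blast
next
  case (loop_word_loop_nat F W)
  \<comment> \<open>The order of the output matters, so besides the countdown in \<open>L\<close> an
    index in \<open>Suc L\<close> counts upwards and serves as the loop variable.\<close>
  let ?L = "L + 2" and ?\<rho> = "case_nat (Suc L) \<rho>"
  have fr: "frame m ?L \<rho>" and nr: "L \<notin> range \<rho>" "Suc L \<notin> range \<rho>"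
    using frame_fresh[OF loop_word_loop_nat.prems(1)] frame_mono[OF loop_word_loop_nat.prems(1)] by auto
  have nr': "\<rho> n \<noteq> L" "\<rho> n \<noteq> Suc L" for n using nr by (metis rangeI)+
  have fr': "frame m ?L ?\<rho>"
    using fr loop_word_loop_nat.prems by (auto simp: frame_def split: nat.splits)
  obtain c p where cp: "realizes m F ?L \<rho> L c p"
    using loop_fun_realizes[OF loop_word_loop_nat.hyps(1) fr, of L] loop_word_loop_nat.prems nr by auto
  obtain c' p' where cp': "writes m W ?L ?\<rho> c' p'"
    using loop_word_loop_nat.IH[OF fr'] loop_word_loop_nat.prems by auto
  obtain b where b: "\<And>I s X. inputs_bounded m I X \<Longrightarrow> (\<forall>n. s n \<le> X) \<Longrightarrow> F I s \<le> poly b X"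
    using loop_fun_bound[OF loop_word_loop_nat.hyps(1)] by blast
  let ?c = "c ;; Countdown L (c' ;; Inc (Suc L)) ;; While (Suc L) {0} (Dec (Suc L))"
  let ?p = "p + b * (pcompose p' ([:0, 1:] + b) + [:5:]) + [:2:]"
  have "writes m (\<lambda>I s. concat (map (\<lambda>i. W I (case_nat i s)) [0..<F I s])) L \<rho> ?c ?p"
    unfolding writes_def
  proof (intro allI impI, elim conjE)
    fix I s y X assume *: "inputs_bounded m I X" "scratch m L s" "\<forall>n. s (\<rho> n) \<le> X"
    have I: "length I = m" using * by (simp add: inputs_bounded_def)
    have sL: "s L = 0" "s (Suc L) = 0" using * by (simp_all add: scratch_def)
    define f where "f = F I (\<lambda>n. s (\<rho> n))"
    define g where "g i = W I (case_nat i (\<lambda>n. s (\<rho> n)))" for i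
    have fb: "f \<le> poly b X" using b[OF *(1,3)] by (simp add: f_def)
    define \<sigma> where "\<sigma> i = s(L := i, Suc L := f - i)" for i
    define ys where "ys i = y @ concat (map g [0..<f - i])" for i
    let ?T = "poly p' (X + poly b X)"
    have ys: "ys f = y" by (simp add: ys_def)
    have 1: "exec I c s y (\<sigma> f) (ys f) (poly p X)"
      unfolding ys by (rule realizesD[OF cp *(1)])
        (use * sL loop_word_loop_nat.prems in \<open>auto simp: f_def scratch_def \<sigma>_def fun_eq_iff\<close>)
    have 2: "exec I (Countdown L (c' ;; Inc (Suc L))) (\<sigma> f) (ys f) (\<sigma> 0) (ys 0) (f * (?T + 1 + 2) + 1)"
    proof (rule exec_Countdown)
      fix i assume i: "i < f"
      let ?s = "(\<sigma> (Suc i))(L := i)"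
      have env: "(\<lambda>n. ?s (?\<rho> n)) = case_nat (f - Suc i) (\<lambda>n. s (\<rho> n))"
        using nr' by (auto simp: \<sigma>_def fun_eq_iff split: nat.splits)
      have bound: "?s (?\<rho> n) \<le> X + poly b X" for n
        using fun_cong[OF env, of n] * i fb by (auto split: nat.splits intro: trans_le_add1)
      have "exec I c' ?s (ys (Suc i)) ?s (ys i) ?T"
      proof (rule writesD[OF cp'])
        show "?s (?\<rho> n) \<le> X + poly b X" for n by (rule bound)
        show "inputs_bounded m I (X + poly b X)" using *(1) by (rule inputs_bounded_mono) simp
        show "scratch m ?L ?s" using * loop_word_loop_nat.prems by (auto simp: scratch_def \<sigma>_def)
        have "f - i = Suc (f - Suc i)" using i by simp
        then show "ys i = ys (Suc i) @ W I (\<lambda>n. ?s (?\<rho> n))"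
          unfolding env g_def[symmetric] by (simp add: ys_def)
      qed simp
      then show "exec I (c' ;; Inc (Suc L)) ?s (ys (Suc i)) (\<sigma> i) (ys i) (?T + 1)"
        by (rule exec_Seq[OF _ exec_Inc]) (use i in \<open>auto simp: \<sigma>_def fun_eq_iff\<close>)
    qed (use I loop_word_loop_nat.prems in \<open>auto simp: \<sigma>_def\<close>)
    have 3: "exec I (While (Suc L) {0} (Dec (Suc L))) ((\<sigma> 0)(Suc L := f)) (ys 0) ((\<sigma> 0)(Suc L := 0)) (ys 0) (2 * f + 1)"
      by (rule exec_clear) (use I loop_word_loop_nat.prems in auto)
    have 4: "(\<sigma> 0)(Suc L := f) = \<sigma> 0" "(\<sigma> 0)(Suc L := 0) = s"
      using sL by (auto simp: \<sigma>_def fun_eq_iff)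
    have t: "poly p X + ((f * (?T + 1 + 2) + 1) + (2 * f + 1)) \<le> poly ?p X"
      using mult_le_mono1[OF fb, of "?T + 5"] by (simp add: poly_pcompose algebra_simps)
    have "exec I ?c s y s (ys 0) (poly ?p X)"
      using exec_Seq[OF 1[unfolded ys] exec_Seq[OF 2[unfolded ys] 3[unfolded 4(1,2)] order_refl] t] .
    then show "exec I ?c s y s (y @ concat (map (\<lambda>i. W I (case_nat i (\<lambda>n. s (\<rho> n))))
        [0..<F I (\<lambda>n. s (\<rho> n))])) (poly ?p X)"
      by (simp add: ys_def g_def[abs_def] f_def)
  qed
  then show ?case by blast
qed

theorem loop_word_computable:
  assumes "loop_word m W" "0 < m"
  shows "\<exists>M (p :: nat poly). turing_machine M \<and>
    (\<forall>I. length I = m \<longrightarrow> tm_computes M I (W I (\<lambda>_. 0)) (poly p (sum_list (map length I))))"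
proof -
  \<comment> \<open>At top level every variable has the value 0, so the single zero counter
    \<open>m\<close> represents the whole environment.\<close>
  have "frame m (Suc m) (\<lambda>_. m)" by (simp add: frame_def)
  from loop_word_writes[OF assms(1) this] obtain c p where cp: "writes m W (Suc m) (\<lambda>_. m) c p" by auto
  define K where "K = max m (width c)"
  let ?M = "seq_tm (mark_tm m K) (compile K c)"
  have "turing_machine ?M"
    by (rule turing_machine_seq_tm[OF turing_machine_mark_tm turing_machine_compile])
      (auto simp: mark_tm_def prim_tm_def)
  moreover have "tm_computes ?M I (W I (\<lambda>_. 0)) (poly (p + 1) (sum_list (map length I)))"
    if I: "length I = m" for I
  proof -
    have "inputs_bounded m I (sum_list (map length I))"
      unfolding inputs_bounded_def using I by (auto intro!: member_le_sum_list)
    then have "exec I c (\<lambda>_. 0) [] (\<lambda>_. 0) (W I (\<lambda>_. 0)) (poly p (sum_list (map length I)))"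
      by (rule writesD[OF cp]) (auto simp: scratch_def)
    from compiled_tm_computes[OF _ _ this, of K] I show ?thesis by (simp add: K_def)
  qed
  ultimately show ?thesis by blast
qed

corollary loop_word_polytime_function:
  assumes "loop_word 1 W" "\<And>x. f x = W [x] (\<lambda>_. 0)"
  shows "polytime_function f"
proof -
  obtain M and p :: "nat poly" where M: "turing_machine M"
    "\<forall>I. length I = 1 \<longrightarrow> tm_computes M I (W I (\<lambda>_. 0)) (poly p (sum_list (map length I)))"
    using loop_word_computable[OF assms(1)] by auto
  have "tm_computes M [x] (f x) (poly p (length x))" for x
    using M(2)[rule_format, of "[x]"] assms(2) by simp
  then show ?thesis using M(1) unfolding polytime_function_def by blast
qed

corollary loop_fun_polytime_relation:
  assumes "loop_fun 2 F" "\<And>x w. R x w \<longleftrightarrow> F [x, w] (\<lambda>_. 0) \<noteq> 0"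
  shows "polytime_relation R"
proof -
  obtain M and p :: "nat poly" where M: "turing_machine M"
    "\<forall>I. length I = 2 \<longrightarrow>
      tm_computes M I [F I (\<lambda>_. 0) \<noteq> 0] (poly p (sum_list (map length I)))"
    using loop_word_computable[OF loop_word_bit[OF assms(1)]] by auto
  have "tm_computes M [x, w] [R x w] (poly p (length x + length w))" for x w
    using M(2)[rule_format, of "[x, w]"] assms(2) by simp
  then show ?thesis using M(1) unfolding polytime_relation_def by blast
qed

section \<open>Closure properties\<close>

named_theorems loop_intros

lemmas [loop_intros] = loop_fun_var loop_fun_add loop_fun_sub loop_fun_bit loop_fun_length

lemma loop_fun_cong:
  assumes "loop_fun m F" "\<And>I s. F I s = G I s"
  shows "loop_fun m G"
proof -
  have "F = G" by (intro ext assms(2))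
  with assms(1) show ?thesis by simp
qed

lemma loop_fun_rename: "loop_fun m F \<Longrightarrow> loop_fun m (\<lambda>I s. F I (\<lambda>n. s (r n)))"
proof (induction arbitrary: r rule: loop_fun.induct)
  case (loop_fun_sum_nat F G)
  have "loop_fun m (\<lambda>I s. \<Sum>i<F I (\<lambda>n. s (r n)). G I (\<lambda>n. case_nat i s (case_nat 0 (\<lambda>n. Suc (r n)) n)))"
    by (rule loop_fun.loop_fun_sum_nat[OF loop_fun_sum_nat.IH])
  moreover have "(\<lambda>n. case_nat i s (case_nat 0 (\<lambda>n. Suc (r n)) n)) = case_nat i (\<lambda>n. s (r n))"
    for i and s :: "nat \<Rightarrow> nat"
    by (auto simp: fun_eq_iff split: nat.splits)
  ultimately show ?case by simp
qed (rule loop_fun.intros; assumption?)+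

text \<open>With substitution it is enough to treat an operation applied to the variables
  \<open>s 0\<close> and \<open>s 1\<close>: no argument has to be carried under the binders in the
  definition of the operation.\<close>

lemma loop_fun_subst: "loop_fun m F \<Longrightarrow> (\<And>n. loop_fun m (G n)) \<Longrightarrow> loop_fun m (\<lambda>I s. F I (\<lambda>n. G n I s))"
proof (induction arbitrary: G rule: loop_fun.induct)
  case (loop_fun_sum_nat F H)
  let ?G = "case_nat (\<lambda>I s. s 0) (\<lambda>n I s. G n I (\<lambda>k. s (Suc k)))"
  have "loop_fun m (?G n)" for n
    by (cases n) (auto intro: loop_fun_var loop_fun_rename loop_fun_sum_nat.prems)
  then have "loop_fun m (\<lambda>I s. \<Sum>i<F I (\<lambda>n. G n I s). H I (\<lambda>n. ?G n I (case_nat i s)))"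
    by (intro loop_fun.loop_fun_sum_nat loop_fun_sum_nat.IH loop_fun_sum_nat.prems)
  moreover have "(\<lambda>n. ?G n I (case_nat i s)) = case_nat i (\<lambda>n. G n I s)" for I i s
    by (auto simp: fun_eq_iff split: nat.splits)
  ultimately show ?case by simp
qed (simp_all add: loop_fun.intros loop_fun_one[unfolded One_nat_def])

lemma loop_fun_subst1: "loop_fun m (\<lambda>I s. f I (s 0)) \<Longrightarrow> loop_fun m A \<Longrightarrow> loop_fun m (\<lambda>I s. f I (A I s))"
  using loop_fun_subst[of m "\<lambda>I s. f I (s 0)" "\<lambda>_. A"] by simp

lemma loop_fun_subst2:
  "loop_fun m (\<lambda>I s. f I (s 0) (s 1)) \<Longrightarrow> loop_fun m A \<Longrightarrow> loop_fun m B \<Longrightarrow> loop_fun m (\<lambda>I s. f I (A I s) (B I s))"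
  using loop_fun_subst[of m "\<lambda>I s. f I (s 0) (s 1)" "case_nat A (\<lambda>_. B)"] by (simp split: nat.splits)

text \<open>The second premise has the shape obtained by matching under a binder: the bound variable
  becomes \<open>s 0\<close> and the outer environment is shifted by one. Quantifiers are treated
  alike, so \<open>intro loop_intros\<close> copes with nested binders.\<close>

lemma loop_fun_sum [loop_intros]:
  assumes "loop_fun m N" "loop_fun m (\<lambda>I s. F I (\<lambda>n. s (Suc n)) (s 0))"
  shows "loop_fun m (\<lambda>I s. \<Sum>i<N I s. F I s i)"
  using loop_fun_sum_nat[OF assms] by simp

lemma loop_word_loop:
  assumes "loop_fun m N" "loop_word m (\<lambda>I s. W I (\<lambda>n. s (Suc n)) (s 0))"
  shows "loop_word m (\<lambda>I s. concat (map (W I s) [0..<N I s]))"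
  using loop_word_loop_nat[OF assms] by simp

lemma loop_fun_const [loop_intros]: "loop_fun m (\<lambda>I s. c)"
proof (induction c)
  case 0
  show ?case using loop_fun_sub[OF loop_fun_one loop_fun_one, of m] by simp
next
  case (Suc c)
  show ?case using loop_fun_add[OF Suc loop_fun_one] by simp
qed

lemma loop_fun_Suc [loop_intros]: "loop_fun m F \<Longrightarrow> loop_fun m (\<lambda>I s. Suc (F I s))"
  using loop_fun_add[of m F, OF _ loop_fun_const[of m 1]] by simp

lemma loop_fun_mult [loop_intros]: "loop_fun m F \<Longrightarrow> loop_fun m G \<Longrightarrow> loop_fun m (\<lambda>I s. F I s * G I s)"
  using loop_fun_sum[of m F "\<lambda>I s i. G I s"] loop_fun_rename[of m G Suc] by simp

lemma loop_fun_power [loop_intros]: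
  assumes "loop_fun m F"
  shows "loop_fun m (\<lambda>I s. F I s ^ k)"
proof (induction k)
  case 0
  show ?case using loop_fun_const[of m 1] by simp
next
  case (Suc k)
  show ?case using loop_fun_mult[OF assms Suc] by simp
qed

lemma loop_fun_poly [loop_intros]:
  assumes "loop_fun m F"
  shows "loop_fun m (\<lambda>I s. poly p (F I s))"
proof (induction p)
  case 0
  show ?case using loop_fun_const[of m 0] by simp
next
  case (pCons a p)
  show ?case using loop_fun_add[OF loop_fun_const[of m a] loop_fun_mult[OF assms pCons.IH]] by simp
qed

abbreviation loop_pred :: "nat \<Rightarrow> (bool list list \<Rightarrow> (nat \<Rightarrow> nat) \<Rightarrow> bool) \<Rightarrow> bool" where
  "loop_pred m P \<equiv> loop_fun m (\<lambda>I s. of_bool (P I s))"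

lemma loop_pred_not [loop_intros]:
  assumes "loop_pred m P"
  shows "loop_pred m (\<lambda>I s. \<not> P I s)"
proof -
  have "loop_fun m (\<lambda>I s. 1 - of_bool (P I s))" by (rule loop_fun_sub[OF loop_fun_const assms])
  then show ?thesis by (rule loop_fun_cong) simp
qed

lemma loop_pred_conj [loop_intros]:
  assumes "loop_pred m P" "loop_pred m Q"
  shows "loop_pred m (\<lambda>I s. P I s \<and> Q I s)"
proof -
  have "loop_fun m (\<lambda>I s. of_bool (P I s) * of_bool (Q I s))" by (rule loop_fun_mult[OF assms])
  then show ?thesis by (rule loop_fun_cong) (simp add: of_bool_conj)
qed

lemma loop_pred_disj [loop_intros]:
  assumes "loop_pred m P" "loop_pred m Q"
  shows "loop_pred m (\<lambda>I s. P I s \<or> Q I s)"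
proof -
  have "loop_pred m (\<lambda>I s. \<not> (\<not> P I s \<and> \<not> Q I s))" by (intro loop_pred_not loop_pred_conj assms)
  then show ?thesis by (rule loop_fun_cong) simp
qed

lemma loop_pred_imp [loop_intros]:
  assumes "loop_pred m P" "loop_pred m Q"
  shows "loop_pred m (\<lambda>I s. P I s \<longrightarrow> Q I s)"
proof -
  have "loop_pred m (\<lambda>I s. \<not> P I s \<or> Q I s)" by (intro loop_pred_not loop_pred_disj assms)
  then show ?thesis by (rule loop_fun_cong) simp
qed

lemma loop_pred_nonzero:
  assumes "loop_fun m F"
  shows "loop_pred m (\<lambda>I s. 0 < F I s)"
proof -
  have "loop_fun m (\<lambda>I s. 1 - (1 - F I s))" by (rule loop_fun_sub[OF loop_fun_const loop_fun_sub[OF loop_fun_const assms]])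
  then show ?thesis by (rule loop_fun_cong) simp
qed

lemma loop_pred_less [loop_intros]:
  assumes "loop_fun m F" "loop_fun m G"
  shows "loop_pred m (\<lambda>I s. F I s < G I s)"
proof -
  have "loop_pred m (\<lambda>I s. 0 < G I s - F I s)" by (intro loop_pred_nonzero loop_fun_sub assms)
  then show ?thesis by (rule loop_fun_cong) simp
qed

lemma loop_pred_le [loop_intros]:
  assumes "loop_fun m F" "loop_fun m G"
  shows "loop_pred m (\<lambda>I s. F I s \<le> G I s)"
proof -
  have "loop_pred m (\<lambda>I s. F I s < Suc (G I s))" by (intro loop_pred_less loop_fun_Suc assms)
  then show ?thesis by (rule loop_fun_cong) (simp add: less_Suc_eq_le)
qed

lemma loop_pred_eq [loop_intros]:
  assumes "loop_fun m F" "loop_fun m G"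
  shows "loop_pred m (\<lambda>I s. F I s = G I s)"
proof -
  have "loop_pred m (\<lambda>I s. F I s \<le> G I s \<and> G I s \<le> F I s)" by (intro loop_pred_conj loop_pred_le assms)
  then show ?thesis by (rule loop_fun_cong) auto
qed

lemma loop_pred_iff [loop_intros]:
  assumes "loop_pred m P" "loop_pred m Q"
  shows "loop_pred m (\<lambda>I s. P I s = Q I s)"
proof -
  have "loop_pred m (\<lambda>I s. (of_bool (P I s) :: nat) = of_bool (Q I s))" by (intro loop_pred_eq assms)
  then show ?thesis by (rule loop_fun_cong) auto
qed

lemma loop_pred_ex [loop_intros]:
  assumes "loop_fun m N" "loop_pred m (\<lambda>I s. P I (\<lambda>n. s (Suc n)) (s 0))"
  shows "loop_pred m (\<lambda>I s. \<exists>i<N I s. P I s i)"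
proof -
  have "loop_pred m (\<lambda>I s. 0 < (\<Sum>i<N I s. of_bool (P I s i) :: nat))"
    by (intro loop_pred_nonzero loop_fun_sum assms)
  moreover have "(0 < (\<Sum>i<N I s. of_bool (P I s i) :: nat)) = (\<exists>i<N I s. P I s i)" for I s
    by (metis (mono_tags, lifting) finite_lessThan gr0I lessThan_iff less_numeral_extra(3) of_bool_eq_0_iff sum_eq_0_iff)
  ultimately show ?thesis by simp
qed

lemma loop_pred_all [loop_intros]:
  assumes "loop_fun m N" "loop_pred m (\<lambda>I s. P I (\<lambda>n. s (Suc n)) (s 0))"
  shows "loop_pred m (\<lambda>I s. \<forall>i<N I s. P I s i)"
proof -
  have "loop_pred m (\<lambda>I s. \<not> (\<exists>i<N I s. \<not> P I s i))" by (intro loop_pred_not loop_pred_ex assms)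
  then show ?thesis by (rule loop_fun_cong) auto
qed

lemma loop_pred_ex_le [loop_intros]:
  assumes "loop_fun m N" "loop_pred m (\<lambda>I s. P I (\<lambda>n. s (Suc n)) (s 0))"
  shows "loop_pred m (\<lambda>I s. \<exists>i\<le>N I s. P I s i)"
proof -
  have "loop_pred m (\<lambda>I s. \<exists>i<Suc (N I s). P I s i)" by (intro loop_fun_Suc loop_pred_ex assms)
  then show ?thesis by (rule loop_fun_cong) (simp add: less_Suc_eq_le)
qed

lemma loop_pred_all_le [loop_intros]:
  assumes "loop_fun m N" "loop_pred m (\<lambda>I s. P I (\<lambda>n. s (Suc n)) (s 0))"
  shows "loop_pred m (\<lambda>I s. \<forall>i\<le>N I s. P I s i)"
proof -
  have "loop_pred m (\<lambda>I s. \<forall>i<Suc (N I s). P I s i)" by (intro loop_fun_Suc loop_pred_all assms)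
  then show ?thesis by (rule loop_fun_cong) (simp add: less_Suc_eq_le)
qed

lemma loop_fun_if [loop_intros]:
  assumes "loop_pred m P" "loop_fun m F" "loop_fun m G"
  shows "loop_fun m (\<lambda>I s. if P I s then F I s else G I s)"
proof -
  have "loop_fun m (\<lambda>I s. of_bool (P I s) * F I s + of_bool (\<not> P I s) * G I s)"
    using assms by (intro loop_intros)
  then show ?thesis by (rule loop_fun_cong) auto
qed

lemma loop_pred_if [loop_intros]:
  assumes "loop_pred m P" "loop_pred m Q" "loop_pred m R"
  shows "loop_pred m (\<lambda>I s. if P I s then Q I s else R I s)"
proof -
  have "loop_pred m (\<lambda>I s. (P I s \<and> Q I s) \<or> (\<not> P I s \<and> R I s))" by (intro loop_intros assms)
  then show ?thesis by (rule loop_fun_cong) auto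
qed

text \<open>The quotient counts the positive multiples of the divisor up to the dividend; the guard
  gives the value 0 for division by 0.\<close>

lemma loop_fun_div [loop_intros]:
  assumes "loop_fun m F" "loop_fun m G"
  shows "loop_fun m (\<lambda>I s. F I s div G I s)"
proof -
  have "(\<Sum>q<a. of_bool (0 < b \<and> (q + 1) * b \<le> a)) = a div b" for a b :: nat
  proof (cases "b = 0")
    case False
    have "q < a \<and> (q + 1) * b \<le> a \<longleftrightarrow> q < a div b" for q
      using less_eq_div_iff_mult_less_eq[of b "q + 1" a] div_le_dividend[of a b] False
      by (auto simp del: div_le_dividend)
    then have "{q. q < a \<and> (q + 1) * b \<le> a} = {..<a div b}" by auto
    then show ?thesis using False by (simp add: sum.If_cases of_bool_def Int_def)
  qed simp
  moreover have "loop_fun m (\<lambda>I s. \<Sum>q<s 0. of_bool (0 < s 1 \<and> (q + 1) * s 1 \<le> s 0))"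
    by (intro loop_intros)
  ultimately have "loop_fun m (\<lambda>I s. s 0 div s 1)" by simp
  from loop_fun_subst2[of m "\<lambda>I a b. a div b", OF this assms] show ?thesis .
qed

lemma loop_fun_mod [loop_intros]: "loop_fun m F \<Longrightarrow> loop_fun m G \<Longrightarrow> loop_fun m (\<lambda>I s. F I s mod G I s)"
  by (simp add: modulo_nat_def) (intro loop_intros)

lemma loop_pred_dvd [loop_intros]: "loop_fun m F \<Longrightarrow> loop_fun m G \<Longrightarrow> loop_pred m (\<lambda>I s. F I s dvd G I s)"
  by (simp add: dvd_eq_mod_eq_0) (intro loop_intros)

text \<open>Any function on finitely many numbers is hardwired by case distinction. In this way the
  transition tables of arbitrary machines become loop functions.\<close>

lemma loop_fun_finite_table: "loop_fun m F \<Longrightarrow> loop_fun m (\<lambda>I s. if F I s < n then g (F I s) else 0)"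
proof (induction n)
  case (Suc n)
  have "loop_fun m (\<lambda>I s. if F I s = n then g n else if F I s < n then g (F I s) else 0)"
    by (intro loop_intros Suc)
  then show ?case by (rule loop_fun_cong) auto
qed (simp add: loop_fun_const)

lemma loop_fun_finite_table2:
  assumes "loop_fun m F" "loop_fun m G"
  shows "loop_fun m (\<lambda>I s. if F I s < a \<and> G I s < b then g (F I s) (G I s) else 0)"
proof -
  \<comment> \<open>The pair of arguments is packed into one number with remainder \<open>G\<close>
    and quotient \<open>F\<close> modulo \<open>b\<close>.\<close>
  let ?h = "\<lambda>I s. G I s + b * F I s"
  have "loop_fun m (\<lambda>I s. if F I s < a \<and> G I s < b then
      (if ?h I s < b * a then g (?h I s div b) (?h I s mod b) else 0) else 0)"
    by (intro loop_intros assms loop_fun_finite_table[where g = "\<lambda>x. g (x div b) (x mod b)"])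
  moreover have "y + b * x < b * a" if "x < a" "y < b" for x y :: nat
  proof -
    have "y + b * x < b * Suc x" using that by simp
    also have "\<dots> \<le> b * a" using that by (intro mult_le_mono) auto
    finally show ?thesis .
  qed
  ultimately show ?thesis by (elim loop_fun_cong) auto
qed

text \<open>Exponentiation is not available, but powers of 2 are recognised by bounded quantification.\<close>

definition pow2 :: "nat \<Rightarrow> bool" where
  "pow2 y \<longleftrightarrow> 0 < y \<and> (\<forall>d\<le>y. d dvd y \<longrightarrow> d \<noteq> 1 \<longrightarrow> even d)"

lemma pow2_iff: "pow2 y \<longleftrightarrow> (\<exists>a. y = 2 ^ a)"
proof
  assume p: "pow2 y"
  then have y: "y \<noteq> 0" by (simp add: pow2_def)
  \<comment> \<open>The largest power of 2 is split off; the odd cofactor is a divisor of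
    \<open>y\<close> and therefore 1.\<close>
  obtain a z where z: "y = 2 ^ a * z" "odd z"
    using y by (metis dvd_def multiplicity_decompose' not_is_unit_0 numeral_One one_eq_numeral_iff semiring_norm(85) nat_dvd_1_iff_1)
  have "z dvd y" "z \<le> y" using z y by (auto intro: dvd_imp_le)
  then have "z = 1" using p z(2) by (auto simp: pow2_def)
  then show "\<exists>a. y = 2 ^ a" using z by auto
next
  assume "\<exists>a. y = 2 ^ a"
  then obtain a where a: "y = 2 ^ a" by blast
  have "even d" if "d dvd y" "d \<noteq> 1" for d
  proof -
    obtain b where "d = 2 ^ b" using \<open>d dvd y\<close> a divides_primepow_nat[of 2 d a] by auto
    with \<open>d \<noteq> 1\<close> show ?thesis by (cases b) auto
  qed
  then show "pow2 y" using a by (auto simp: pow2_def)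
qed

text \<open>At \<open>2 ^ a\<close> this is the exponent \<open>a\<close>; at \<open>Suc k\<close>
  it is the number of binary digits of \<open>k\<close>.\<close>

definition log2_count :: "nat \<Rightarrow> nat" where
  "log2_count y = (\<Sum>z<y. of_bool (pow2 z))"

lemma log2_count_card: "log2_count y = card {a. 2 ^ a < y}"
proof -
  have "log2_count y = card {z. z < y \<and> pow2 z}"
    by (simp add: log2_count_def sum.If_cases of_bool_def Int_def)
  also have "{z. z < y \<and> pow2 z} = (\<lambda>a. 2 ^ a) ` {a. 2 ^ a < y}" by (auto simp: pow2_iff)
  also have "card \<dots> = card {a. 2 ^ a < y}" by (rule card_image) (auto simp: inj_on_def)
  finally show ?thesis .
qed

section \<open>Length and digits of binary representations\<close>

lemma length_binary_iff: "a < length (binary k) \<longleftrightarrow> 2 ^ a \<le> k"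
proof (induction a arbitrary: k)
  case 0
  show ?case by (simp add: binary.simps[of k])
next
  case (Suc a)
  have "Suc a < length (binary k) \<longleftrightarrow> k \<noteq> 0 \<and> a < length (binary (k div 2))"
    by (simp add: binary.simps[of k])
  also have "\<dots> \<longleftrightarrow> 2 ^ Suc a \<le> k" unfolding Suc by (cases "k = 0") (auto simp: less_eq_div_iff_mult_less_eq mult.commute)
  finally show ?case .
qed

lemma nth_binary: "a < length (binary k) \<Longrightarrow> binary k ! a = odd (k div 2 ^ a)"
proof (induction a arbitrary: k)
  case 0
  then show ?case by (cases "k = 0") (simp_all add: binary.simps[of k], simp add: binary.simps)
next
  case (Suc a)
  then have "k \<noteq> 0" by (cases "k = 0") (auto simp: binary.simps[of 0])
  then show ?case using Suc by (simp add: binary.simps[of k] div_mult2_eq)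
qed

lemma length_binary: "length (binary k) = log2_count (Suc k)"
proof -
  have "{a. 2 ^ a < Suc k} = {..<length (binary k)}"
    using length_binary_iff[of _ k] by (auto simp: less_Suc_eq_le)
  then show ?thesis by (simp add: log2_count_card)
qed

lemma nth_binary_iff:
  "a < length (binary k) \<Longrightarrow>
   binary k ! a \<longleftrightarrow> (\<exists>y\<le>k. pow2 y \<and> log2_count y = a \<and> odd (k div y))"
proof -
  assume a: "a < length (binary k)"
  have *: "log2_count (2 ^ b) = b" for b
  proof -
    have "{c. (2::nat) ^ c < 2 ^ b} = {..<b}" by auto
    then show ?thesis by (simp add: log2_count_card)
  qed
  show ?thesis
    using a length_binary_iff[of a k] nth_binary[OF a] by (auto simp: pow2_iff *)
qed

lemma loop_pred_pow2 [loop_intros]: "loop_fun m F \<Longrightarrow> loop_pred m (\<lambda>I s. pow2 (F I s))"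
  by (rule loop_fun_subst1[of m "\<lambda>I y. of_bool (pow2 y)"]) (unfold pow2_def, intro loop_intros)

lemma loop_fun_log2_count [loop_intros]: "loop_fun m F \<Longrightarrow> loop_fun m (\<lambda>I s. log2_count (F I s))"
  by (rule loop_fun_subst1[of m "\<lambda>I. log2_count"]) (unfold log2_count_def, intro loop_intros)

lemma loop_fun_length_binary [loop_intros]: "loop_fun m F \<Longrightarrow> loop_fun m (\<lambda>I s. length (binary (F I s)))"
  unfolding length_binary by (intro loop_intros)

definition bin_bit :: "nat \<Rightarrow> nat \<Rightarrow> bool" where
  "bin_bit k a \<longleftrightarrow> (\<exists>y\<le>k. pow2 y \<and> log2_count y = a \<and> odd (k div y))"

lemma loop_pred_bin_bit [loop_intros]: "loop_fun m F \<Longrightarrow> loop_fun m G \<Longrightarrow> loop_pred m (\<lambda>I s. bin_bit (F I s) (G I s))"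
  by (rule loop_fun_subst2[of m "\<lambda>I k a. of_bool (bin_bit k a)"]) (unfold bin_bit_def, intro loop_intros)

lemma binary_eq_map: "binary k = map (bin_bit k) [0..<length (binary k)]"
  by (rule nth_equalityI) (auto simp: nth_binary_iff bin_bit_def)

lemma loop_word_map:
  assumes "loop_fun m N" "loop_pred m (\<lambda>I s. P I (\<lambda>n. s (Suc n)) (s 0))"
  shows "loop_word m (\<lambda>I s. map (P I s) [0..<N I s])"
proof -
  have "loop_word m (\<lambda>I s. concat (map (\<lambda>i. [P I s i]) [0..<N I s]))"
    using loop_word_loop[OF assms(1), of "\<lambda>I s i. [P I s i]"] loop_word_bit[OF assms(2)] by simp
  then show ?thesis by simp
qed

lemma loop_word_binary:
  assumes "loop_fun m F"
  shows "loop_word m (\<lambda>I s. binary (F I s))"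
  by (subst binary_eq_map, rule loop_word_map; intro loop_intros assms loop_fun_rename[OF assms])

section \<open>Trees and hypertrees\<close>

text \<open>If \<open>par\<close> gives the parents in a rooted tree and \<open>rk\<close> the depths, then the nonempty sets that induce
  a connected subgraph are those with a vertex \<open>t\<close> such that all other vertices have their parent
  in the set. This replaces connectivity by a condition that is checked vertex by vertex.\<close>

definition top_closed :: "('a \<Rightarrow> 'a) \<Rightarrow> ('a \<Rightarrow> nat) \<Rightarrow> 'a set \<Rightarrow> bool" where
  "top_closed par rk e \<longleftrightarrow> (\<exists>t\<in>e. \<forall>v\<in>e. v \<noteq> t \<longrightarrow> par v \<in> e \<and> rk (par v) < rk v)"

definition parent_graph :: "('a \<Rightarrow> 'a) \<Rightarrow> ('a \<Rightarrow> nat) \<Rightarrow> 'a set \<Rightarrow> 'a graph" where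
  "parent_graph par rk V = \<lparr>verts = V, adj = {(u, v). u \<in> V \<and> v \<in> V \<and>
     (par u = v \<and> rk v < rk u \<or> par v = u \<and> rk u < rk v)}\<rparr>"

text \<open>Ranks strictly decrease along parents, so every vertex of \<open>e\<close> climbs to the
  top vertex without leaving \<open>e\<close>.\<close>

lemma connected_parent_graph:
  assumes "e \<subseteq> V" "top_closed par rk e"
  shows "connected_graph (induced_subgraph (parent_graph par rk V) e)"
proof -
  let ?E = "adj (induced_subgraph (parent_graph par rk V) e)"
  obtain t where t: "t \<in> e" "\<And>v. v \<in> e \<Longrightarrow> v \<noteq> t \<Longrightarrow> par v \<in> e \<and> rk (par v) < rk v"
    using assms(2) by (auto simp: top_closed_def)
  have up: "v \<in> e \<Longrightarrow> (v, t) \<in> ?E\<^sup>*" for v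
  proof (induction "rk v" arbitrary: v rule: less_induct)
    case less
    show ?case
    proof (cases "v = t")
      case False
      then have "(v, par v) \<in> ?E"
        using t(2)[OF less.prems \<open>v \<noteq> t\<close>] less.prems assms(1)
        by (auto simp: induced_subgraph_def parent_graph_def)
      moreover have "(par v, t) \<in> ?E\<^sup>*"
        using less.hyps[of "par v"] t(2)[OF less.prems False] by blast
      ultimately show ?thesis by (rule converse_rtrancl_into_rtrancl)
    qed simp
  qed
  have "sym ?E" by (auto simp: sym_def induced_subgraph_def parent_graph_def)
  then have "sym (?E\<^sup>*)" by (rule sym_rtrancl)
  from symD[OF this up] have "(u, v) \<in> ?E\<^sup>*" if "u \<in> e" "v \<in> e" for u v
    using rtrancl_trans[OF up[OF that(1)]] that(2) by blast
  moreover have "verts (induced_subgraph (parent_graph par rk V) e) = e"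
    using assms(1) by (auto simp: induced_subgraph_def parent_graph_def)
  ultimately show ?thesis using t(1) unfolding connected_graph_def by blast
qed

text \<open>A vertex of maximal rank on a cycle is joined to both its neighbours there by its own
  parent edge. The neighbours coincide, against a length of at least 3.\<close>

lemma tree_parent_graph:
  assumes "finite V" "top_closed par rk V"
  shows "tree (parent_graph par rk V)"
proof -
  let ?T = "parent_graph par rk V"
  have "\<not> graph_cycle ?T vs" for vs
  proof
    assume c: "graph_cycle ?T vs"
    let ?n = "length vs"
    have n: "3 \<le> ?n" and dist: "distinct vs"
      and adj: "\<And>i. i < ?n \<Longrightarrow> (vs ! i, vs ! (Suc i mod ?n)) \<in> adj ?T"
      using c by (auto simp: graph_cycle_def)
    have "Max (rk ` set vs) \<in> rk ` set vs" using n by (intro Max_in) auto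
    then obtain x where "x \<in> set vs" "rk x = Max (rk ` set vs)" by auto
    then have x: "x \<in> set vs" "\<And>y. y \<in> set vs \<Longrightarrow> rk y \<le> rk x" by auto
    then obtain i where i: "i < ?n" "vs ! i = x" by (auto simp: in_set_conv_nth)
    define j where "j = (if i = 0 then ?n - 1 else i - 1)"
    have j: "j < ?n" "Suc j mod ?n = i" using i n by (auto simp: j_def)
    let ?k = "Suc i mod ?n"
    have k: "?k < ?n" using n by (intro mod_less_divisor) auto
    have "vs ! ?k = par x" using adj[OF i(1)] x(2)[OF nth_mem[OF k]] i(2)
      by (auto simp: parent_graph_def)
    moreover have "vs ! j = par x" using adj[OF j(1)] x(2)[OF nth_mem[OF j(1)]] i(2) j(2)
      by (auto simp: parent_graph_def)
    ultimately have "?k = j" using dist j(1) k by (metis nth_eq_iff_index_eq)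
    moreover have "?k = (if Suc i = ?n then 0 else Suc i)" using i by auto
    ultimately show False using n i by (auto simp: j_def split: if_splits)
  qed
  moreover have "connected_graph ?T"
  proof -
    have "induced_subgraph ?T V = ?T" by (auto simp: induced_subgraph_def parent_graph_def)
    then show ?thesis using connected_parent_graph[of V V, OF subset_refl assms(2)] by simp
  qed
  moreover have "simple_graph ?T"
    using assms(1) by (auto simp: simple_graph_def parent_graph_def sym_def irrefl_def)
  ultimately show ?thesis by (simp add: tree_def)
qed

lemma rtrancl_distinct_path:
  "(u, v) \<in> R\<^sup>* \<Longrightarrow> \<exists>p. p \<noteq> [] \<and> hd p = u \<and> last p = v \<and> distinct p \<and>
     successively (\<lambda>x y. (x, y) \<in> R) p"
proof (induction rule: converse_rtrancl_induct)
  case base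
  show ?case by (rule exI[of _ "[v]"]) auto
next
  case (step x y)
  then obtain p where p: "p \<noteq> []" "hd p = y" "last p = v" "distinct p"
    "successively (\<lambda>x y. (x, y) \<in> R) p" by blast
  show ?case
  proof (cases "x \<in> set p")
    case False
    then show ?thesis using p step.hyps(1)
      by (intro exI[of _ "x # p"]) (auto simp: successively_Cons)
  next
    case True
    then obtain a b where "p = a @ x # b" by (auto dest: split_list)
    then show ?thesis using p
      by (intro exI[of _ "x # b"]) (auto simp: successively_append_iff)
  qed
qed

text \<open>The tree is rooted at some \<open>r\<close>, with a neighbour closer to \<open>r\<close>
  as parent of each other vertex; acyclicity leaves no edges besides these. The top of a connected
  set is its vertex closest to \<open>r\<close>.\<close>

lemma tree_parents:
  assumes "tree T"
  shows "\<exists>par rk. (\<forall>v\<in>verts T. par v \<in> verts T \<and> rk v < card (verts T)) \<and>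
    (\<forall>e\<subseteq>verts T. connected_graph (induced_subgraph T e) \<longrightarrow> top_closed par rk e)"
proof -
  have fin: "finite (verts T)" and sub: "adj T \<subseteq> verts T \<times> verts T" and symT: "sym (adj T)"
    and irr: "irrefl (adj T)" and ne: "verts T \<noteq> {}"
    and conn: "\<And>u v. u \<in> verts T \<Longrightarrow> v \<in> verts T \<Longrightarrow> (u, v) \<in> (adj T)\<^sup>*"
    and acyc: "\<And>vs. \<not> graph_cycle T vs"
    using assms by (auto simp: tree_def simple_graph_def connected_graph_def)
  obtain r where r: "r \<in> verts T" using ne by blast
  define d where "d v = (LEAST n. (r, v) \<in> adj T ^^ n)" for v
  have d: "(r, v) \<in> adj T ^^ d v" if "v \<in> verts T" for v
    using conn[OF r that] unfolding d_def rtrancl_power by (auto intro: LeastI)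
  have "\<exists>u. (v, u) \<in> adj T \<and> d u < d v" if "v \<in> verts T" "v \<noteq> r" for v
  proof (cases "d v")
    case 0
    then show ?thesis using d[OF that(1)] that(2) by simp
  next
    case (Suc n)
    with d[OF that(1)] obtain u where u: "(r, u) \<in> adj T ^^ n" "(u, v) \<in> adj T" by auto
    have "d u \<le> n" unfolding d_def by (rule Least_le) (rule u(1))
    then show ?thesis using Suc u(2) symT by (auto dest: symD)
  qed
  then obtain f where f: "\<And>v. v \<in> verts T \<Longrightarrow> v \<noteq> r \<Longrightarrow> (v, f v) \<in> adj T \<and> d (f v) < d v"
    by metis
  define par where "par v = (if v = r then r else f v)" for v
  have par: "(v, par v) \<in> adj T" "d (par v) < d v" if "v \<in> verts T" "v \<noteq> r" for v
    using f[OF that] that by (auto simp: par_def)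
  let ?P = "{(v, par v) | v. v \<in> verts T \<and> v \<noteq> r}"
  let ?E = "?P \<union> ?P\<inverse>"
  have E_sub: "?E \<subseteq> adj T" using par(1) symT by (auto dest: symD)
  have up: "v \<in> verts T \<Longrightarrow> (v, r) \<in> ?P\<^sup>*" for v
  proof (induction "d v" arbitrary: v rule: less_induct)
    case less
    show ?case
    proof (cases "v = r")
      case False
      then have "(v, par v) \<in> ?P" using less.prems by blast
      moreover have "(par v, r) \<in> ?P\<^sup>*"
        using less.hyps[of "par v"] par[OF less.prems False] sub by blast
      ultimately show ?thesis by (rule converse_rtrancl_into_rtrancl)
    qed simp
  qed
  \<comment> \<open>Any other edge would close a cycle with a simple path of parent edges from
    \<open>u\<close> to \<open>v\<close>. That path has at least three vertices because
    \<open>(u, v)\<close> is not a parent edge.\<close>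
  have adj: "(u, v) \<in> ?E" if uv: "(u, v) \<in> adj T" for u v
  proof (rule ccontr)
    assume nE: "(u, v) \<notin> ?E"
    have ur: "(u, r) \<in> ?E\<^sup>*" and vr: "(v, r) \<in> ?E\<^sup>*"
      using up[of u] up[of v] uv sub by (auto intro: in_rtrancl_UnI)
    have "sym ?E" by (auto simp: sym_def)
    then have "sym (?E\<^sup>*)" by (rule sym_rtrancl)
    then have "(u, v) \<in> ?E\<^sup>*" by (rule rtrancl_trans[OF ur symD[OF _ vr]])
    from rtrancl_distinct_path[OF this] obtain p where p: "p \<noteq> []" "hd p = u" "last p = v"
      "distinct p" "successively (\<lambda>x y. (x, y) \<in> ?E) p" by blast
    have "u \<noteq> v" using irr uv by (auto simp: irrefl_def)
    obtain b c q where p_eq: "p = b # c # q"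
      using p(1-3) \<open>u \<noteq> v\<close> by (cases p rule: remdups_adj.cases) auto
    have "q \<noteq> []" using p nE p_eq by auto
    then have len: "3 \<le> length p" using p_eq by (cases q) auto
    have step: "(p ! i, p ! Suc i) \<in> adj T" if "Suc i < length p" for i
    proof -
      have "(p ! i, p ! Suc i) \<in> ?E"
        using p(5) that unfolding successively_conv_nth by blast
      then show ?thesis using E_sub by blast
    qed
    have cyc: "(p ! i, p ! (Suc i mod length p)) \<in> adj T" if i: "i < length p" for i
    proof (cases "Suc i = length p")
      case True
      then have "p ! i = v" using p(1,3) by (simp add: last_conv_nth flip: True)
      moreover have "p ! 0 = u" using p(1,2) by (simp add: hd_conv_nth)
      ultimately show ?thesis using uv symT True by (auto dest: symD)
    qed (use i step in auto)
    have "set p \<subseteq> verts T"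
    proof
      fix x assume "x \<in> set p"
      then obtain i where "i < length p" "x = p ! i" by (auto simp: in_set_conv_nth)
      then show "x \<in> verts T" using subsetD[OF sub cyc[of i]] by simp
    qed
    then have "graph_cycle T p" 
      unfolding graph_cycle_def using len p(4) cyc by blast
    then show False using acyc by blast
  qed
  have anc: "d v \<le> d u" if "(u, v) \<in> ?P\<^sup>*" for u v
    using that
  proof induction
    case (step y z)
    then have "d z < d y" using par(2) by blast
    then show ?case using step.IH by simp
  qed simp
  have anc_less: "d v < d u" if uv: "(u, v) \<in> ?P\<^sup>*" "u \<noteq> v" for u v
    using uv(1)
  proof (cases rule: converse_rtranclE)
    case (step z)
    then have "d z < d u" using par(2) by blast
    then show ?thesis using anc[OF step(2)] by simp
  qed (use uv(2) in simp)
  \<comment> \<open>Counting the strictly closer vertices respects the order of \<open>d\<close>,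
    and the bound by \<open>card (verts T)\<close>, needed for unary storage, is a matter of
    cardinality.\<close>
  define rk where "rk v = card {u \<in> verts T. d u < d v}" for v
  have rk_less: "rk u < rk v" if "d u < d v" "u \<in> verts T" for u v
    unfolding rk_def using that fin by (intro psubset_card_mono) auto
  have "top_closed par rk e" if e: "e \<subseteq> verts T" "connected_graph (induced_subgraph T e)" for e
  proof -
    let ?A = "adj (induced_subgraph T e)"
    have "e \<noteq> {}" using e by (auto simp: connected_graph_def induced_subgraph_def)
    moreover have "finite e" using fin e(1) by (rule rev_finite_subset)
    ultimately obtain t where t: "t \<in> e" "\<And>v. v \<in> e \<Longrightarrow> d t \<le> d v"
      using arg_min_if_finite(1)[of e d] arg_min_least[of e _ d] by blast
    have "par v \<in> e \<and> rk (par v) < rk v" if v: "v \<in> e" "v \<noteq> t" for v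
    proof -
      have "v \<noteq> r"
      proof
        assume "v = r"
        then have "d v < d t" using anc_less[OF up[of t]] t(1) v(2) e(1) by auto
        then show False using t(2)[OF v(1)] by simp
      qed
      have "par v \<in> e"
      proof (rule ccontr)
        assume nv: "par v \<notin> e"
        have "(v, t) \<in> ?A\<^sup>*"
          using e v(1) t(1) by (auto simp: connected_graph_def) (auto simp: induced_subgraph_def)
        \<comment> \<open>A walk inside \<open>e\<close> can leave the subtree below
          \<open>v\<close> only through \<open>par v\<close>. If that vertex is missing,
          \<open>t\<close> is a proper descendant of \<open>v\<close> and hence farther from
          \<open>r\<close> than \<open>v\<close>.\<close>
        then have "(t, v) \<in> ?P\<^sup>*"
        proof induction
          case (step x y)
          then have xy: "(x, y) \<in> adj T" "y \<in> e" by (auto simp: induced_subgraph_def)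
          from adj[OF xy(1)] consider "(x, y) \<in> ?P" | "(y, x) \<in> ?P" by blast
          then show ?case
          proof cases
            case 1
            then have y: "y = par x" by blast
            then have "x \<noteq> v" using nv xy(2) by blast
            from step.IH show ?thesis
            proof (cases rule: converse_rtranclE)
              case (step z)
              then show ?thesis using y by simp
            qed (use \<open>x \<noteq> v\<close> in simp)
          next
            case 2
            then show ?thesis using step.IH by (rule converse_rtrancl_into_rtrancl)
          qed
        qed simp
        then show False using anc_less[of t v] t(2)[OF v(1)] v(2) by auto
      qed
      moreover have "rk (par v) < rk v"
        using par[of v] \<open>v \<noteq> r\<close> v(1) e(1) sub by (intro rk_less) auto
      ultimately show ?thesis ..
    qed
    then show ?thesis using t(1) by (auto simp: top_closed_def)
  qed
  moreover have "par v \<in> verts T" if "v \<in> verts T" for v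
    using that par(1)[OF that] sub r by (cases "v = r") (auto simp: par_def)
  moreover have "rk v < card (verts T)" if "v \<in> verts T" for v
    unfolding rk_def using that fin by (intro psubset_card_mono) auto
  ultimately show ?thesis by blast
qed

lemma hypertree_parents:
  assumes "hypertree H"
  shows "\<exists>par rk. (\<forall>v\<in>hverts H. par v \<in> hverts H \<and> rk v < card (hverts H)) \<and>
    top_closed par rk (hverts H) \<and> (\<forall>e\<in>set (hedges H). top_closed par rk e)"
proof -
  obtain T where T: "tree T" "verts T = hverts H"
    "\<And>e. e \<in> set (hedges H) \<Longrightarrow> connected_graph (induced_subgraph T e)"
    and H: "is_hypergraph H"
    using assms by (auto simp: hypertree_def)
  obtain par rk where pr: "\<forall>v\<in>verts T. par v \<in> verts T \<and> rk v < card (verts T)"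
    "\<forall>e\<subseteq>verts T. connected_graph (induced_subgraph T e) \<longrightarrow> top_closed par rk e"
    using tree_parents[OF T(1)] by (elim exE conjE)
  have "induced_subgraph T (verts T) = T"
    using T(1) by (cases T) (auto simp: induced_subgraph_def tree_def simple_graph_def)
  then have "top_closed par rk (verts T)"
    using pr(2)[rule_format, of "verts T"] T(1) by (simp add: tree_def)
  moreover have "top_closed par rk e" if "e \<in> set (hedges H)" for e
    using pr(2)[rule_format, of e] T(2,3) that H by (auto simp: is_hypergraph_def)
  ultimately show ?thesis using pr(1) unfolding T(2) by blast
qed

lemma hypertree_parent_graph:
  assumes "is_hypergraph H" "top_closed par rk (hverts H)"
    and "\<And>e. e \<in> set (hedges H) \<Longrightarrow> top_closed par rk e"
  shows "hypertree H"
proof -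
  let ?T = "parent_graph par rk (hverts H)"
  have "tree ?T" using assms(1,2) by (intro tree_parent_graph) (auto simp: is_hypergraph_def)
  moreover have "connected_graph (induced_subgraph ?T e)" if "e \<in> set (hedges H)" for e
    using assms(1) assms(3)[OF that] that
    by (intro connected_parent_graph) (auto simp: is_hypergraph_def)
  ultimately show ?thesis
    using assms(1) unfolding hypertree_def
    by (intro conjI exI[of _ ?T]) (auto simp: parent_graph_def)
qed

section \<open>Adjacency in the square of the line graph\<close>

lemma distance_eq_iff:
  "distance G u v = enat n \<longleftrightarrow> (u, v) \<in> adj G ^^ n \<and> (\<forall>k<n. (u, v) \<notin> adj G ^^ k)"
proof (cases "\<exists>n. (u, v) \<in> adj G ^^ n")
  case True
  define k where "k = (LEAST n. (u, v) \<in> adj G ^^ n)"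
  have k: "(u, v) \<in> adj G ^^ k" "\<And>j. (u, v) \<in> adj G ^^ j \<Longrightarrow> k \<le> j"
    using True unfolding k_def by (auto intro: LeastI Least_le)
  have "distance G u v = enat k"
    unfolding distance_def using k by (intro antisym INF_lower2[of k] INF_greatest) auto
  then have "distance G u v = enat n \<longleftrightarrow> n = k" by auto
  also have "\<dots> \<longleftrightarrow> (u, v) \<in> adj G ^^ n \<and> (\<forall>k<n. (u, v) \<notin> adj G ^^ k)"
    using k by (metis leD linorder_neqE_nat)
  finally show ?thesis .
next
  case False
  then show ?thesis by (simp add: distance_def top_enat_def)
qed

text \<open>Distances 1 and 2 merge into one condition, because the hyperedge that meets both may be
  one of the two itself.\<close>

lemma induced_matching_iff:
  assumes "\<forall>e\<in>set (hedges H). e \<noteq> {}"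
  shows "induced_matching H M \<longleftrightarrow> M \<subseteq> {..<length (hedges H)} \<and>
    (\<forall>i\<in>M. \<forall>j\<in>M. i \<noteq> j \<longrightarrow> \<not> (\<exists>l<length (hedges H).
       hedges H ! l \<inter> hedges H ! i \<noteq> {} \<and> hedges H ! l \<inter> hedges H ! j \<noteq> {}))"
proof -
  let ?L = "line_graph H" and ?m = "length (hedges H)" and ?e = "\<lambda>i. hedges H ! i"
  have one: "distance ?L i j = 1 \<longleftrightarrow> i \<noteq> j \<and> (i, j) \<in> adj ?L" for i j
    using distance_eq_iff[of ?L i j 1] by (auto simp: one_enat_def)
  have two: "distance ?L i j = 2 \<longleftrightarrow> i \<noteq> j \<and> (i, j) \<notin> adj ?L \<and> (i, j) \<in> adj ?L O adj ?L" for i j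
  proof -
    have "adj ?L ^^ 2 = adj ?L O adj ?L" by (simp add: numeral_2_eq_2)
    then show ?thesis
      using distance_eq_iff[of ?L i j 2] unfolding numeral_eq_enat by (auto simp: less_2_cases_iff)
  qed
  have key: "((i, j) \<in> adj (graph_square ?L)) \<longleftrightarrow> i \<noteq> j \<and> (\<exists>l<?m. ?e l \<inter> ?e i \<noteq> {} \<and> ?e l \<inter> ?e j \<noteq> {})"
    if ij: "i < ?m" "j < ?m" for i j
  proof
    assume "(i, j) \<in> adj (graph_square ?L)"
    then have "i \<noteq> j" and "(i, j) \<in> adj ?L \<or> (i, j) \<in> adj ?L O adj ?L"
      by (auto simp: graph_square_def one two)
    then show "i \<noteq> j \<and> (\<exists>l<?m. ?e l \<inter> ?e i \<noteq> {} \<and> ?e l \<inter> ?e j \<noteq> {})"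
      using assms ij by (auto simp: line_graph_def)
  next
    assume "i \<noteq> j \<and> (\<exists>l<?m. ?e l \<inter> ?e i \<noteq> {} \<and> ?e l \<inter> ?e j \<noteq> {})"
    then obtain l where l: "i \<noteq> j" "l < ?m" "?e l \<inter> ?e i \<noteq> {}" "?e l \<inter> ?e j \<noteq> {}" by blast
    have "(i, j) \<in> adj ?L \<or> (i, l) \<in> adj ?L \<and> (l, j) \<in> adj ?L"
      using l ij by (cases "l = i"; cases "l = j") (auto simp: line_graph_def)
    then show "(i, j) \<in> adj (graph_square ?L)"
      using l(1) ij by (auto simp: graph_square_def one two) (auto simp: line_graph_def)
  qed
  have "verts (graph_square ?L) = {..<?m}" by (simp add: graph_square_def line_graph_def)
  moreover have "(\<forall>i\<in>M. \<forall>j\<in>M. (i, j) \<notin> adj (graph_square ?L)) \<longleftrightarrow>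
      (\<forall>i\<in>M. \<forall>j\<in>M. i \<noteq> j \<longrightarrow> \<not> (\<exists>l<?m. ?e l \<inter> ?e i \<noteq> {} \<and> ?e l \<inter> ?e j \<noteq> {}))"
    if M: "M \<subseteq> {..<?m}"
  proof (intro ball_cong refl)
    fix i j assume "i \<in> M" "j \<in> M"
    then have "i < ?m" "j < ?m" using M by auto
    from key[OF this] show "(i, j) \<notin> adj (graph_square ?L) \<longleftrightarrow>
        (i \<noteq> j \<longrightarrow> \<not> (\<exists>l<?m. ?e l \<inter> ?e i \<noteq> {} \<and> ?e l \<inter> ?e j \<noteq> {}))" by blast
  qed
  ultimately show ?thesis
    unfolding induced_matching_def independent_set_def by (metis (no_types, lifting))
qed

section \<open>Membership in NP\<close>

definition bit_at :: "bool list \<Rightarrow> nat \<Rightarrow> bool" where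
  "bit_at y i \<longleftrightarrow> i < length y \<and> y ! i"

lemma loop_pred_bit_at [loop_intros]: "j < m \<Longrightarrow> loop_fun m F \<Longrightarrow> loop_pred m (\<lambda>I s. bit_at (I ! j) (F I s))"
  unfolding bit_at_def by (rule loop_fun_bit)

text \<open>The unary prefix with its separator and every flagged row take \<open>Suc n\<close>
  cells each. So row \<open>j\<close> starts at \<open>Suc n + j * Suc n\<close>, and the digits of
  \<open>k\<close> start one cell after \<open>Suc n + m * Suc n\<close>.\<close>

definition has_format :: "(nat \<Rightarrow> bool) \<Rightarrow> nat \<Rightarrow> nat \<Rightarrow> nat \<Rightarrow> bool" where
  "has_format f n m k \<longleftrightarrow> (\<forall>i<n. f i) \<and> \<not> f n \<and> (\<forall>j<m. f (Suc n + j * Suc n)) \<and>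
     \<not> f (Suc n + m * Suc n) \<and>
     (\<forall>a<length (binary k). bin_bit k a = f (Suc (Suc n + m * Suc n) + a))"

definition row_bit :: "(nat \<Rightarrow> bool) \<Rightarrow> nat \<Rightarrow> nat \<Rightarrow> nat \<Rightarrow> bool" where
  "row_bit f n j v \<longleftrightarrow> v < n \<and> f (Suc (Suc n + j * Suc n) + v)"

lemma append_blocks_eq_iff:
  assumes "length as = length as'" "length bs = length bs'"
  shows "as @ [x] @ bs @ [y] @ cs = as' @ [x'] @ bs' @ [y'] @ cs' \<longleftrightarrow>
    as = as' \<and> x = x' \<and> bs = bs' \<and> y = y' \<and> cs = cs'"
  using assms by simp

lemma map_eq_map_upt_iff:
  "map g [0..<n] = map f [a..<a + n] \<longleftrightarrow> (\<forall>i<n. g i = f (a + i))"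
  by (auto simp: list_eq_iff_nth_eq)

lemma row_eq_iff:
  "True # map (\<lambda>v. v \<in> e) [0..<n] = map f [b..<b + Suc n] \<longleftrightarrow>
   f b \<and> (\<forall>v<n. v \<in> e \<longleftrightarrow> f (Suc b + v))"
proof -
  have "[b..<b + Suc n] = b # [Suc b..<Suc b + n]" by (simp add: upt_conv_Cons del: upt_Suc)
  then show ?thesis
    using map_eq_map_upt_iff[of "\<lambda>v. v \<in> e" n f "Suc b"] by (simp del: upt_Suc)
qed

lemma length_rows: "length (concat (map (\<lambda>e. True # map (\<lambda>v. v \<in> e) [0..<n]) es)) = length es * Suc n"
  by (induction es) auto

lemma rows_eq_iff:
  "concat (map (\<lambda>e. True # map (\<lambda>v. v \<in> e) [0..<n]) es) = map f [a..<a + length es * Suc n] \<longleftrightarrow>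
   (\<forall>j<length es. f (a + j * Suc n) \<and> (\<forall>v<n. v \<in> es ! j \<longleftrightarrow> f (Suc (a + j * Suc n) + v)))"
proof (induction es rule: rev_induct)
  case (snoc e es)
  let ?rows = "\<lambda>es. concat (map (\<lambda>e. True # map (\<lambda>v. v \<in> e) [0..<n]) es)"
  let ?c = "a + length es * Suc n"
  have "[a..<a + length (es @ [e]) * Suc n] = [a..<?c] @ [?c..<?c + Suc n]"
    using upt_add_eq_append[of a ?c "Suc n"] by (simp add: algebra_simps del: upt_Suc)
  then have "?rows (es @ [e]) = map f [a..<a + length (es @ [e]) * Suc n] \<longleftrightarrow>
      ?rows es @ True # map (\<lambda>v. v \<in> e) [0..<n] = map f [a..<?c] @ map f [?c..<?c + Suc n]"
    by (simp del: upt_Suc)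
  also have "\<dots> \<longleftrightarrow> ?rows es = map f [a..<?c] \<and>
      True # map (\<lambda>v. v \<in> e) [0..<n] = map f [?c..<?c + Suc n]"
    by (rule append_eq_append_conv) (simp add: length_rows del: upt_Suc)
  also have "\<dots> \<longleftrightarrow> (\<forall>j<Suc (length es). f (a + j * Suc n) \<and>
      (\<forall>v<n. v \<in> (es @ [e]) ! j \<longleftrightarrow> f (Suc (a + j * Suc n) + v)))"
    unfolding snoc.IH row_eq_iff by (simp add: All_less_Suc nth_append conj_ac cong: imp_cong)
  finally show ?case by simp
qed simp

text \<open>Parsing is replaced by checking guessed values of \<open>n\<close>, \<open>k\<close> and
  the number of rows: at the right length, being the code word is a condition on single positions,
  which bounded quantifiers express.\<close>

lemma encode_instance_eq_iff:
  "encode_instance n es k = map f [0..<Suc (Suc n + length es * Suc n) + length (binary k)] \<longleftrightarrow>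
   has_format f n (length es) k \<and> (\<forall>j<length es. \<forall>v<n. v \<in> es ! j \<longleftrightarrow> row_bit f n j v)"
proof -
  let ?m = "length es" and ?l = "length (binary k)"
  let ?a = "Suc n + ?m * Suc n"
  let ?rows = "concat (map (\<lambda>e. True # map (\<lambda>v. v \<in> e) [0..<n]) es)"
  have "[0..<Suc ?a + ?l] = [0..<n] @ [n] @ [Suc n..<?a] @ [?a] @ [Suc ?a..<Suc ?a + ?l]"
    using upt_add_eq_append[of 0 "Suc ?a" ?l] upt_add_eq_append[of 0 "Suc n" "?m * Suc n"] by simp
  then have "encode_instance n es k = map f [0..<Suc ?a + ?l] \<longleftrightarrow>
    replicate n True @ [False] @ ?rows @ [False] @ binary k =
    map f [0..<n] @ [f n] @ map f [Suc n..<?a] @ [f ?a] @ map f [Suc ?a..<Suc ?a + ?l]"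
    by (simp add: encode_instance_def del: upt_Suc)
  also have "\<dots> \<longleftrightarrow> replicate n True = map f [0..<n] \<and> False = f n \<and>
    ?rows = map f [Suc n..<?a] \<and> False = f ?a \<and> binary k = map f [Suc ?a..<Suc ?a + ?l]"
    by (rule append_blocks_eq_iff) (simp_all add: length_rows del: upt_Suc)
  also have "replicate n True = map f [0..<n] \<longleftrightarrow> (\<forall>i<n. f i)"
    by (simp add: list_eq_iff_nth_eq)
  also have "binary k = map f [Suc ?a..<Suc ?a + ?l] \<longleftrightarrow> (\<forall>a<?l. bin_bit k a = f (Suc ?a + a))"
    by (subst (1) binary_eq_map) (rule map_eq_map_upt_iff)
  also note rows_eq_iff[of n es f "Suc n"]
  also have "(\<forall>j<?m. P j \<and> (\<forall>v<n. S j v = Q j v)) \<longleftrightarrow>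
      (\<forall>j<?m. P j) \<and> (\<forall>j<?m. \<forall>v<n. S j v = (v < n \<and> Q j v))" for P S Q
    by auto
  finally show ?thesis
    unfolding has_format_def row_bit_def by (simp only: simp_thms conj_ac)
qed

text \<open>A certificate consists of \<open>2n\<close> rows of length \<open>n\<close>, which give the ranks and the parents of
  the vertices in unary, followed by the characteristic vector of the matching.\<close>

definition row_sum :: "(nat \<Rightarrow> bool) \<Rightarrow> nat \<Rightarrow> nat \<Rightarrow> nat" where
  "row_sum g n u = (\<Sum>v<n. of_bool (g (u * n + v)))"

definition good_edge :: "(nat \<Rightarrow> bool) \<Rightarrow> (nat \<Rightarrow> bool) \<Rightarrow> nat \<Rightarrow> nat \<Rightarrow> bool" where
  "good_edge f g n j \<longleftrightarrow> (\<exists>t<n. row_bit f n j t \<and> (\<forall>v<n. row_bit f n j v \<longrightarrow> v \<noteq> t \<longrightarrow>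
      row_bit f n j (row_sum g n (n + v)) \<and>
      row_sum g n (row_sum g n (n + v)) < row_sum g n v))"

text \<open>Closedness of the whole vertex set makes the parent graph a tree. The root must exist,
  so \<open>n = 0\<close> is rejected, in accordance with the empty graph not being
  connected.\<close>

definition good_verts :: "(nat \<Rightarrow> bool) \<Rightarrow> nat \<Rightarrow> bool" where
  "good_verts g n \<longleftrightarrow> (\<exists>t<n. \<forall>v<n. v \<noteq> t \<longrightarrow>
      row_sum g n (n + v) < n \<and> row_sum g n (row_sum g n (n + v)) < row_sum g n v)"

definition rows_meet :: "(nat \<Rightarrow> bool) \<Rightarrow> nat \<Rightarrow> nat \<Rightarrow> nat \<Rightarrow> bool" where
  "rows_meet f n i j \<longleftrightarrow> (\<exists>v<n. row_bit f n i v \<and> row_bit f n j v)"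

definition selected :: "(nat \<Rightarrow> bool) \<Rightarrow> nat \<Rightarrow> nat \<Rightarrow> bool" where
  "selected g n j \<longleftrightarrow> g (2 * n * n + j)"

definition good_matching :: "(nat \<Rightarrow> bool) \<Rightarrow> (nat \<Rightarrow> bool) \<Rightarrow> nat \<Rightarrow> nat \<Rightarrow> nat \<Rightarrow> bool" where
  "good_matching f g n m k \<longleftrightarrow>
     (\<forall>i<m. \<forall>j<m. selected g n i \<longrightarrow> selected g n j \<longrightarrow> i \<noteq> j \<longrightarrow>
        \<not> (\<exists>l<m. rows_meet f n l i \<and> rows_meet f n l j)) \<and>
     k \<le> (\<Sum>j<m. of_bool (selected g n j))"

definition verifies :: "bool list \<Rightarrow> bool list \<Rightarrow> nat \<Rightarrow> nat \<Rightarrow> nat \<Rightarrow> bool" where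
  "verifies x w n m k \<longleftrightarrow>
     length x = Suc (Suc n + m * Suc n) + length (binary k) \<and> has_format (bit_at x) n m k \<and>
     good_verts (bit_at w) n \<and> (\<forall>j<m. good_edge (bit_at x) (bit_at w) n j) \<and>
     good_matching (bit_at x) (bit_at w) n m k"

text \<open>A number in binary may exceed the length of the word, but \<open>good_matching\<close>
  forces \<open>k \<le> m\<close>, so the bound on \<open>k\<close> excludes no instance that can be
  verified.\<close>

definition verifier :: "bool list \<Rightarrow> bool list \<Rightarrow> bool" where
  "verifier x w \<longleftrightarrow> (\<exists>n\<le>length x. \<exists>m\<le>length x. \<exists>k\<le>length x. verifies x w n m k)"

lemma polytime_verifier: "polytime_relation verifier"
proof (rule loop_fun_polytime_relation)
  have "loop_pred 2 (\<lambda>I s. \<exists>n\<le>length (I ! 0). \<exists>m\<le>length (I ! 0). \<exists>k\<le>length (I ! 0).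
      verifies (I ! 0) (I ! 1) n m k)"
    unfolding verifies_def has_format_def good_verts_def good_edge_def good_matching_def
      selected_def rows_meet_def row_sum_def row_bit_def
    by (intro loop_intros) simp_all
  then show "loop_pred 2 (\<lambda>I s. verifier (I ! 0) (I ! 1))" by (simp add: verifier_def)
qed simp

lemma good_edge_iff:
  assumes "e \<subseteq> {..<n}" "\<And>v. v < n \<Longrightarrow> v \<in> e \<longleftrightarrow> row_bit f n j v"
  shows "good_edge f g n j \<longleftrightarrow> top_closed (\<lambda>v. row_sum g n (n + v)) (row_sum g n) e"
proof -
  have lt: "row_bit f n j v \<Longrightarrow> v < n" for v by (simp add: row_bit_def)
  have "e = {v. row_bit f n j v}" using assms by (auto simp: row_bit_def)
  moreover have "(\<exists>t<n. row_bit f n j t \<and> Q t) \<longleftrightarrow> (\<exists>t. row_bit f n j t \<and> Q t)"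
    and "(\<forall>t<n. row_bit f n j t \<longrightarrow> Q t) \<longleftrightarrow> (\<forall>t. row_bit f n j t \<longrightarrow> Q t)" for Q
    using lt by blast+
  ultimately show ?thesis
    unfolding good_edge_def top_closed_def Bex_def Ball_def by simp
qed

lemma good_verts_iff:
  "good_verts g n \<longleftrightarrow> top_closed (\<lambda>v. row_sum g n (n + v)) (row_sum g n) {..<n}"
  by (auto simp: good_verts_def top_closed_def)

lemma good_matching_iff:
  assumes "\<And>e. e \<in> set es \<Longrightarrow> e \<subseteq> {..<n}" "\<And>e. e \<in> set es \<Longrightarrow> e \<noteq> {}"
    and "\<And>j v. j < length es \<Longrightarrow> v < n \<Longrightarrow> v \<in> es ! j \<longleftrightarrow> row_bit f n j v"
  shows "good_matching f g n (length es) k \<longleftrightarrow>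
    induced_matching \<lparr>hverts = {..<n}, hedges = es\<rparr> {j. j < length es \<and> selected g n j} \<and>
    k \<le> card {j. j < length es \<and> selected g n j}"
proof -
  let ?m = "length es"
  have meet: "rows_meet f n i j \<longleftrightarrow> es ! i \<inter> es ! j \<noteq> {}" if "i < ?m" "j < ?m" for i j
  proof -
    have "es ! i \<subseteq> {..<n}" using assms(1) that by simp
    then show ?thesis using assms(3) that unfolding rows_meet_def by blast
  qed
  have "(\<Sum>j<?m. of_bool (selected g n j)) = card {j. j < ?m \<and> selected g n j}"
    by (simp add: sum.If_cases of_bool_def Int_def)
  moreover have "(\<forall>i<?m. \<forall>j<?m. selected g n i \<longrightarrow> selected g n j \<longrightarrow> i \<noteq> j \<longrightarrow>
        \<not> (\<exists>l<?m. rows_meet f n l i \<and> rows_meet f n l j)) \<longleftrightarrow>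
     (\<forall>i\<in>{j. j < ?m \<and> selected g n j}. \<forall>j\<in>{j. j < ?m \<and> selected g n j}. i \<noteq> j \<longrightarrow>
        \<not> (\<exists>l<?m. es ! l \<inter> es ! i \<noteq> {} \<and> es ! l \<inter> es ! j \<noteq> {}))"
    using meet by (simp cong: conj_cong) blast
  ultimately show ?thesis
    unfolding good_matching_def using assms(2) by (subst induced_matching_iff) auto
qed

lemma verifies_imp_mim_hypertree:
  assumes "verifies x w n m k"
  shows "x \<in> mim_hypertree"
proof -
  let ?f = "bit_at x" and ?g = "bit_at w"
  define es where "es = map (\<lambda>j. {v. row_bit ?f n j v}) [0..<m]"
  let ?H = "\<lparr>hverts = {..<n}, hedges = es\<rparr>"
  have m: "length es = m" by (simp add: es_def)
  have sub: "e \<subseteq> {..<n}" if "e \<in> set es" for e using that by (auto simp: es_def row_bit_def)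
  have bit: "v \<in> es ! j \<longleftrightarrow> row_bit ?f n j v" if "j < m" for j v using that by (simp add: es_def)
  have "map ?f [0..<length x] = x" by (rule nth_equalityI) (auto simp: bit_at_def)
  then have x: "x = encode_instance n es k"
    using encode_instance_eq_iff[of n es k ?f] assms bit by (simp add: verifies_def m)
  have top: "top_closed (\<lambda>v. row_sum ?g n (n + v)) (row_sum ?g n) e" if "e \<in> set es" for e
  proof -
    obtain j where j: "j < m" "e = es ! j" using \<open>e \<in> set es\<close> by (auto simp: in_set_conv_nth m)
    then show ?thesis using assms good_edge_iff[of e n ?f j ?g] sub bit that by (auto simp: verifies_def)
  qed
  have ne: "e \<noteq> {}" if "e \<in> set es" for e using top[OF that] by (auto simp: top_closed_def)
  have "top_closed (\<lambda>v. row_sum ?g n (n + v)) (row_sum ?g n) {..<n}"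
    using assms by (simp add: verifies_def good_verts_iff)
  then have "hypertree ?H"
    using hypertree_parent_graph[of ?H] top sub
    by (auto simp: is_hypergraph_def)
  moreover have "good_matching ?f ?g n (length es) k" using assms by (simp add: verifies_def m)
  then have "maximum_induced_matching ?H k"
    using good_matching_iff[of es n ?f ?g k] sub ne bit m by (auto simp: maximum_induced_matching_def)
  ultimately show ?thesis using x by (auto simp: mim_hypertree_def)
qed

definition certificate :: "nat \<Rightarrow> nat \<Rightarrow> (nat \<Rightarrow> nat) \<Rightarrow> (nat \<Rightarrow> nat) \<Rightarrow> nat set \<Rightarrow> bool list" where
  "certificate n m par rk M = map (\<lambda>i.
     if i < n * n then i mod n < rk (i div n)
     else if i < 2 * n * n then i mod n < par (i div n - n)
     else i - 2 * n * n \<in> M) [0..<2 * n * n + m]"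

lemma row_sum_certificate:
  assumes "u < 2 * n" "u < n \<Longrightarrow> rk u \<le> n" "n \<le> u \<Longrightarrow> par (u - n) \<le> n"
  shows "row_sum (bit_at (certificate n m par rk M)) n u = (if u < n then rk u else par (u - n))"
proof -
  let ?r = "if u < n then rk u else par (u - n)"
  have "bit_at (certificate n m par rk M) (u * n + v) \<longleftrightarrow> v < ?r" if v: "v < n" for v
  proof -
    \<comment> \<open>As \<open>v < n\<close>, the position lies before row \<open>c\<close> iff
      \<open>u < c\<close>; this decides whether row \<open>u\<close> belongs to the ranks or to the
      parents.\<close>
    have lt: "u * n + v < c * n \<longleftrightarrow> u < c" for c
      using v by (metis div_less_iff_less_mult div_mult_self3 add.commute div_less add_0 gr_implies_not0 neq0_conv mult.commute)
    have "(u * n + v) div n = u" "(u * n + v) mod n = v" using v by auto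
    moreover have "u * n + v < 2 * n * n + m" using lt[of "2 * n"] assms(1) by simp
    ultimately show ?thesis
      using lt[of n] lt[of "2 * n"] assms(1) by (simp add: bit_at_def certificate_def)
  qed
  then have "row_sum (bit_at (certificate n m par rk M)) n u = (\<Sum>v<n. of_bool (v < ?r))"
    unfolding row_sum_def by (intro sum.cong) auto
  also have "\<dots> = card {v. v < n \<and> v < ?r}" by (simp add: sum.If_cases of_bool_def Int_def)
  also have "{v. v < n \<and> v < ?r} = {..<?r}" using assms by auto
  finally show ?thesis by simp
qed

lemma ex_verifies:
  assumes "hypertree \<lparr>hverts = {..<n}, hedges = es\<rparr>"
    and "induced_matching \<lparr>hverts = {..<n}, hedges = es\<rparr> M" and "k \<le> card M"
  shows "\<exists>w. length w = 2 * n * n + length es \<and> verifies (encode_instance n es k) w n (length es) k"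
proof -
  let ?H = "\<lparr>hverts = {..<n}, hedges = es\<rparr>" and ?m = "length es"
  let ?x = "encode_instance n es k"
  have H: "is_hypergraph ?H" using assms(1) by (simp add: hypertree_def)
  then have sub: "e \<subseteq> {..<n}" if "e \<in> set es" for e using that by (auto simp: is_hypergraph_def)
  obtain par rk where pr: "\<forall>v<n. par v < n \<and> rk v < n" "top_closed par rk {..<n}"
    "\<forall>e\<in>set es. top_closed par rk e"
    using hypertree_parents[OF assms(1)] by auto
  have ne: "e \<noteq> {}" if "e \<in> set es" for e using pr(3) that by (auto simp: top_closed_def)
  let ?w = "certificate n ?m par rk M"
  have par: "row_sum (bit_at ?w) n (n + v) = par v" and rk: "row_sum (bit_at ?w) n v = rk v"
    if "v < n" for v
    using pr(1) that by (subst row_sum_certificate; auto simp: less_imp_le)+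
  have top_eq: "top_closed (\<lambda>v. row_sum (bit_at ?w) n (n + v)) (row_sum (bit_at ?w) n) e \<longleftrightarrow>
      top_closed par rk e" if "e \<subseteq> {..<n}" for e
    unfolding top_closed_def using that pr(1) par rk
    by (intro bex_cong ball_cong imp_cong refl) (auto simp: subset_iff)
  have "length (concat (map (\<lambda>e. True # map (\<lambda>v. v \<in> e) [0..<n]) es)) = ?m * Suc n"
    by (induction es) auto
  then have len: "length ?x = Suc (Suc n + ?m * Suc n) + length (binary k)"
    by (simp add: encode_instance_def)
  have "map (bit_at ?x) [0..<length ?x] = ?x" by (rule nth_equalityI) (auto simp: bit_at_def)
  then have fmt: "has_format (bit_at ?x) n ?m k"
    and bit: "\<And>j v. j < ?m \<Longrightarrow> v < n \<Longrightarrow> v \<in> es ! j \<longleftrightarrow> row_bit (bit_at ?x) n j v"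
    using encode_instance_eq_iff[of n es k "bit_at ?x"] by (simp_all add: len)
  have "good_verts (bit_at ?w) n" using pr(2) by (simp add: good_verts_iff top_eq)
  moreover have "good_edge (bit_at ?x) (bit_at ?w) n j" if "j < ?m" for j
    using good_edge_iff[of "es ! j" n "bit_at ?x" j "bit_at ?w"] top_eq[of "es ! j"] sub[of "es ! j"]
      bit pr(3) that by auto
  moreover have "good_matching (bit_at ?x) (bit_at ?w) n ?m k"
  proof -
    have "M \<subseteq> {..<?m}" using assms(2) ne by (subst (asm) induced_matching_iff) auto
    then have "{j. j < ?m \<and> selected (bit_at ?w) n j} = M"
      by (auto simp: selected_def bit_at_def certificate_def)
    then show ?thesis using good_matching_iff[of es n "bit_at ?x" "bit_at ?w" k] sub ne bit assms(2,3)
      by simp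
  qed
  ultimately have "verifies ?x ?w n ?m k" using fmt len by (simp add: verifies_def)
  moreover have "length ?w = 2 * n * n + ?m" by (simp add: certificate_def)
  ultimately show ?thesis by blast
qed

lemma card_induced_matching_le:
  assumes "induced_matching H M"
  shows "card M \<le> length (hedges H)"
proof -
  have "M \<subseteq> {..<length (hedges H)}"
    using assms by (auto simp: induced_matching_def independent_set_def graph_square_def line_graph_def)
  then show ?thesis using card_mono[of "{..<length (hedges H)}" M] by simp
qed

lemma mim_hypertree_in_NP: "in_NP mim_hypertree"
  unfolding in_NP_def
\<comment> \<open>The certificate has \<open>2 * n * n + m\<close> bits, and \<open>n + m\<close> is
  at most the length of \<open>x\<close>; hence the polynomial with coefficients 0, 1, 2.\<close>
proof (intro exI[of _ verifier] exI[of _ "[:0, 1, 2:] :: nat poly"] conjI allI)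
  show "polytime_relation verifier" by (rule polytime_verifier)
  fix x
  show "x \<in> mim_hypertree \<longleftrightarrow> (\<exists>w. length w \<le> poly [:0, 1, 2:] (length x) \<and> verifier x w)"
  proof
    assume "x \<in> mim_hypertree"
    then obtain n es k M where x: "x = encode_instance n es k"
      and H: "hypertree \<lparr>hverts = {..<n}, hedges = es\<rparr>"
      and M: "induced_matching \<lparr>hverts = {..<n}, hedges = es\<rparr> M" "k \<le> card M"
      by (auto simp: mim_hypertree_def maximum_induced_matching_def)
    obtain w where w: "length w = 2 * n * n + length es" "verifies x w n (length es) k"
      using ex_verifies[OF H M] x by blast
    have k: "k \<le> length es" using card_induced_matching_le[OF M(1)] M(2) by simp
    have len: "n + length es \<le> length x" using w(2) by (simp add: verifies_def)
    then have "verifier x w" using w(2) k unfolding verifier_def by (meson add_leE le_trans)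
    moreover have "length w \<le> poly [:0, 1, 2:] (length x)"
    proof -
      have "n * n \<le> length x * length x" using len by (intro mult_le_mono) auto
      then show ?thesis using w(1) len by (simp add: algebra_simps)
    qed
    ultimately show "\<exists>w. length w \<le> poly [:0, 1, 2:] (length x) \<and> verifier x w" by blast
  next
    assume "\<exists>w. length w \<le> poly [:0, 1, 2:] (length x) \<and> verifier x w"
    then show "x \<in> mim_hypertree" unfolding verifier_def using verifies_imp_mim_hypertree by blast
  qed
qed

section \<open>Independent sets as induced matchings of stars\<close>

text \<open>The vertex \<open>N\<close> is the centre of a star with leaves \<open>0, \<dots>, N - 1\<close>.\<close>

definition spoke :: "nat \<Rightarrow> (nat \<Rightarrow> nat \<Rightarrow> bool) \<Rightarrow> nat \<Rightarrow> nat \<Rightarrow> nat set" where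
  "spoke N C u v = {i. i = N \<or> i = u \<or> i = v \<and> C u v}"

text \<open>Every singleton meets a spoke and all spokes meet in the centre, so that a spoke excludes every
  other hyperedge from an induced matching; and the singletons of \<open>u\<close> and \<open>v\<close> exclude each other iff
  they are joined by a spoke.\<close>

definition star_edges :: "nat \<Rightarrow> (nat \<Rightarrow> nat \<Rightarrow> bool) \<Rightarrow> nat set list" where
  "star_edges N C = map (\<lambda>u. {u}) [0..<N] @ concat (map (\<lambda>u. map (spoke N C u) [0..<N]) [0..<N])"

lemma set_star_edges:
  "set (star_edges N C) = (\<lambda>u. {u}) ` {..<N} \<union> {spoke N C u v | u v. u < N \<and> v < N}"
  by (auto simp: star_edges_def)

lemma hypertree_star: "hypertree \<lparr>hverts = {..<Suc N}, hedges = star_edges N C\<rparr>"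
proof (rule hypertree_parent_graph)
  show "is_hypergraph \<lparr>hverts = {..<Suc N}, hedges = star_edges N C\<rparr>"
    by (auto simp: is_hypergraph_def set_star_edges spoke_def)
  \<comment> \<open>The star as a rooted tree: the centre \<open>N\<close> has rank 0 and is the
    parent of all leaves, which have rank 1.\<close>
  have c: "top_closed (\<lambda>_. N) (\<lambda>v. of_bool (v \<noteq> N)) e" if "N \<in> e" for e
    using that by (auto simp: top_closed_def intro!: bexI[of _ N])
  then show "top_closed (\<lambda>_. N) (\<lambda>v. of_bool (v \<noteq> N))
      (hverts \<lparr>hverts = {..<Suc N}, hedges = star_edges N C\<rparr>)"
    by simp
  fix e assume "e \<in> set (hedges \<lparr>hverts = {..<Suc N}, hedges = star_edges N C\<rparr>)"
  then consider u where "e = {u}" | u v where "e = spoke N C u v" by (auto simp: set_star_edges)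
  then show "top_closed (\<lambda>_. N) (\<lambda>v. of_bool (v \<noteq> N)) e"
  proof cases
    case 1
    then show ?thesis by (simp add: top_closed_def)
  next
    case 2
    then show ?thesis by (intro c) (simp add: spoke_def)
  qed
qed

text \<open>The bound \<open>2 \<le> k\<close> discards matchings that consist of one spoke; a
  matching with two elements contains only singletons. As \<open>{u}\<close> stands at position
  \<open>u\<close> of the list, such a matching is literally a set of vertices.\<close>

lemma maximum_induced_matching_star:
  assumes "2 \<le> k" "\<And>u. \<not> C u u"
  shows "maximum_induced_matching \<lparr>hverts = {..<Suc N}, hedges = star_edges N C\<rparr> k \<longleftrightarrow>
    (\<exists>S\<subseteq>{..<N}. k \<le> card S \<and> (\<forall>u\<in>S. \<forall>v\<in>S. \<not> C u v))"
proof -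
  let ?es = "star_edges N C" and ?H = "\<lparr>hverts = {..<Suc N}, hedges = star_edges N C\<rparr>"
  let ?m = "length ?es"
  have ne: "\<forall>e\<in>set (hedges ?H). e \<noteq> {}" by (auto simp: set_star_edges spoke_def)
  have single: "?es ! u = {u}" "u < ?m" if "u < N" for u
    using that by (auto simp: star_edges_def nth_append)
  have spoke_nth: "\<exists>a<N. \<exists>b<N. ?es ! l = spoke N C a b" if "l < ?m" "N \<le> l" for l
  proof -
    let ?sp = "concat (map (\<lambda>u. map (spoke N C u) [0..<N]) [0..<N])"
    have "?es ! l = ?sp ! (l - N)" "l - N < length ?sp"
      using that by (auto simp: star_edges_def nth_append)
    then have "?es ! l \<in> set ?sp" by (simp only: nth_mem)
    then obtain a b where "a < N" "b < N" "?es ! l = spoke N C a b" by auto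
    then show ?thesis by blast
  qed
  have ex_spoke: "\<exists>l<?m. ?es ! l = spoke N C u v" if "u < N" "v < N" for u v
  proof -
    have "spoke N C u v \<in> set ?es" using that by (auto simp: set_star_edges)
    then show ?thesis by (auto simp: in_set_conv_nth)
  qed
  show ?thesis
  proof
    assume "maximum_induced_matching ?H k"
    then obtain M where M: "induced_matching ?H M" "k \<le> card M"
      by (auto simp: maximum_induced_matching_def)
    then have sub: "M \<subseteq> {..<?m}"
      and ind: "\<And>i j l. i \<in> M \<Longrightarrow> j \<in> M \<Longrightarrow> i \<noteq> j \<Longrightarrow> l < ?m \<Longrightarrow>
        ?es ! l \<inter> ?es ! i = {} \<or> ?es ! l \<inter> ?es ! j = {}"
      unfolding induced_matching_iff[OF ne] by auto
    have "M \<subseteq> {..<N}"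
    proof (rule ccontr)
      assume "\<not> M \<subseteq> {..<N}"
      then obtain i where i: "i \<in> M" "N \<le> i" by (auto simp: subset_iff not_less)
      have "\<not> M \<subseteq> {i}" using M(2) assms(1) card_mono[of "{i}" M] by auto
      then obtain j where j: "j \<in> M" "j \<noteq> i" by blast
      have iN: "N \<in> ?es ! i" using spoke_nth[of i] i sub by (auto simp: spoke_def)
      show False
      proof (cases "j < N")
        case True
        \<comment> \<open>This spoke is \<open>{N, j}\<close>, whatever \<open>C\<close> is; it
          meets the spoke at \<open>i\<close> in the centre and the singleton
          \<open>{j}\<close>.\<close>
        obtain l where l: "l < ?m" "?es ! l = spoke N C j j" using ex_spoke[OF True True] by blast
        have "N \<in> ?es ! l" "j \<in> ?es ! l" using l(2) by (auto simp: spoke_def)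
        then show False using ind[OF i(1) j(1) _ l(1)] j(2) iN single(1)[OF True] by auto
      next
        case False
        then have "N \<in> ?es ! j" using spoke_nth[of j] j sub by (auto simp: spoke_def)
        then show False using ind[OF i(1) j(1) _, of i] i j(2) iN sub by auto
      qed
    qed
    moreover have "\<not> C u v" if uv: "u \<in> M" "v \<in> M" for u v
    proof
      assume C: "C u v"
      then have "u \<noteq> v" using assms(2) by auto
      have lt: "u < N" "v < N" using uv \<open>M \<subseteq> {..<N}\<close> by auto
      obtain l where l: "l < ?m" "?es ! l = spoke N C u v" using ex_spoke[OF lt] by blast
      have "u \<in> ?es ! l" "v \<in> ?es ! l" using l(2) C by (auto simp: spoke_def)
      then show False using ind[OF uv \<open>u \<noteq> v\<close> l(1)] single(1)[OF lt(1)] single(1)[OF lt(2)] by auto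
    qed
    ultimately show "\<exists>S\<subseteq>{..<N}. k \<le> card S \<and> (\<forall>u\<in>S. \<forall>v\<in>S. \<not> C u v)" using M(2) by blast
  next
    assume "\<exists>S\<subseteq>{..<N}. k \<le> card S \<and> (\<forall>u\<in>S. \<forall>v\<in>S. \<not> C u v)"
    then obtain S where S: "S \<subseteq> {..<N}" "k \<le> card S" "\<And>u v. u \<in> S \<Longrightarrow> v \<in> S \<Longrightarrow> \<not> C u v" by blast
    have "\<not> (?es ! l \<inter> ?es ! u \<noteq> {} \<and> ?es ! l \<inter> ?es ! v \<noteq> {})"
      if uv: "u \<in> S" "v \<in> S" "u \<noteq> v" and l: "l < ?m" for u v l
    proof
      assume *: "?es ! l \<inter> ?es ! u \<noteq> {} \<and> ?es ! l \<inter> ?es ! v \<noteq> {}"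
      have lt: "u < N" "v < N" using uv S(1) by auto
      then have in_l: "u \<in> ?es ! l" "v \<in> ?es ! l" using * single(1) by auto
      show False
      proof (cases "l < N")
        case True
        then show False using in_l single(1) uv(3) by auto
      next
        case False
        then obtain a b where "?es ! l = spoke N C a b" using spoke_nth[OF l] by auto
        then have "C u v \<or> C v u" using in_l lt uv(3) by (auto simp: spoke_def)
        then show False using S(3) uv by blast
      qed
    qed
    moreover have "S \<subseteq> {..<?m}" using S(1) single(2) by auto
    ultimately have "induced_matching ?H S" unfolding induced_matching_iff[OF ne] by auto
    then show "maximum_induced_matching ?H k" using S(2) by (auto simp: maximum_induced_matching_def)
  qed
qed

lemma encode_star_in_mim_hypertree:
  assumes "2 \<le> k" "\<And>u. \<not> C u u"
  shows "encode_instance (Suc N) (star_edges N C) k \<in> mim_hypertree \<longleftrightarrow>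
    (\<exists>S\<subseteq>{..<N}. k \<le> card S \<and> (\<forall>u\<in>S. \<forall>v\<in>S. \<not> C u v))"
proof -
  let ?H = "\<lambda>n es. \<lparr>hverts = {..<n}, hedges = es\<rparr> :: nat hypergraph"
  have sub: "\<forall>e\<in>set es. e \<subseteq> {..<n}" if "hypertree (?H n es)" for n es
    using that by (auto simp: hypertree_def is_hypergraph_def)
  have "encode_instance (Suc N) (star_edges N C) k \<in> mim_hypertree \<longleftrightarrow>
    maximum_induced_matching (?H (Suc N) (star_edges N C)) k" (is "?l \<longleftrightarrow> ?r")
  proof
    assume ?l
    then obtain n es k' where eq: "encode_instance (Suc N) (star_edges N C) k = encode_instance n es k'"
      and H: "hypertree (?H n es)" "maximum_induced_matching (?H n es) k'"
      by (auto simp: mim_hypertree_def)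
    show ?r using encode_instance_inject[OF eq sub[OF hypertree_star] sub[OF H(1)]] H(2) by simp
  next
    assume ?r
    then show ?l using hypertree_star[of N C] by (auto simp: mim_hypertree_def)
  qed
  then show ?thesis using maximum_induced_matching_star[of k C N] assms by simp
qed

lemma loop_word_const: "loop_word m (\<lambda>I s. [b])"
  using loop_word_bit[OF loop_fun_const[of m "of_bool b"]] by simp

lemma loop_word_row:
  assumes "loop_fun m N" "loop_pred m (\<lambda>I s. s 0 \<in> E I (\<lambda>n. s (Suc n)))"
  shows "loop_word m (\<lambda>I s. True # map (\<lambda>i. i \<in> E I s) [0..<N I s])"
proof -
  have "loop_word m (\<lambda>I s. [True] @ map (\<lambda>i. i \<in> E I s) [0..<N I s])"
    by (intro loop_word_append loop_word_const loop_word_map assms)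
  then show ?thesis by simp
qed

lemma concat_concat: "concat (concat xss) = concat (map concat xss)"
  by (induction xss) simp_all

lemma loop_word_encode_star:
  assumes N: "loop_fun m (\<lambda>I s. N I)" and k: "loop_fun m (\<lambda>I s. k I)"
    and C: "loop_pred m (\<lambda>I s. C I (s 0) (s 1))"
  shows "loop_word m (\<lambda>I s. encode_instance (Suc (N I)) (star_edges (N I) (C I)) (k I))"
proof -
  let ?row = "\<lambda>I e. True # map (\<lambda>i. i \<in> e) [0..<Suc (N I)]"
  have 1: "loop_word m (\<lambda>I s. ?row I {s 0})"
    by (rule loop_word_row) (simp_all del: upt_Suc, (intro loop_intros N)+)
  have "loop_pred m (\<lambda>I s. s 0 = N I \<or> s 0 = s 2 \<or> s 0 = s 1 \<and> C I (s 2) (s 1))"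
    by (intro loop_intros N loop_fun_subst2[of m "\<lambda>I a b. of_bool (C I a b)", OF C])
  then have 2: "loop_word m (\<lambda>I s. ?row I (spoke (N I) (C I) (s 1) (s 0)))"
    by (intro loop_word_row loop_intros N) (simp add: spoke_def numeral_2_eq_2)
  have "loop_word m (\<lambda>I s. map (\<lambda>i. True) [0..<Suc (N I)] @ [False] @
      (concat (map (\<lambda>u. ?row I {u}) [0..<N I]) @
       concat (map (\<lambda>u. concat (map (\<lambda>v. ?row I (spoke (N I) (C I) u v)) [0..<N I])) [0..<N I])) @
      [False] @ binary (k I))"
    using 1 2
    by (intro loop_word_append loop_word_const loop_word_map loop_word_loop loop_word_binary loop_intros N k) (simp_all del: upt_Suc)
  then show ?thesis
    by (simp add: encode_instance_def star_edges_def map_replicate_const map_concat comp_def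
      concat_concat del: upt_Suc)
qed

section \<open>Turing machine computations as conflict graphs\<close>

definition readings :: "tm \<Rightarrow> (nat \<times> nat list) set" where
  "readings M = {(q, ss). q \<le> tm_halt M \<and> length ss = tm_tapes M \<and> set ss \<subseteq> {..<tm_symbols M}}"

lemma finite_readings: "finite (readings M)"
proof -
  have "readings M = {..tm_halt M} \<times> {ss. set ss \<subseteq> {..<tm_symbols M} \<and> length ss = tm_tapes M}"
    by (auto simp: readings_def)
  then show ?thesis by (simp add: finite_lists_length_eq)
qed

text \<open>A halted machine receives idle actions, so that one rule describes the step at every
  time.\<close>

definition tm_action :: "tm \<Rightarrow> nat \<times> nat list \<Rightarrow> nat \<times> (nat \<times> move) list" where
  "tm_action M = (\<lambda>(q, ss). if q < tm_halt M then tm_delta M q ss else (q, map (\<lambda>a. (a, Stay)) ss))"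

lemma tm_step_action:
  "tm_step M (q, ts) = (case tm_action M (q, map read_tape ts) of (q', as) \<Rightarrow> (q', map2 act_tape as ts))"
  by (simp add: tm_action_def map2_Stay)

lemma tm_action_readings:
  assumes "turing_machine M" "(q, ss) \<in> readings M" "tm_action M (q, ss) = (q', as)"
  shows "q' \<le> tm_halt M" "length as = tm_tapes M" "fst ` set as \<subseteq> {..<tm_symbols M}"
proof -
  have "q' \<le> tm_halt M \<and> length as = tm_tapes M \<and> fst ` set as \<subseteq> {..<tm_symbols M}"
  proof (cases "q < tm_halt M")
    case True
    then have "case tm_delta M q ss of (q', as) \<Rightarrow>
        q' \<le> tm_halt M \<and> length as = tm_tapes M \<and> fst ` set as \<subseteq> {..<tm_symbols M}"
      using assms(1,2) by (simp add: turing_machine_def readings_def)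
    then show ?thesis using assms(3) True by (simp add: tm_action_def)
  next
    case False
    then show ?thesis using assms(2,3) by (auto simp: tm_action_def readings_def)
  qed
  then show "q' \<le> tm_halt M" "length as = tm_tapes M" "fst ` set as \<subseteq> {..<tm_symbols M}" by auto
qed

text \<open>Offset by one to stay in \<open>nat\<close>: the new position plus 1 is the old position
  plus \<open>shift d\<close>.\<close>

fun shift :: "move \<Rightarrow> nat" where
  "shift Move_Left = 0"
| "shift Stay = 1"
| "shift Move_Right = 2"

lemma move_head_shift: "move_head d p = p + int (shift d) - 1"
  by (cases d) auto

lemma read_tape_eq: "read_tape tp = fst tp (snd tp)"
  by (cases tp) simp

lemma readings_tapes:
  assumes "q \<le> tm_halt M" "length ts = tm_tapes M"
    and "\<And>k i. k < tm_tapes M \<Longrightarrow> fst (ts ! k) i < tm_symbols M"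
  shows "(q, map read_tape ts) \<in> readings M"
proof -
  have "set (map read_tape ts) \<subseteq> {..<tm_symbols M}"
  proof
    fix a assume "a \<in> set (map read_tape ts)"
    then obtain k where "k < length ts" "a = read_tape (ts ! k)"
      by (metis in_set_conv_nth length_map nth_map)
    then show "a \<in> {..<tm_symbols M}" using assms(2,3) by (simp add: read_tape_eq)
  qed
  then show ?thesis using assms(1,2) by (simp add: readings_def)
qed

section \<open>The run of a machine in terms of states, tapes and heads\<close>

definition tm_state :: "tm \<Rightarrow> bool list \<Rightarrow> bool list \<Rightarrow> nat \<Rightarrow> nat" where
  "tm_state M x w t = fst ((tm_step M ^^ t) (tm_init M [x, w]))"

definition tm_tape :: "tm \<Rightarrow> bool list \<Rightarrow> bool list \<Rightarrow> nat \<Rightarrow> nat \<Rightarrow> int \<Rightarrow> nat" where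
  "tm_tape M x w t k = fst (snd ((tm_step M ^^ t) (tm_init M [x, w])) ! k)"

definition tm_head :: "tm \<Rightarrow> bool list \<Rightarrow> bool list \<Rightarrow> nat \<Rightarrow> nat \<Rightarrow> int" where
  "tm_head M x w t k = snd (snd ((tm_step M ^^ t) (tm_init M [x, w])) ! k)"

definition tm_reading :: "tm \<Rightarrow> bool list \<Rightarrow> bool list \<Rightarrow> nat \<Rightarrow> nat \<times> nat list" where
  "tm_reading M x w t =
     (tm_state M x w t, map (\<lambda>k. tm_tape M x w t k (tm_head M x w t k)) [0..<tm_tapes M])"

locale two_input_tm =
  fixes M :: tm
  assumes tm: "turing_machine M" and two: "2 \<le> tm_tapes M"
begin

lemma length_tapes_run: "length (snd ((tm_step M ^^ t) (tm_init M [x, w]))) = tm_tapes M"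
  and run_in_readings:
    "(fst ((tm_step M ^^ t) (tm_init M [x, w])),
      map read_tape (snd ((tm_step M ^^ t) (tm_init M [x, w])))) \<in> readings M"
  and tm_tape_less: "k < tm_tapes M \<Longrightarrow> tm_tape M x w t k i < tm_symbols M"
proof -
  let ?c = "\<lambda>t. (tm_step M ^^ t) (tm_init M [x, w])"
  have "fst (?c t) \<le> tm_halt M \<and> length (snd (?c t)) = tm_tapes M \<and>
    (\<forall>k<tm_tapes M. \<forall>i. fst (snd (?c t) ! k) i < tm_symbols M)"
  proof (induction t)
    case 0
    have "3 \<le> tm_symbols M" using tm by (simp add: turing_machine_def)
    then have "fst (input_tape y) i < tm_symbols M" for y i
      by (auto simp: input_tape_def bit_symbol_def)
    then show ?case using two
      by (auto simp: tm_init_def nth_append nth_Cons' map_replicate_const)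
  next
    case (Suc t)
    obtain q ts where c: "?c t = (q, ts)" by (cases "?c t")
    obtain q' as where a: "tm_action M (q, map read_tape ts) = (q', as)" by fastforce
    have "(q, map read_tape ts) \<in> readings M"
      using Suc c by (intro readings_tapes) simp_all
    note act = tm_action_readings[OF tm this a]
    have step: "?c (Suc t) = (q', map2 act_tape as ts)" using c a by (simp add: tm_step_action del: tm_step.simps)
    have "fst (act_tape (as ! k) (ts ! k)) i < tm_symbols M" if "k < tm_tapes M" for k i
    proof -
      obtain b d where as: "as ! k = (b, d)" by (cases "as ! k")
      have "b \<in> fst ` set as" using that act(2) as by (metis fst_conv image_eqI nth_mem)
      then have "b < tm_symbols M" using act(3) by auto
      moreover have "fst (ts ! k) i < tm_symbols M" using Suc c that by auto
      ultimately show ?thesis using as by (cases "ts ! k") auto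
    qed
    moreover have "length ts = tm_tapes M" using Suc c by simp
    ultimately show ?case using act(1,2) unfolding step by simp
  qed
  then show "length (snd (?c t)) = tm_tapes M"
    and "(fst (?c t), map read_tape (snd (?c t))) \<in> readings M"
    and "k < tm_tapes M \<Longrightarrow> tm_tape M x w t k i < tm_symbols M"
    using readings_tapes[of "fst (?c t)" M "snd (?c t)"] by (simp_all add: tm_tape_def)
qed

lemma tm_reading_eq:
  "tm_reading M x w t = (fst ((tm_step M ^^ t) (tm_init M [x, w])),
     map read_tape (snd ((tm_step M ^^ t) (tm_init M [x, w]))))"
proof -
  show ?thesis
    unfolding tm_reading_def tm_state_def tm_tape_def tm_head_def
    by (simp add: list_eq_iff_nth_eq length_tapes_run read_tape_eq)
qed

lemma tm_reading_in: "tm_reading M x w t \<in> readings M"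
  unfolding tm_reading_eq by (rule run_in_readings)

lemma run_Suc:
  "tm_state M x w (Suc t) = fst (tm_action M (tm_reading M x w t))"
  "k < tm_tapes M \<Longrightarrow> tm_tape M x w (Suc t) k =
     (tm_tape M x w t k)(tm_head M x w t k := fst (snd (tm_action M (tm_reading M x w t)) ! k))"
  "k < tm_tapes M \<Longrightarrow> tm_head M x w (Suc t) k =
     tm_head M x w t k + int (shift (snd (snd (tm_action M (tm_reading M x w t)) ! k))) - 1"
proof -
  obtain q ts where c: "(tm_step M ^^ t) (tm_init M [x, w]) = (q, ts)"
    by (cases "(tm_step M ^^ t) (tm_init M [x, w])")
  have rd: "tm_reading M x w t = (q, map read_tape ts)" by (simp add: tm_reading_eq c)
  obtain q' as where a: "tm_action M (q, map read_tape ts) = (q', as)" by fastforce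
  have len: "length ts = tm_tapes M" using length_tapes_run[of t x w] c by simp
  have len': "length as = tm_tapes M" using tm_action_readings(2)[OF tm _ a] tm_reading_in[of x w t] rd by simp
  have step: "(tm_step M ^^ Suc t) (tm_init M [x, w]) = (q', map2 act_tape as ts)"
    using c a by (simp add: tm_step_action del: tm_step.simps)
  show "tm_state M x w (Suc t) = fst (tm_action M (tm_reading M x w t))"
    by (simp only: tm_state_def step rd a fst_conv)
  assume k: "k < tm_tapes M"
  obtain b d where as: "as ! k = (b, d)" by (cases "as ! k")
  obtain f p where ts: "ts ! k = (f, p)" by (cases "ts ! k")
  have nth: "map2 act_tape as ts ! k = (f(p := b), move_head d p)" using k len len' as ts by simp
  show "tm_tape M x w (Suc t) k =
     (tm_tape M x w t k)(tm_head M x w t k := fst (snd (tm_action M (tm_reading M x w t)) ! k))"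
    by (simp only: tm_tape_def tm_head_def step rd a fst_conv snd_conv nth c ts as)
  show "tm_head M x w (Suc t) k =
     tm_head M x w t k + int (shift (snd (snd (tm_action M (tm_reading M x w t)) ! k))) - 1"
    by (simp only: tm_head_def step rd a fst_conv snd_conv nth c ts as move_head_shift)
qed

lemma tm_reading_nth:
  "k < tm_tapes M \<Longrightarrow> snd (tm_reading M x w t) ! k = tm_tape M x w t k (tm_head M x w t k)"
  by (simp add: tm_reading_def)

lemma run_0:
  "tm_state M x w 0 = 0"
  "k < tm_tapes M \<Longrightarrow> tm_head M x w 0 k = 0"
  "k < tm_tapes M \<Longrightarrow> tm_tape M x w 0 k = fst (input_tape (if k = 0 then x else if k = 1 then w else []))"
  using two
  by (auto simp: tm_state_def tm_head_def tm_tape_def tm_init_def nth_Cons' input_tape_def)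

text \<open>This allows positions up to time \<open>T\<close> to be stored as natural numbers after
  adding \<open>T\<close>, with values up to \<open>2 * T\<close>.\<close>

lemma tm_head_bound: "k < tm_tapes M \<Longrightarrow> \<bar>tm_head M x w t k\<bar> \<le> int t"
proof (induction t)
  case (Suc t)
  have "shift d \<le> 2" for d by (cases d) auto
  from this[of "snd (snd (tm_action M (tm_reading M x w t)) ! k)"] show ?case
    using Suc run_Suc(3)[OF Suc.prems, of x w t] by auto
qed (simp add: run_0)

lemma tm_tape_unvisited:
  assumes "k < tm_tapes M"
  shows "(\<And>t'. t0 \<le> t' \<Longrightarrow> t' < t \<Longrightarrow> tm_head M x w t' k \<noteq> i) \<Longrightarrow> t0 \<le> t \<Longrightarrow>
    tm_tape M x w t k i = tm_tape M x w t0 k i"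
proof (induction t)
  case (Suc t)
  show ?case
  proof (cases "t0 = Suc t")
    case False
    then have "tm_tape M x w t k i = tm_tape M x w t0 k i" using Suc by auto
    moreover have "tm_head M x w t k \<noteq> i" using Suc.prems False by auto
    ultimately show ?thesis by (simp add: run_Suc(2)[OF assms])
  qed simp
qed simp

lemma tm_tape_last_visit:
  assumes "k < tm_tapes M" "t0 < t" "tm_head M x w t0 k = i"
    and "\<And>t'. t0 < t' \<Longrightarrow> t' < t \<Longrightarrow> tm_head M x w t' k \<noteq> i"
  shows "tm_tape M x w t k i = fst (snd (tm_action M (tm_reading M x w t0)) ! k)"
proof -
  have "tm_tape M x w t k i = tm_tape M x w (Suc t0) k i"
    using assms by (intro tm_tape_unvisited) auto
  then show ?thesis using assms(1,3) by (simp add: run_Suc(2))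
qed

end

lemma ex_last_visit:
  fixes Q :: "nat \<Rightarrow> bool"
  shows "\<exists>l\<le>t. (\<forall>t'. l = Suc t' \<longrightarrow> Q t') \<and> (\<forall>t'. l \<le> t' \<and> t' < t \<longrightarrow> \<not> Q t')"
proof (induction t)
  case (Suc t)
  then obtain l where l: "l \<le> t" "\<forall>t'. l = Suc t' \<longrightarrow> Q t'" "\<forall>t'. l \<le> t' \<and> t' < t \<longrightarrow> \<not> Q t'"
    by blast
  show ?case
  proof (cases "Q t")
    case True
    then show ?thesis by (intro exI[of _ "Suc t"]) auto
  next
    case False
    then have "\<forall>t'. l \<le> t' \<and> t' < Suc t \<longrightarrow> \<not> Q t'" using l(3) by (auto simp: less_Suc_eq)
    then show ?thesis using l by (intro exI[of _ l]) auto
  qed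
qed auto

text \<open>Position \<open>p\<close> stands for cell \<open>p - T\<close>. On tape 1 either bit is
  accepted in the first \<open>n\<close> cells: here the nondeterministic choice of the witness
  enters.\<close>

definition init_ok :: "bool list \<Rightarrow> nat \<Rightarrow> nat \<Rightarrow> nat \<Rightarrow> nat \<Rightarrow> nat \<Rightarrow> bool" where
  "init_ok x T k p n a \<longleftrightarrow>
     (if k = 0 then a = (if T \<le> p \<and> p < T + length x then (if bit_at x (p - T) then 2 else 1) else 0)
      else if k = 1 then (if T \<le> p \<and> p < T + n then a = 1 \<or> a = 2 else a = 0)
      else a = 0)"

locale tableau = two_input_tm +
  fixes C :: nat and dec :: "nat \<Rightarrow> nat \<times> nat list"
  assumes dec: "bij_betw dec {..<C} (readings M)"
begin

abbreviation K :: nat where "K \<equiv> tm_tapes M"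

text \<open>\<open>st\<close>, \<open>nx\<close>, \<open>sy\<close>, \<open>wt\<close> and
  \<open>mv\<close> give state, next state, symbol read, symbol written and shifted move of a
  numbered reading. The value 0 outside the range makes them finite tables.\<close>

definition st :: "nat \<Rightarrow> nat" where
  "st c = (if c < C then fst (dec c) else 0)"

definition nx :: "nat \<Rightarrow> nat" where
  "nx c = (if c < C then fst (tm_action M (dec c)) else 0)"

definition sy :: "nat \<Rightarrow> nat \<Rightarrow> nat" where
  "sy c k = (if c < C \<and> k < K then snd (dec c) ! k else 0)"

definition wt :: "nat \<Rightarrow> nat \<Rightarrow> nat" where
  "wt c k = (if c < C \<and> k < K then fst (snd (tm_action M (dec c)) ! k) else 0)"

definition mv :: "nat \<Rightarrow> nat \<Rightarrow> nat" where
  "mv c k = (if c < C \<and> k < K then shift (snd (snd (tm_action M (dec c)) ! k)) else 0)"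

text \<open>An entry describes tape \<open>k\<close> at time \<open>t\<close>: \<open>c\<close> is the number of the state and the symbols that
  are read, \<open>p\<close> is the head position plus \<open>T\<close>, \<open>l\<close> is 0 if the cell has not been visited before
  and otherwise one more than the time of the last visit, and \<open>n\<close> is the length of the witness.
  At the additional time \<open>T + 1\<close> all heads are in cell 0, which gives access to the output.\<close>

definition node_ok ::
  "bool list \<Rightarrow> nat \<Rightarrow> nat \<Rightarrow> nat \<Rightarrow> nat \<Rightarrow> nat \<Rightarrow> nat \<Rightarrow> nat \<Rightarrow> nat \<Rightarrow> bool" where
  "node_ok x T P t k c p l n \<longleftrightarrow> t \<le> Suc T \<and> k < K \<and> c < C \<and> l \<le> t \<and> n \<le> P \<and>
     (l = 0 \<longrightarrow> init_ok x T k p n (sy c k)) \<and> (t = 0 \<longrightarrow> p = T \<and> st c = 0) \<and>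
     (t = Suc T \<longrightarrow> p = T \<and> (k = K - 1 \<longrightarrow> sy c k = 2))"

text \<open>The guard \<open>t < T\<close> exempts the jump of the heads to cell 0 at time
  \<open>Suc T\<close>. The last line pins down \<open>l'\<close>: if \<open>l' = Suc t\<close>,
  then time \<open>t\<close> is a visit of the cell, and no time from \<open>l'\<close> up to
  \<open>t' - 1\<close> is one.\<close>

definition link_ok ::
  "nat \<Rightarrow> nat \<Rightarrow> nat \<Rightarrow> nat \<Rightarrow> nat \<Rightarrow> nat \<Rightarrow> nat \<Rightarrow>
   nat \<Rightarrow> nat \<Rightarrow> nat \<Rightarrow> nat \<Rightarrow> nat \<Rightarrow> nat \<Rightarrow> bool" where
  "link_ok T t k c p l n t' k' c' p' l' n' \<longleftrightarrow> n = n' \<and> (t = t' \<longrightarrow> c = c') \<and>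
     (t' = Suc t \<and> t < T \<longrightarrow> st c' = nx c \<and> (k = k' \<longrightarrow> p' + 1 = p + mv c k)) \<and>
     (k = k' \<and> t < t' \<longrightarrow> (l' = Suc t \<longrightarrow> p' = p \<and> sy c' k = wt c k) \<and> (l' \<le> t \<longrightarrow> p' \<noteq> p))"

definition is_tableau where
  "is_tableau x T P c p l n \<longleftrightarrow>
     (\<forall>t\<le>Suc T. \<forall>k<K. node_ok x T P t k (c t k) (p t k) (l t k) (n t k)) \<and>
     (\<forall>t\<le>Suc T. \<forall>k<K. \<forall>t'\<le>Suc T. \<forall>k'<K. link_ok T t k (c t k) (p t k) (l t k) (n t k)
        t' k' (c t' k') (p t' k') (l t' k') (n t' k'))"

lemma run_tableau:
  assumes w: "length w \<le> P" and acc: "tm_tape M x w (Suc T) (K - 1) 0 = 2"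
  shows "\<exists>c p l n. is_tableau x T P c p l n \<and> (\<forall>t\<le>Suc T. \<forall>k<K. p t k \<le> 2 * T)"
proof -
  let ?f = "tm_tape M x w"
  \<comment> \<open>At the additional time \<open>Suc T\<close> the tapes are inspected in cell 0,
    wherever the heads are; the symbols found there still form a reading.\<close>
  define r where "r t = (if t = Suc T then (tm_state M x w t, map (\<lambda>k. ?f t k 0) [0..<K])
    else tm_reading M x w t)" for t
  define g where "g t k = (if t = Suc T then 0 else tm_head M x w t k)" for t k
  have r_in: "r t \<in> readings M" for t
    using tm_reading_in[of x w t] tm_tape_less[of _ x w t 0]
    by (auto simp: r_def readings_def tm_reading_def)
  define c where "c t = inv_into {..<C} dec (r t)" for t
  have c: "c t < C" "dec (c t) = r t" for t
    using bij_betw_inv_into_right[OF dec r_in] bij_betw_apply[OF bij_betw_inv_into[OF dec] r_in[of t]]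
    by (simp_all add: c_def)
  have sy: "sy (c t) k = ?f t k (g t k)" if "k < K" for t k
    using that c by (simp add: sy_def r_def g_def tm_reading_nth)
  have g_bound: "- int T \<le> g t k" "g t k \<le> int T" if "k < K" "t \<le> Suc T" for t k
    using tm_head_bound[OF that(1), of x w t] that(2) by (auto simp: g_def)
  define p where "p t k = nat (g t k + int T)" for t k
  have p: "int (p t k) = g t k + int T" if "k < K" "t \<le> Suc T" for t k
    using g_bound[OF that] by (simp add: p_def)
  define l where "l t k = (SOME l. l \<le> t \<and> (\<forall>t'. l = Suc t' \<longrightarrow> g t' k = g t k) \<and>
      (\<forall>t'. l \<le> t' \<and> t' < t \<longrightarrow> g t' k \<noteq> g t k))" for t k
  have l_all: "l t k \<le> t \<and> (\<forall>t'. l t k = Suc t' \<longrightarrow> g t' k = g t k) \<and>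
      (\<forall>t'. l t k \<le> t' \<and> t' < t \<longrightarrow> g t' k \<noteq> g t k)" for t k
    unfolding l_def by (rule someI_ex[OF ex_last_visit])
  have l: "l t k \<le> t" "l t k = Suc t' \<Longrightarrow> g t' k = g t k"
    "l t k \<le> t' \<Longrightarrow> t' < t \<Longrightarrow> g t' k \<noteq> g t k" for t k t'
    using l_all[of t k] by blast+
  have run: "g t k = tm_head M x w t k" "r t = tm_reading M x w t" if "t \<le> T" for t k
    using that by (auto simp: g_def r_def)
  have "node_ok x T P t k (c t) (p t k) (l t k) (length w)" if t: "t \<le> Suc T" and k: "k < K" for t k
  proof -
    have "init_ok x T k (p t k) (length w) (sy (c t) k)" if l0: "l t k = 0"
    proof -
      have "?f t k (g t k) = ?f 0 k (g t k)"
        using l(3)[of t k] l0 run t by (intro tm_tape_unvisited[OF k]) auto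
      then have sy: "sy (c t) k = fst (input_tape (if k = 0 then x else if k = 1 then w else [])) (g t k)"
        using sy[OF k] run_0(3)[OF k] by simp
      have pg: "T \<le> p t k \<longleftrightarrow> 0 \<le> g t k" "p t k - T = nat (g t k)"
        "p t k < T + m \<longleftrightarrow> g t k < int m" for m
        using p[OF k t] by linarith+
      show ?thesis
        unfolding init_ok_def sy pg
        by (simp add: input_tape_def bit_symbol_def bit_at_def nat_less_iff)
    qed
    moreover have "t = 0 \<longrightarrow> p t k = T \<and> st (c t) = 0"
      using p[OF k t] c[of t] run[of 0] run_0(1)[of x w] run_0(2)[OF k, of x w]
      by (auto simp: st_def tm_reading_def)
    moreover have "t = Suc T \<longrightarrow> p t k = T \<and> (k = K - 1 \<longrightarrow> sy (c t) k = 2)"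
      using sy[OF k, of t] acc by (auto simp: p_def g_def)
    ultimately show ?thesis
      using t k c l(1) w by (simp add: node_ok_def)
  qed
  moreover have "link_ok T t k (c t) (p t k) (l t k) (length w) t' k' (c t') (p t' k') (l t' k') (length w)"
    if t: "t \<le> Suc T" "t' \<le> Suc T" and k: "k < K" "k' < K" for t k t' k'
  proof -
    have step: "st (c t') = nx (c t) \<and> (k = k' \<longrightarrow> p t' k' + 1 = p t k + mv (c t) k)"
      if t': "t' = Suc t" "t < T"
    proof -
      have "st (c t') = nx (c t)"
        using c run t' run_Suc(1)[of x w t] by (simp add: st_def nx_def tm_reading_def)
      moreover have "p (Suc t) k + 1 = p t k + mv (c t) k"
        using p[OF k(1), of t] p[OF k(1), of "Suc t"] run_Suc(3)[OF k(1), of x w t] run[of t] run[of "Suc t"]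
          t' c[of t] k(1)
        by (simp add: mv_def)
      ultimately show ?thesis using t' by blast
    qed
    have visit: "(l t' k' = Suc t \<longrightarrow> p t' k' = p t k \<and> sy (c t') k = wt (c t) k) \<and>
        (l t' k' \<le> t \<longrightarrow> p t' k' \<noteq> p t k)" if "k = k'" "t < t'"
    proof (intro conjI impI)
      assume lt: "l t' k' = Suc t"
      have g: "g t k = g t' k" using l(2)[OF lt] \<open>k = k'\<close> by simp
      show "p t' k' = p t k" using g \<open>k = k'\<close> by (simp add: p_def)
      have "?f t' k (g t' k) = fst (snd (tm_action M (tm_reading M x w t)) ! k)"
      proof (rule tm_tape_last_visit[OF k(1) \<open>t < t'\<close>])
        show "tm_head M x w t k = g t' k" using run(1)[of t k] g t \<open>t < t'\<close> by simp
        fix s assume s: "t < s" "s < t'"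
        then show "tm_head M x w s k \<noteq> g t' k"
          using l(3)[of t' k' s] lt run(1)[of s k] t \<open>k = k'\<close> by simp
      qed
      then show "sy (c t') k = wt (c t) k"
        using sy[OF k(1), of t'] c[of t] run(2)[of t] t \<open>t < t'\<close> k(1) by (simp add: wt_def)
    next
      assume "l t' k' \<le> t"
      then have "g t k \<noteq> g t' k" using l(3)[of t' k' t] \<open>k = k'\<close> \<open>t < t'\<close> by simp
      then show "p t' k' \<noteq> p t k" using p[OF k(1) t(1)] p[OF k(1) t(2)] \<open>k = k'\<close> by auto
    qed
    show ?thesis unfolding link_ok_def
      by (intro conjI[OF refl] conjI impI; (elim conjE)?) (use step visit in simp_all)
  qed
  ultimately have "is_tableau x T P (\<lambda>t k. c t) p l (\<lambda>t k. length w)"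
    unfolding is_tableau_def by blast
  moreover have "p t k \<le> 2 * T" if "t \<le> Suc T" "k < K" for t k
    using p[OF that(2,1)] g_bound[OF that(2,1)] by linarith
  ultimately show ?thesis by blast
qed

text \<open>A witness is assembled from the symbols at first visits on tape 1. Induction on time
  then shows that the tableau describes the run on this very word.\<close>

lemma tableau_run:
  assumes tab: "is_tableau x T P c p l n"
  shows "\<exists>w. length w \<le> P \<and> tm_tape M x w (Suc T) (K - 1) 0 = 2"
proof -
  have K: "0 < K" "1 < K" using two by auto
  have node: "node_ok x T P t k (c t k) (p t k) (l t k) (n t k)" if "t \<le> Suc T" "k < K" for t k
    using tab that by (simp add: is_tableau_def)
  have link: "link_ok T t k (c t k) (p t k) (l t k) (n t k)
        t' k' (c t' k') (p t' k') (l t' k') (n t' k')"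
    if "t \<le> Suc T" "k < K" "t' \<le> Suc T" "k' < K" for t k t' k'
    using tab that by (simp add: is_tableau_def)
  define e where "e t = c t 0" for t
  define d where "d = n 0 0"
  have c: "c t k = e t" if "t \<le> Suc T" "k < K" for t k
    using link[OF that that(1) K(1)] by (simp add: link_ok_def e_def)
  have n: "n t k = d" if "t \<le> Suc T" "k < K" for t k
    using link[OF that _ K(1), of 0] by (simp add: link_ok_def d_def)
  have e: "e t < C" "dec (e t) \<in> readings M" if "t \<le> Suc T" for t
  proof -
    show "e t < C" using node[OF that K(1)] by (simp add: node_ok_def e_def)
    then show "dec (e t) \<in> readings M" using bij_betw_apply[OF dec] by simp
  qed
  have fresh: "p t' k \<noteq> p t k" if "l t k = 0" "t' < t" "t \<le> Suc T" "k < K" for t t' k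
    using link[of t' k t k] that by (simp add: link_ok_def)
  \<comment> \<open>Bits whose cells are never inspected become False; for the others
    \<open>fresh\<close> leaves only one first visit, so the bit is well defined.\<close>
  define w where "w = map (\<lambda>i. \<exists>t\<le>Suc T. p t 1 = T + i \<and> l t 1 = 0 \<and> sy (e t) 1 = 2) [0..<d]"
  let ?f = "tm_tape M x w" and ?h = "tm_head M x w"
  have len: "length w \<le> P" "length w = d"
    using node[of 0 0] K by (simp_all add: w_def d_def node_ok_def)
  have w_nth: "w ! i \<longleftrightarrow> sy (e t) 1 = 2" if "i < d" "t \<le> Suc T" "p t 1 = T + i" "l t 1 = 0" for i t
  proof -
    have uniq: "t' = t" if t': "t' \<le> Suc T" "p t' 1 = T + i" "l t' 1 = 0" for t'
    proof (rule ccontr)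
      assume "t' \<noteq> t"
      then consider "t' < t" | "t < t'" by linarith
      then show False
      proof cases
        case 1
        then show ?thesis using fresh[OF \<open>l t 1 = 0\<close> 1 \<open>t \<le> Suc T\<close> K(2)] t'(2) \<open>p t 1 = T + i\<close> by simp
      next
        case 2
        then show ?thesis using fresh[OF t'(3) 2 t'(1) K(2)] t'(2) \<open>p t 1 = T + i\<close> by simp
      qed
    qed
    have "w ! i \<longleftrightarrow> (\<exists>t\<le>Suc T. p t 1 = T + i \<and> l t 1 = 0 \<and> sy (e t) 1 = 2)"
      using that(1) by (simp add: w_def)
    also have "\<dots> \<longleftrightarrow> sy (e t) 1 = 2" using uniq that(2-4) by metis
    finally show ?thesis .
  qed
  \<comment> \<open>Only agreement with the run at earlier times is assumed. The claim thus serves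
    inside the induction below and once more at time \<open>Suc T\<close>, where the cell
    \<open>i\<close> is 0 and need not be the head position.\<close>
  have read: "?f t k i = sy (e t) k"
    if t: "t \<le> Suc T" and k: "k < K" and i: "int (p t k) = i + int T"
      and inv: "\<And>t'. t' < t \<Longrightarrow> dec (e t') = tm_reading M x w t' \<and> int (p t' k) = ?h t' k + int T"
    for t k i
  proof (cases "l t k")
    case 0
    have "?f t k i = ?f 0 k i"
    proof (rule tm_tape_unvisited[OF k])
      fix t' assume "t' < t"
      show "?h t' k \<noteq> i"
      proof
        assume "?h t' k = i"
        then have "int (p t' k) = int (p t k)" using inv[OF \<open>t' < t\<close>] i by simp
        then show False using fresh[OF 0 \<open>t' < t\<close> t k] by simp
      qed
    qed simp
    also have "\<dots> = fst (input_tape (if k = 0 then x else if k = 1 then w else [])) i"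
      using run_0(3)[OF k] by simp
    also have "\<dots> = sy (e t) k"
    proof -
      have ini: "init_ok x T k (p t k) d (sy (e t) k)"
        using node[OF t k] 0 c[OF t k] n[OF t k] by (simp add: node_ok_def)
      have pg: "T \<le> p t k \<longleftrightarrow> 0 \<le> i" "p t k - T = nat i" "p t k < T + m \<longleftrightarrow> i < int m" for m
        using i by linarith+
      consider "k = 0" | "k = 1" | "k \<noteq> 0" "k \<noteq> 1" by blast
      then show ?thesis
      proof cases
        case 1
        then show ?thesis using ini unfolding init_ok_def pg
          by (auto simp: input_tape_def bit_symbol_def bit_at_def nat_less_iff split: if_splits)
      next
        case 2
        show ?thesis
        proof (cases "0 \<le> i \<and> i < int d")
          case True
          then have "p t 1 = T + nat i" "nat i < d" using i 2 by auto
          from w_nth[OF this(2) t this(1)] 0 2 have "w ! nat i \<longleftrightarrow> sy (e t) 1 = 2" by simp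
          with ini 2 True show ?thesis unfolding init_ok_def pg
            by (auto simp: input_tape_def bit_symbol_def len)
        next
          case False
          then show ?thesis using ini 2 unfolding init_ok_def pg by (auto simp: input_tape_def len)
        qed
      next
        case 3
        then show ?thesis using ini by (simp add: init_ok_def input_tape_def)
      qed
    qed
    finally show ?thesis .
  next
    case (Suc t0)
    have t0: "t0 < t" using node[OF t k] Suc by (simp add: node_ok_def)
    have lk: "p t k = p t0 k" "sy (e t) k = wt (e t0) k"
      using link[of t0 k t k] t t0 k Suc c[of t k] c[of t0 k] by (auto simp: link_ok_def)
    have "?f t k i = fst (snd (tm_action M (tm_reading M x w t0)) ! k)"
    proof (rule tm_tape_last_visit[OF k t0])
      show "?h t0 k = i" using inv[OF t0] lk(1) i by simp
      fix t' assume t': "t0 < t'" "t' < t"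
      then have "p t k \<noteq> p t' k" using link[of t' k t k] t k Suc by (auto simp: link_ok_def)
      then show "?h t' k \<noteq> i" using inv[OF t'(2)] i by auto
    qed
    also have "\<dots> = wt (e t0) k" using inv[OF t0] e[of t0] t t0 k by (simp add: wt_def)
    finally show ?thesis using lk(2) by simp
  qed
  have inv: "dec (e t) = tm_reading M x w t \<and> (\<forall>k<K. int (p t k) = ?h t k + int T)" if "t \<le> T" for t
    using that
  proof (induction t rule: less_induct)
    case (less t)
    then have t: "t \<le> Suc T" by simp
    have sh: "st (e t) = tm_state M x w t \<and> (\<forall>k<K. int (p t k) = ?h t k + int T)"
    proof (cases t)
      case 0
      then show ?thesis
        using node[of 0] K(1) c[of 0] run_0(1)[of x w] run_0(2)[of _ x w] by (auto simp: node_ok_def)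
    next
      case (Suc t0)
      have IH: "dec (e t0) = tm_reading M x w t0" "\<And>k. k < K \<Longrightarrow> int (p t0 k) = ?h t0 k + int T"
        using less.IH[of t0] less.prems Suc by auto
      have t0: "t0 \<le> Suc T" "t0 < T" using less.prems Suc by auto
      have lk: "st (e t) = nx (e t0)" "\<And>k. k < K \<Longrightarrow> p t k + 1 = p t0 k + mv (e t0) k"
        using link[OF t0(1) _ t] K(1) c[OF t0(1)] c[OF t] Suc t0(2) by (auto simp: link_ok_def)
      have "st (e t) = tm_state M x w t"
        using lk(1) e(1)[OF t0(1)] IH(1) Suc run_Suc(1)[of x w t0] by (simp add: nx_def)
      moreover have "int (p t k) = ?h t k + int T" if "k < K" for k
        using lk(2)[OF that] e(1)[OF t0(1)] IH(1) IH(2)[OF that] Suc run_Suc(3)[OF that, of x w t0] that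
        by (simp add: mv_def)
      ultimately show ?thesis by blast
    qed
    have rd: "?f t k (?h t k) = sy (e t) k" if "k < K" for k
      using read[OF t that, of "?h t k"] sh that less by auto
    have "snd (dec (e t)) = map (\<lambda>k. ?f t k (?h t k)) [0..<K]"
      using e[OF t] rd by (auto simp: list_eq_iff_nth_eq readings_def sy_def)
    then have "dec (e t) = tm_reading M x w t"
      using sh e(1)[OF t] by (simp add: tm_reading_def st_def prod_eq_iff)
    then show ?case using sh by blast
  qed
  have "node_ok x T P (Suc T) (K - 1) (e (Suc T)) (p (Suc T) (K - 1)) (l (Suc T) (K - 1)) d"
    using node[of "Suc T" "K - 1"] c[of "Suc T" "K - 1"] n[of "Suc T" "K - 1"] K by simp
  then have "p (Suc T) (K - 1) = T" "sy (e (Suc T)) (K - 1) = 2" by (auto simp: node_ok_def)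
  then have "?f (Suc T) (K - 1) 0 = 2"
    using read[of "Suc T" "K - 1" 0] inv K by (auto simp: less_Suc_eq_le)
  then show ?thesis using len(1) by blast
qed

end

section \<open>Entries of a tableau as digits of a vertex number\<close>

definition dig :: "nat \<Rightarrow> nat \<Rightarrow> nat \<Rightarrow> nat" where
  "dig B j u = u div B ^ j mod B"

lemma loop_fun_dig [loop_intros]: "loop_fun m F \<Longrightarrow> loop_fun m G \<Longrightarrow> loop_fun m (\<lambda>I s. dig (F I s) j (G I s))"
  unfolding dig_def by (intro loop_intros)

lemma ex_digits: "(\<And>j. j < n \<Longrightarrow> f j < B) \<Longrightarrow> \<exists>u<B ^ n. \<forall>j<n. dig B j u = f j"
proof (induction n arbitrary: f)
  case (Suc n)
  obtain u where u: "u < B ^ n" "\<And>j. j < n \<Longrightarrow> dig B j u = f (Suc j)"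
    using Suc.IH[of "\<lambda>j. f (Suc j)"] Suc.prems by auto
  have f0: "f 0 < B" using Suc.prems by simp
  let ?v = "f 0 + B * u"
  have "?v < B * Suc u" using f0 by simp
  also have "\<dots> \<le> B ^ Suc n" using u(1) by (simp only: power_Suc) (intro mult_le_mono, auto)
  finally have "?v < B ^ Suc n" .
  moreover have "?v div B = u" "?v mod B = f 0" using f0 by auto
  then have "dig B j ?v = f j" if "j < Suc n" for j
    using u(2)[of "j - 1"] that by (cases j) (simp_all add: dig_def div_mult2_eq)
  ultimately show ?case by blast
qed simp

lemma ex_digits6:
  assumes "a0 < B" "a1 < B" "a2 < B" "a3 < B" "a4 < B" "a5 < B"
  shows "\<exists>u<B ^ 6. dig B 0 u = a0 \<and> dig B 1 u = a1 \<and> dig B 2 u = a2 \<and> dig B 3 u = a3 \<and>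
    dig B 4 u = a4 \<and> dig B 5 u = a5"
proof -
  let ?f = "\<lambda>j. [a0, a1, a2, a3, a4, a5] ! j"
  have "?f j < B" if "j < 6" for j
    using that assms by (auto simp: numeral_eq_Suc less_Suc_eq)
  from ex_digits[of 6 ?f B, OF this] obtain u where u: "u < B ^ 6" "\<And>j. j < 6 \<Longrightarrow> dig B j u = ?f j"
    by blast
  show ?thesis using u(1) u(2)[of 0] u(2)[of 1] u(2)[of 2] u(2)[of 3] u(2)[of 4] u(2)[of 5]
    by (intro exI[of _ u]) simp
qed

context tableau
begin

lemma link_ok_refl: "link_ok T t k c p l n t k c p l n"
  by (simp add: link_ok_def)

text \<open>Exceeds all six components of an entry that stems from a run: \<open>t\<close> and
  \<open>l\<close> are at most \<open>Suc T\<close>, \<open>k < K\<close>, \<open>c < C\<close>,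
  \<open>p \<le> 2 * T\<close> and \<open>n \<le> P\<close>.\<close>

definition base :: "nat \<Rightarrow> nat \<Rightarrow> nat" where
  "base T P = 2 * T + C + K + P + 5"

definition entry_ok :: "bool list \<Rightarrow> nat \<Rightarrow> nat \<Rightarrow> nat \<Rightarrow> bool" where
  "entry_ok x T P u \<longleftrightarrow> node_ok x T P (dig (base T P) 0 u) (dig (base T P) 1 u) (dig (base T P) 2 u)
     (dig (base T P) 3 u) (dig (base T P) 4 u) (dig (base T P) 5 u)"

definition entries_link :: "nat \<Rightarrow> nat \<Rightarrow> nat \<Rightarrow> nat \<Rightarrow> bool" where
  "entries_link T P u v \<longleftrightarrow> link_ok T
     (dig (base T P) 0 u) (dig (base T P) 1 u) (dig (base T P) 2 u)
     (dig (base T P) 3 u) (dig (base T P) 4 u) (dig (base T P) 5 u)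
     (dig (base T P) 0 v) (dig (base T P) 1 v) (dig (base T P) 2 v)
     (dig (base T P) 3 v) (dig (base T P) 4 v) (dig (base T P) 5 v)"

text \<open>Not every number codes a valid entry; an invalid one conflicts with all other vertices
  and so lies in no independent set with two elements. \<open>u \<noteq> v\<close> provides the
  irreflexivity that the star construction asks for.\<close>

definition conflict :: "bool list \<Rightarrow> nat \<Rightarrow> nat \<Rightarrow> nat \<Rightarrow> nat \<Rightarrow> bool" where
  "conflict x T P u v \<longleftrightarrow> u \<noteq> v \<and> (\<not> entry_ok x T P u \<or> \<not> entry_ok x T P v \<or>
     (dig (base T P) 0 u = dig (base T P) 0 v \<and> dig (base T P) 1 u = dig (base T P) 1 v) \<or>
     \<not> entries_link T P u v \<or> \<not> entries_link T P v u)"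

text \<open>Pigeonhole: the pairs of time and tape are distinct on \<open>S\<close> and range over
  \<open>(T + 2) * K\<close> possibilities, so each pair occurs exactly once and the entries fill a
  tableau.\<close>

lemma independent_imp_tableau:
  assumes "(T + 2) * K \<le> card S" and nc: "\<And>u v. u \<in> S \<Longrightarrow> v \<in> S \<Longrightarrow> \<not> conflict x T P u v"
  shows "\<exists>c p l n. is_tableau x T P c p l n"
proof -
  let ?D = "dig (base T P)"
  define key where "key u = (?D 0 u, ?D 1 u)" for u
  \<comment> \<open>A second element of \<open>S\<close> is what an invalid entry would conflict
    with.\<close>
  have "2 * 2 \<le> (T + 2) * K" using two by (intro mult_le_mono) auto
  then have card: "2 \<le> card S" using assms(1) by simp
  have ok: "entry_ok x T P u" if "u \<in> S" for u
  proof -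
    have "\<not> S \<subseteq> {u}" using card card_mono[of "{u}" S] by auto
    then obtain v where "v \<in> S" "v \<noteq> u" by blast
    then show ?thesis using nc[OF that] by (auto simp: conflict_def)
  qed
  have inj: "inj_on key S" using nc by (auto simp: inj_on_def key_def conflict_def)
  have sub: "key ` S \<subseteq> {..Suc T} \<times> {..<K}"
    using ok by (auto simp: key_def entry_ok_def node_ok_def)
  have "card ({..Suc T} \<times> {..<K}) \<le> card (key ` S)"
    using assms(1) card_image[OF inj] by (simp add: algebra_simps)
  then have img: "key ` S = {..Suc T} \<times> {..<K}"
    using sub by (intro card_seteq) auto
  define a where "a t k = inv_into S key (t, k)" for t k
  have a: "a t k \<in> S" "key (a t k) = (t, k)" if "t \<le> Suc T" "k < K" for t k
  proof -
    have "(t, k) \<in> key ` S" using img that by simp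
    then show "a t k \<in> S" "key (a t k) = (t, k)"
      unfolding a_def by (rule inv_into_into, rule f_inv_into_f)
  qed
  have d01: "?D 0 (a t k) = t" "?D 1 (a t k) = k" if "t \<le> Suc T" "k < K" for t k
    using a(2)[OF that] by (simp_all add: key_def)
  have "is_tableau x T P (\<lambda>t k. ?D 2 (a t k)) (\<lambda>t k. ?D 3 (a t k)) (\<lambda>t k. ?D 4 (a t k)) (\<lambda>t k. ?D 5 (a t k))"
    unfolding is_tableau_def
  proof (intro conjI allI impI)
    fix t k assume tk: "t \<le> Suc T" "k < K"
    then show "node_ok x T P t k (?D 2 (a t k)) (?D 3 (a t k)) (?D 4 (a t k)) (?D 5 (a t k))"
      using ok[OF a(1)[OF tk]] d01[OF tk] by (simp add: entry_ok_def)
    fix t' k' assume tk': "t' \<le> Suc T" "k' < K"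
    have "entries_link T P (a t k) (a t' k')"
    proof (cases "a t k = a t' k'")
      case True
      then show ?thesis by (simp add: entries_link_def link_ok_refl)
    next
      case False
      then show ?thesis using nc[OF a(1)[OF tk] a(1)[OF tk']] by (simp add: conflict_def)
    qed
    then show "link_ok T t k (?D 2 (a t k)) (?D 3 (a t k)) (?D 4 (a t k)) (?D 5 (a t k))
        t' k' (?D 2 (a t' k')) (?D 3 (a t' k')) (?D 4 (a t' k')) (?D 5 (a t' k'))"
      unfolding entries_link_def d01[OF tk] d01[OF tk'] .
  qed
  then show ?thesis by blast
qed

lemma tableau_imp_independent:
  assumes tab: "is_tableau x T P c p l n" and p: "\<forall>t\<le>Suc T. \<forall>k<K. p t k \<le> 2 * T"
  shows "\<exists>S\<subseteq>{..<base T P ^ 6}. (T + 2) * K \<le> card S \<and> (\<forall>u\<in>S. \<forall>v\<in>S. \<not> conflict x T P u v)"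
proof -
  let ?D = "dig (base T P)"
  have node: "node_ok x T P t k (c t k) (p t k) (l t k) (n t k)" if "t \<le> Suc T" "k < K" for t k
    using tab that by (simp add: is_tableau_def)
  have link: "link_ok T t k (c t k) (p t k) (l t k) (n t k)
        t' k' (c t' k') (p t' k') (l t' k') (n t' k')"
    if "t \<le> Suc T" "k < K" "t' \<le> Suc T" "k' < K" for t k t' k'
    using tab that by (simp add: is_tableau_def)
  have "\<exists>u<base T P ^ 6. ?D 0 u = t \<and> ?D 1 u = k \<and> ?D 2 u = c t k \<and> ?D 3 u = p t k \<and>
      ?D 4 u = l t k \<and> ?D 5 u = n t k" if "t \<le> Suc T" "k < K" for t k
  proof (rule ex_digits6)
    have "p t k \<le> 2 * T" using p that by simp
    then show "t < base T P" "k < base T P" "c t k < base T P" "p t k < base T P" "l t k < base T P"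
      "n t k < base T P"
      using node[OF that] by (simp_all add: node_ok_def base_def)
  qed
  then obtain a where a: "\<And>t k. t \<le> Suc T \<Longrightarrow> k < K \<Longrightarrow> a t k < base T P ^ 6 \<and> ?D 0 (a t k) = t \<and>
      ?D 1 (a t k) = k \<and> ?D 2 (a t k) = c t k \<and> ?D 3 (a t k) = p t k \<and>
      ?D 4 (a t k) = l t k \<and> ?D 5 (a t k) = n t k"
    by metis
  let ?X = "{..Suc T} \<times> {..<K}"
  let ?S = "(\<lambda>(t, k). a t k) ` ?X"
  have "inj_on (\<lambda>(t, k). a t k) ?X"
  proof (rule inj_onI, clarsimp)
    fix t k t' k' assume "t \<le> Suc T" "k < K" "t' \<le> Suc T" "k' < K" "a t k = a t' k'"
    then show "t = t' \<and> k = k'" using a[of t k] a[of t' k'] by metis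
  qed
  then have "card ?S = (T + 2) * K" by (simp add: card_image)
  moreover have "?S \<subseteq> {..<base T P ^ 6}" using a by auto
  moreover have "\<not> conflict x T P u v" if "u \<in> ?S" "v \<in> ?S" for u v
  proof -
    obtain t k where u: "u = a t k" and tk: "t \<le> Suc T" "k < K" using \<open>u \<in> ?S\<close> by auto
    obtain t' k' where v: "v = a t' k'" and tk': "t' \<le> Suc T" "k' < K" using \<open>v \<in> ?S\<close> by auto
    have "entry_ok x T P u" "entry_ok x T P v"
      unfolding entry_ok_def u v using a[OF tk] a[OF tk'] node[OF tk] node[OF tk'] by simp_all
    moreover have "entries_link T P u v" "entries_link T P v u"
      unfolding entries_link_def u v using a[OF tk] a[OF tk'] link[OF tk tk'] link[OF tk' tk] by simp_all
    moreover have "u = v" if "?D 0 u = ?D 0 v" "?D 1 u = ?D 1 v"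
      using that a[OF tk] a[OF tk'] u v by simp
    ultimately show ?thesis unfolding conflict_def by blast
  qed
  ultimately show ?thesis by (intro exI[of _ ?S]) simp
qed

lemma independent_iff_accepts:
  "(\<exists>S\<subseteq>{..<base T P ^ 6}. (T + 2) * K \<le> card S \<and> (\<forall>u\<in>S. \<forall>v\<in>S. \<not> conflict x T P u v)) \<longleftrightarrow>
   (\<exists>w. length w \<le> P \<and> tm_tape M x w (Suc T) (K - 1) 0 = 2)" (is "?l \<longleftrightarrow> ?r")
proof
  assume ?l
  then obtain S where S: "(T + 2) * K \<le> card S" "\<And>u v. u \<in> S \<Longrightarrow> v \<in> S \<Longrightarrow> \<not> conflict x T P u v"
    by blast
  obtain c p l n where "is_tableau x T P c p l n" using independent_imp_tableau[OF S] by blast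
  then show ?r by (rule tableau_run)
next
  assume ?r
  then obtain w where w: "length w \<le> P" "tm_tape M x w (Suc T) (K - 1) 0 = 2" by blast
  obtain c p l n where "is_tableau x T P c p l n" "\<forall>t\<le>Suc T. \<forall>k<K. p t k \<le> 2 * T"
    using run_tableau[OF w] by blast
  then show ?l by (rule tableau_imp_independent)
qed

lemma loop_fun_st [loop_intros]: "loop_fun m F \<Longrightarrow> loop_fun m (\<lambda>I s. st (F I s))"
  unfolding st_def by (rule loop_fun_finite_table)

lemma loop_fun_nx [loop_intros]: "loop_fun m F \<Longrightarrow> loop_fun m (\<lambda>I s. nx (F I s))"
  unfolding nx_def by (rule loop_fun_finite_table)

lemma loop_fun_sy [loop_intros]: "loop_fun m F \<Longrightarrow> loop_fun m G \<Longrightarrow> loop_fun m (\<lambda>I s. sy (F I s) (G I s))"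
  unfolding sy_def by (rule loop_fun_finite_table2)

lemma loop_fun_wt [loop_intros]: "loop_fun m F \<Longrightarrow> loop_fun m G \<Longrightarrow> loop_fun m (\<lambda>I s. wt (F I s) (G I s))"
  unfolding wt_def by (rule loop_fun_finite_table2)

lemma loop_fun_mv [loop_intros]: "loop_fun m F \<Longrightarrow> loop_fun m G \<Longrightarrow> loop_fun m (\<lambda>I s. mv (F I s) (G I s))"
  unfolding mv_def by (rule loop_fun_finite_table2)

lemma loop_pred_node_ok [loop_intros]:
  assumes "0 < m" "loop_fun m T" "loop_fun m P" "loop_fun m t" "loop_fun m k" "loop_fun m c" "loop_fun m p" "loop_fun m l" "loop_fun m n"
  shows "loop_pred m (\<lambda>I s. node_ok (I ! 0) (T I s) (P I s) (t I s) (k I s) (c I s) (p I s) (l I s) (n I s))"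
  unfolding node_ok_def init_ok_def by (intro loop_intros assms)

lemma loop_pred_link_ok [loop_intros]:
  assumes "loop_fun m T" "loop_fun m t" "loop_fun m k" "loop_fun m c" "loop_fun m p" "loop_fun m l" "loop_fun m n"
    "loop_fun m t'" "loop_fun m k'" "loop_fun m c'" "loop_fun m p'" "loop_fun m l'" "loop_fun m n'"
  shows "loop_pred m (\<lambda>I s. link_ok (T I s) (t I s) (k I s) (c I s) (p I s) (l I s) (n I s)
     (t' I s) (k' I s) (c' I s) (p' I s) (l' I s) (n' I s))"
  unfolding link_ok_def by (intro loop_intros assms)

lemma loop_fun_base [loop_intros]: "loop_fun m T \<Longrightarrow> loop_fun m P \<Longrightarrow> loop_fun m (\<lambda>I s. base (T I s) (P I s))"
  unfolding base_def by (intro loop_intros)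

lemma loop_pred_conflict [loop_intros]:
  assumes "0 < m" "loop_fun m T" "loop_fun m P" "loop_fun m u" "loop_fun m v"
  shows "loop_pred m (\<lambda>I s. conflict (I ! 0) (T I s) (P I s) (u I s) (v I s))"
  unfolding conflict_def entry_ok_def entries_link_def by (intro loop_intros assms)

end

text \<open>A halted configuration persists, so one fixed late time serves to inspect the output for
  all witnesses.\<close>

lemma tm_computes_output:
  assumes tm: "two_input_tm M" and comp: "tm_computes M [x, w] [b] t0" and "t0 \<le> t"
  shows "tm_tape M x w t (tm_tapes M - 1) 0 = bit_symbol b"
proof -
  obtain q ts where c: "(tm_step M ^^ t0) (tm_init M [x, w]) = (q, ts)"
    by (cases "(tm_step M ^^ t0) (tm_init M [x, w])")
  have halt: "q = tm_halt M" and out: "tape_holds (last ts) [b]"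
    using comp c by (auto simp: tm_computes_def)
  have "(tm_step M ^^ (t - t0 + t0)) (tm_init M [x, w]) = (q, ts)"
    unfolding funpow_add using c halt by (simp add: tm_steps_halted)
  then have run: "(tm_step M ^^ t) (tm_init M [x, w]) = (q, ts)" using \<open>t0 \<le> t\<close> by simp
  have len: "length ts = tm_tapes M"
    using two_input_tm.length_tapes_run[OF tm, of t x w] run by simp
  moreover have "2 \<le> tm_tapes M" using tm by (simp add: two_input_tm_def)
  ultimately have "last ts = ts ! (tm_tapes M - 1)" by (subst last_conv_nth) auto
  then show ?thesis using out run by (simp add: tm_tape_def tape_holds_def)
qed

lemma mim_hypertree_NP_hard: "NP_hard mim_hypertree"
  unfolding NP_hard_def
proof (intro allI impI)
  fix L assume "in_NP L"
  then obtain R and p q :: "nat poly" and M where M: "turing_machine M"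
    and R: "\<And>x w. tm_computes M [x, w] [R x w] (poly q (length x + length w))"
    and L: "\<And>x. x \<in> L \<longleftrightarrow> (\<exists>w. length w \<le> poly p (length x) \<and> R x w)"
    unfolding in_NP_def polytime_relation_def by metis
  have "2 \<le> tm_tapes M" using R[of "[]" "[]"] by (simp add: tm_computes_def)
  then have two_input: "two_input_tm M" using M by (simp add: two_input_tm_def)
  \<comment> \<open>\<open>M\<close> does not depend on the input, so an arbitrary numbering of its
    readings may be fixed; the tables built from it are constants of the reduction.\<close>
  obtain dec where "bij_betw dec {0..<card (readings M)} (readings M)"
    using ex_bij_betw_nat_finite[OF finite_readings] by blast
  then interpret tableau M "card (readings M)" dec
    by (intro tableau.intro two_input tableau_axioms.intro) (simp add: lessThan_atLeast0)
  define P where "P x = poly p (length x)" for x :: "bool list"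
  \<comment> \<open>By monotonicity of \<open>q\<close> this bounds the running time for all
    witnesses of length at most \<open>P x\<close> together.\<close>
  define T where "T x = poly q (length x + P x)" for x :: "bool list"
  define N where "N x = base (T x) (P x) ^ 6" for x
  define f where "f x = encode_instance (Suc (N x)) (star_edges (N x) (conflict x (T x) (P x)))
    ((T x + 2) * K)" for x
  have "x \<in> L \<longleftrightarrow> f x \<in> mim_hypertree" for x
  proof -
    have acc: "R x w \<longleftrightarrow> tm_tape M x w (Suc (T x)) (K - 1) 0 = 2" if "length w \<le> P x" for w
    proof -
      have "poly q (length x + length w) \<le> Suc (T x)"
        using that unfolding T_def by (intro le_SucI poly_nat_mono) simp
      from tm_computes_output[OF two_input R this] show ?thesis by (simp add: bit_symbol_def)
    qed
    have "2 * 1 \<le> (T x + 2) * K" using \<open>2 \<le> tm_tapes M\<close> by (intro mult_le_mono) auto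
    then have "f x \<in> mim_hypertree \<longleftrightarrow> (\<exists>S\<subseteq>{..<N x}. (T x + 2) * K \<le> card S \<and>
        (\<forall>u\<in>S. \<forall>v\<in>S. \<not> conflict x (T x) (P x) u v))"
      unfolding f_def by (intro encode_star_in_mim_hypertree) (auto simp: conflict_def)
    also have "\<dots> \<longleftrightarrow> (\<exists>w. length w \<le> P x \<and> tm_tape M x w (Suc (T x)) (K - 1) 0 = 2)"
      unfolding N_def by (rule independent_iff_accepts)
    also have "\<dots> \<longleftrightarrow> x \<in> L" using acc unfolding L P_def[symmetric] by blast
    finally show ?thesis ..
  qed
  moreover have "polytime_function f"
  proof (rule loop_word_polytime_function)
    have P: "loop_fun 1 (\<lambda>I s. P (I ! 0))" unfolding P_def by (intro loop_intros) simp
    have T: "loop_fun 1 (\<lambda>I s. T (I ! 0))" unfolding T_def by (intro loop_intros P) simp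
    show "loop_word 1 (\<lambda>I s. f (I ! 0))"
      unfolding f_def
    proof (rule loop_word_encode_star)
      show "loop_fun 1 (\<lambda>I s. N (I ! 0))" unfolding N_def by (intro loop_intros P T)
      show "loop_fun 1 (\<lambda>I s. (T (I ! 0) + 2) * K)" by (intro loop_intros T)
      show "loop_pred 1 (\<lambda>I s. conflict (I ! 0) (T (I ! 0)) (P (I ! 0)) (s 0) (s 1))"
        by (intro loop_intros P T) simp
    qed
  qed simp
  ultimately show "polytime_reducible L mim_hypertree"
    unfolding polytime_reducible_def by blast
qed

theorem theorem8: "NP_complete mim_hypertree"
  unfolding NP_complete_def using mim_hypertree_in_NP mim_hypertree_NP_hard by blast

end
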